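(* Let $f:\mathbb{R}^n\to\mathbb{R}$ be $L$-smooth and $\mu$-strongly convex ($\mu>0$), let $g$ be convex, proper and lower semicontinuous on $\mathbb{R}^n$, and let $x^\star$ be the unique minimizer of $f+g$. Consider the ARPSD algorithm under the following randomness assumption: for all $k>0$, $\mathfrak{S}^k$ is $\mathcal{F}^k$-measurable and admissible; if $k\notin\mathsf{L}$, the selections are independent and identically distributed on $[k_\ell,k]$; and the decision to adapt or not at time $k$ is $\mathcal{F}^k$-measurable, i.e. $(k_\ell)_\ell$ is a sequence of $\mathcal{F}^k$-stopping times. Take $\gamma\in(0,2/(\mu+L)]$, choose $\lambda>0$, and set $\beta=\gamma\mu L\lambda/(\mu+L)$. Consider the following adaptation strategy: 1) from the observation of $x^{k_{\ell-1}}$, choose a new sampling with $\mathsf{P}_\ell$ and $\mathsf{Q}_\ell$ such that $\lambda_{\min}(\mathsf{P}_\ell)\ge\lambda$; 2) compute $\mathbf{c}_\ell$ so that $\|\mathsf{Q}_\ell\mathsf{Q}_{\ell-1}^{-1}\|_2^2\,(1-\alpha_{\ell-1})^{\mathbf{c}_\ell}\le1-\beta$, where $\alpha_{\ell-1}=2\gamma\mu L\lambda_{\min}(\mathsf{P}_{\ell-1})/(\mu+L)$; 3) apply the new sampling after $\mathbf{c}_\ell$ iterations ($k_\ell=k_{\ell-1}+\mathbf{c}_\ell$). Then, for any $k\in[k_\ell,k_{\ell+1})$, $$\mathbb{E}\left[\|x^{k+1}-x^\star\|_2^2\right]\le(1-\alpha_\ell)^{k-k_\ell}(1-\beta)^\ell\,\|z^0-\mathsf{Q}_0(x^\star-\gamma\nabla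 f(x^\star))\|_2^2.$$
   Context: A family $\mathcal{C}=\{\mathcal{C}_i\}_i$ of linear subspaces of $\mathbb{R}^n$ is covering if $\sum_i\mathcal{C}_i=\mathbb{R}^n$. A selection $\mathfrak{S}$ from a covering family $\mathcal{C}$ is a random subspace: a random subset $\omega=\{\mathcal{C}_{i_1},\ldots,\mathcal{C}_{i_s}\}$ of $\mathcal{C}$ is drawn and $\mathfrak{S}(\omega)=\sum_{j=1}^s\mathcal{C}_{i_j}$. It is admissible if $\mathbb{P}[x\in\mathfrak{S}^\perp]<1$ for all $x\in\mathbb{R}^n\setminus\{0\}$. $P_F$ denotes the orthogonal projection matrix onto the subspace $F$. The average projection matrix of an admissible selection, $\mathbb{E}[P_{\mathfrak{S}}]$, is positive definite. $\mathbf{prox}_{\gamma g}(x)=\mathrm{argmin}_{y\in\mathbb{R}^n}\{g(y)+\frac{1}{2\gamma}\|y-x\|_2^2\}$. "$L$-smooth" means differentiable with $L$-Lipschitz gradient. $\|\cdot\|_2$ is the Euclidean norm of vectors and the spectral norm of matrices. ARPSD algorithm (Adaptive Randomized Proximal Subspace Descent) with stepsize $\gamma$: start from a (deterministic) $z^0\in\mathbb{R}^n$, an initial admissible selection with average projection $\mathsf{P}_0$ and $\mathsf{Q}_0=\mathsf{P}_0^{-1/2}$, $x^1=\mathbf{prox}_{\gamma g}(\mathsf{Q}_0^{-1}z^0)$, $\ell=0$, $\mathsf{L}=\{0\}$. For $k=1,2,\ldots$: $$y^k=\mathsf{Q}_\ell(x^k-\gamma\nabla f(x^k)),\qquad z^k=P_{\mathfrak{S}^k}(y^k)+(I-P_{\mathfrak{S}^k})(z^{k-1}),\qquad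 x^{k+1}=\mathbf{prox}_{\gamma g}(\mathsf{Q}_\ell^{-1}(z^k));$$ then, if an adaptation is decided: $\mathsf{L}\leftarrow\mathsf{L}\cup\{k+1\}$, $\ell\leftarrow\ell+1$; a new admissible selection is generated, with average projection $\mathsf{P}_\ell$ (the expected projection matrix under the selection law used during cycle $\ell$, given the past); $\mathsf{Q}_\ell=\mathsf{P}_\ell^{-1/2}$ and $\mathsf{Q}_\ell^{-1}$ are computed; and $z^k$ is rescaled: $z^k\leftarrow\mathsf{Q}_\ell\mathsf{Q}_{\ell-1}^{-1}z^k$. $\mathsf{L}$ is the set of adaptation times; its elements are listed increasingly as $k_0=0$ and $k_\ell=\min\{k>k_{\ell-1}:k\in\mathsf{L}\}$. $\mathcal{F}^k$ is the sigma-algebra generated by the selections $\mathfrak{S}^j$, $j\le k$.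
   Formalization: The first cycle lasts c_1 iterations, so k_1 = c_1+1, since k_1 = k_0+c_1 makes the bound false; as α_ℓ, k_ℓ may be random, the bound is stated with any a.s. deterministic bound r on the factor, and with the factor dividing inside the expectation. *)

theory Defs
  imports "HOL-Probability.Probability"
begin

section \<open>Smooth and convex functions, proximal operator\<close>

definition grad :: "('a::euclidean_space \<Rightarrow> real) \<Rightarrow> 'a \<Rightarrow> 'a" where
  "grad f x = (THE D. GDERIV f x :> D)"

definition L_smooth :: "real \<Rightarrow> ('a::euclidean_space \<Rightarrow> real) \<Rightarrow> bool" where
  "L_smooth L f \<longleftrightarrow> (\<forall>x. f differentiable (at x)) \<and> L-lipschitz_on UNIV (grad f)"

definition strongly_convex :: "real \<Rightarrow> ('a::euclidean_space \<Rightarrow> real) \<Rightarrow> bool" where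
  "strongly_convex \<mu> f \<longleftrightarrow> convex_on UNIV (\<lambda>x. f x - \<mu> / 2 * (norm x)\<^sup>2)"

definition proper_fun :: "('a \<Rightarrow> ereal) \<Rightarrow> bool" where
  "proper_fun g \<longleftrightarrow> (\<forall>x. g x \<noteq> -\<infinity>) \<and> (\<exists>x. g x \<noteq> \<infinity>)"

text \<open>Only meaningful for functions that do not take the value \<open>-\<infinity>\<close>.\<close>

definition convex_fun :: "('a::real_vector \<Rightarrow> ereal) \<Rightarrow> bool" where
  "convex_fun g \<longleftrightarrow> (\<forall>x y. \<forall>t\<in>{0<..<1}.
     g ((1 - t) *\<^sub>R x + t *\<^sub>R y) \<le> ereal (1 - t) * g x + ereal t * g y)"

definition lower_semicont :: "('a::topological_space \<Rightarrow> ereal) \<Rightarrow> bool" where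
  "lower_semicont g \<longleftrightarrow> (\<forall>x. g x \<le> Liminf (at x) g)"

definition prox :: "real \<Rightarrow> ('a::euclidean_space \<Rightarrow> ereal) \<Rightarrow> 'a \<Rightarrow> 'a" where
  "prox \<gamma> g x = arg_min (\<lambda>y. g y + ereal (1 / (2 * \<gamma>) * (norm (y - x))\<^sup>2)) (\<lambda>_. True)"

section \<open>Matrices\<close>

definition eigenvalues :: "real^'n^'n \<Rightarrow> real set" where
  "eigenvalues A = {e. \<exists>v. v \<noteq> 0 \<and> A *v v = e *\<^sub>R v}"

definition lambda_min :: "real^'n^'n \<Rightarrow> real" where
  "lambda_min A = Min (eigenvalues A)"

definition pos_semidef :: "real^'n^'n \<Rightarrow> bool" where
  "pos_semidef A \<longleftrightarrow> transpose A = A \<and> (\<forall>x. 0 \<le> x \<bullet> (A *v x))"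

definition mat_sqrt :: "real^'n^'n \<Rightarrow> real^'n^'n" where
  "mat_sqrt A = (THE B. pos_semidef B \<and> B ** B = A)"

definition inv_sqrt :: "real^'n^'n \<Rightarrow> real^'n^'n" where
  "inv_sqrt A = matrix_inv (mat_sqrt A)"

definition spectral_norm :: "real^'n^'n \<Rightarrow> real" where
  "spectral_norm A = onorm ((*v) A)"

text \<open>On a subspace the nearest-point map is the orthogonal projection.\<close>

definition orth_proj :: "(real^'n) set \<Rightarrow> real^'n^'n" where
  "orth_proj F = matrix (closest_point F)"

section \<open>Random subspaces\<close>

definition covering :: "(real^'n) set set \<Rightarrow> bool" where
  "covering C \<longleftrightarrow> (\<forall>F\<in>C. subspace F) \<and> span (\<Union>C) = UNIV"

text \<open>The sum of finitely many subspaces is the span of their union.\<close>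

definition subfamily_sums :: "(real^'n) set set \<Rightarrow> (real^'n) set set" where
  "subfamily_sums C = {span (\<Union>J) |J. finite J \<and> J \<subseteq> C}"

text \<open>The \<open>\<sigma>\<close>-algebra on the set of all subspaces for which a random subspace is measurable iff
  its projection matrix is. For a random subspace taking finitely many values it induces the
  same \<open>\<sigma>\<close>-algebra as the discrete one.\<close>

definition subspace_algebra :: "(real^'n) set measure" where
  "subspace_algebra = vimage_algebra {F. subspace F} orth_proj borel"

text \<open>The next two notions are properties of the law \<open>\<nu>\<close> of a random subspace.\<close>

definition avg_proj :: "(real^'n) set measure \<Rightarrow> real^'n^'n" where
  "avg_proj \<nu> = (\<integral>F. orth_proj F \<partial>\<nu>)"

definition admissible :: "(real^'n) set measure \<Rightarrow> bool" where
  "admissible \<nu> \<longleftrightarrow> (\<forall>x. x \<noteq> 0 \<longrightarrow> measure \<nu> {F \<in> space \<nu>. x \<in> orthogonal_comp F} < 1)"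

text \<open>Selections are numbered from 1 on, so the \<open>\<sigma>\<close>-algebra with index 0 is trivial.\<close>

definition sel_filtration ::
  "'w measure \<Rightarrow> (nat \<Rightarrow> 'w \<Rightarrow> (real^'n) set) \<Rightarrow> nat \<Rightarrow> 'w measure" where
  "sel_filtration M S k = sigma (space M)
     {S j -` B \<inter> space M |j B. 1 \<le> j \<and> j \<le> k \<and> B \<in> sets subspace_algebra}"

section \<open>The algorithm\<close>

text \<open>One path of the algorithm, for given matrices \<open>Q l\<close>, subspaces \<open>S k\<close> and set of adaptation
  times \<open>A\<close>. The value at \<open>k\<close> is the state at the end of iteration \<open>k\<close>: the point
  \<open>x\<close> with index \<open>k + 1\<close>, the vector \<open>z\<close> with index \<open>k\<close> (after rescaling, if there was an
  adaptation), and the current cycle number. Adapting at the end of iteration \<open>k\<close> means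
  that \<open>k + 1 \<in> A\<close>.\<close>

primrec arpsd ::
  "(real^'n \<Rightarrow> real) \<Rightarrow> (real^'n \<Rightarrow> ereal) \<Rightarrow> real \<Rightarrow> (nat \<Rightarrow> real^'n^'n) \<Rightarrow>
   (nat \<Rightarrow> (real^'n) set) \<Rightarrow> nat set \<Rightarrow> real^'n \<Rightarrow> nat \<Rightarrow> (real^'n) \<times> (real^'n) \<times> nat" where
  "arpsd f g \<gamma> Q S A z0 0 = (prox \<gamma> g (matrix_inv (Q 0) *v z0), z0, 0)"
| "arpsd f g \<gamma> Q S A z0 (Suc k) =
    (case arpsd f g \<gamma> Q S A z0 k of (x, z, l) \<Rightarrow>
      let P = orth_proj (S (Suc k));
          y = Q l *v (x - \<gamma> *\<^sub>R grad f x);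
          z' = P *v y + (mat 1 - P) *v z;
          x' = prox \<gamma> g (matrix_inv (Q l) *v z')
      in if Suc (Suc k) \<in> A
         then (x', (Q (Suc l) ** matrix_inv (Q l)) *v z', Suc l)
         else (x', z', l))"

text \<open>\<open>enumerate A l\<close> is the \<open>l\<close>-th adaptation time; the cycle of \<open>k\<close> is the \<open>l\<close> such that
  \<open>k\<close> lies between the \<open>l\<close>-th (included) and the next one (excluded).\<close>

definition cycle :: "nat set \<Rightarrow> nat \<Rightarrow> nat" where
  "cycle A k = (THE l. enumerate A l \<le> k \<and> k < enumerate A (Suc l))"

text \<open>The laws \<open>law l \<omega>\<close> of the selections in cycle \<open>l\<close> may depend on the past. Hence ``i.i.d. during
  a cycle'' reads: given the past, every selection of cycle \<open>l\<close> is a fresh draw from \<open>law l\<close>.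
  For deterministic laws this is independence from the past together with equality of laws.
  The initial law \<open>\<nu>0\<close> is deterministic. The requirement \<open>1 \<notin> A \<omega>\<close> holds because the first iteration has number 1.\<close>

definition arpsd_randomness ::
  "'w measure \<Rightarrow> (real^'n) set set \<Rightarrow> (nat \<Rightarrow> 'w \<Rightarrow> (real^'n) set) \<Rightarrow>
   (real^'n) set measure \<Rightarrow> (nat \<Rightarrow> 'w \<Rightarrow> (real^'n) set measure) \<Rightarrow> ('w \<Rightarrow> nat set) \<Rightarrow> bool"
  where
  "arpsd_randomness M C S \<nu>0 law A \<longleftrightarrow>
     (\<forall>k\<ge>1. S k \<in> measurable M subspace_algebra \<and> (\<forall>\<omega>\<in>space M. S k \<omega> \<in> subfamily_sums C)) \<and>
     (\<forall>l. \<forall>\<omega>\<in>space M. law l \<omega> \<in> space (prob_algebra subspace_algebra) \<and> admissible (law l \<omega>)) \<and>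
     (\<forall>\<omega>\<in>space M. law 0 \<omega> = \<nu>0) \<and>
     (\<forall>k. \<forall>B\<in>sets subspace_algebra. AE \<omega> in M.
        real_cond_exp M (sel_filtration M S k) (indicator {\<omega>\<in>space M. S (Suc k) \<omega> \<in> B}) \<omega>
          = measure (law (cycle (A \<omega>) (Suc k)) \<omega>) B) \<and>
     (\<forall>\<omega>\<in>space M. 0 \<in> A \<omega> \<and> 1 \<notin> A \<omega>) \<and>
     (\<forall>k\<ge>1. Measurable.pred (sel_filtration M S k) (\<lambda>\<omega>. Suc k \<in> A \<omega>)) \<and>
     (\<forall>l. stopping_time (sel_filtration M S) (\<lambda>\<omega>. enumerate (A \<omega>) l))"

definition alpha :: "real \<Rightarrow> real \<Rightarrow> real \<Rightarrow> real^'n^'n \<Rightarrow> real" where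
  "alpha \<gamma> \<mu> L P = 2 * \<gamma> * \<mu> * L * lambda_min P / (\<mu> + L)"

text \<open>The new law is chosen from what is known at the previous adaptation time. It is applied after
  \<open>c (Suc l) \<omega>\<close> iterations of cycle \<open>l\<close>. The first iteration of cycle \<open>l\<close> is the \<open>l\<close>-th
  adaptation time, except that cycle 0 starts with iteration 1 although its adaptation time is 0;
  hence the maximum.\<close>

definition adaptation_strategy ::
  "real \<Rightarrow> real \<Rightarrow> real \<Rightarrow> real \<Rightarrow> real \<Rightarrow> 'w measure \<Rightarrow> (nat \<Rightarrow> 'w \<Rightarrow> (real^'n) set) \<Rightarrow>
   (nat \<Rightarrow> 'w \<Rightarrow> (real^'n) set measure) \<Rightarrow> ('w \<Rightarrow> nat set) \<Rightarrow> (nat \<Rightarrow> 'w \<Rightarrow> nat) \<Rightarrow> bool" where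
  "adaptation_strategy \<gamma> \<mu> L lam \<beta> M S law A c \<longleftrightarrow>
     (\<forall>\<omega>\<in>space M. infinite (A \<omega>)) \<and>
     (\<forall>l. law (Suc l) \<in> measurable
            (filtration.pre_sigma (space M) (sel_filtration M S) (\<lambda>\<omega>. enumerate (A \<omega>) l))
            (prob_algebra subspace_algebra)) \<and>
     (\<forall>l. \<forall>\<omega>\<in>space M. lam \<le> lambda_min (avg_proj (law (Suc l) \<omega>))) \<and>
     (\<forall>l. \<forall>\<omega>\<in>space M.
        (spectral_norm (inv_sqrt (avg_proj (law (Suc l) \<omega>))
            ** matrix_inv (inv_sqrt (avg_proj (law l \<omega>)))))\<^sup>2
          * (1 - alpha \<gamma> \<mu> L (avg_proj (law l \<omega>))) ^ c (Suc l) \<omega> \<le> 1 - \<beta>) \<and>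
     (\<forall>l. \<forall>\<omega>\<in>space M.
        enumerate (A \<omega>) (Suc l) = max 1 (enumerate (A \<omega>) l) + c (Suc l) \<omega>)"

text \<open>The factor of the initial error in the bound for an index \<open>k\<close> in cycle \<open>l\<close>. It depends on the
  path through the laws and the adaptation times.\<close>

definition rate_factor ::
  "real \<Rightarrow> real \<Rightarrow> real \<Rightarrow> real \<Rightarrow> (nat \<Rightarrow> (real^'n) set measure) \<Rightarrow> nat set \<Rightarrow> nat \<Rightarrow> nat \<Rightarrow> real"
  where
  "rate_factor \<gamma> \<mu> L \<beta> law A k l =
     (1 - alpha \<gamma> \<mu> L (avg_proj (law l))) ^ (k - enumerate A l) * (1 - \<beta>) ^ l"

end

theory Submission
  imports Defs
begin

text \<open>
  Write \<open>P\<close> for the average projection in force, \<open>Q = P\<^sup>-\<^sup>1\<^sup>/\<^sup>2\<close>, and let \<open>us = xs - \<gamma> \<nabla>f(xs)\<close>. The minimiser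
  satisfies \<open>xs = prox us\<close>, so \<open>Q us\<close> is the value at which the vector \<open>z\<close> should settle.

  One iteration replaces the component of \<open>z - Q us\<close> in a random subspace \<open>F\<close> by that of
  \<open>y - Q us\<close>. By Pythagoras, the conditional expectation of the new squared error is
  \<open>|z - Q us|\<^sup>2 + (y - Q us) \<bullet> P (y - Q us) - (z - Q us) \<bullet> P (z - Q us)\<close>. The factor \<open>Q\<close> is designed so
  that the middle term is the squared error of a gradient step, hence at most
  \<open>(1 - \<kappa>) |x - xs|\<^sup>2\<close> with \<open>\<kappa> = 2 \<gamma> \<mu> L / (\<mu> + L)\<close>; and \<open>|x - xs|\<^sup>2\<close> is at most the subtracted
  term because \<open>prox\<close> is nonexpansive. What remains is
  \<open>|z - Q us|\<^sup>2 - \<kappa> (z - Q us) \<bullet> P (z - Q us)\<close>, at most \<open>1 - \<alpha>\<close> times the old squared error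
  (\<open>expected_contraction\<close>).

  Rescaling \<open>z\<close> at an adaptation multiplies the squared error by at most the squared spectral norm
  of the rescaling matrix. The required length of a cycle is such that the contractions of the whole cycle together
  with this factor give at most \<open>1 - \<beta>\<close>. So the squared error divided by the guaranteed rate is a
  supermartingale along the algorithm: \<open>err_quotient_le\<close> is the rescaling,
  \<open>expected_raw_quotient_le\<close> the iteration. The rate is random, as it depends on the laws chosen so
  far, but it is predictable, so it can be treated as a constant under the conditional expectation
  given the past. Working with the quotient in \<open>[0, \<infinity>]\<close> also covers the case \<open>\<alpha> = 1\<close>, in which the
  rate may vanish: the quotient having finite expectation then says that the error vanishes almost
  surely on that event.

  Taking the conditional expectation requires two preparations. The first is measurability of all
  matrix functions involved; the only delicate one is the square root, which is continuous as the
  inverse of the squaring map on a compact set. The second is that integrating a function of the past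
  and of the new subspace amounts to integrating it first over the conditional law of the subspace
  (\<open>conditional_law_disintegration\<close>).
\<close>

section \<open>Smooth and strongly convex functions\<close>

text \<open>A derivative on a Euclidean space is the inner product with exactly one vector, so the definite
  description in \<open>grad\<close> denotes the gradient.\<close>

lemma grad_gderiv:
  fixes f :: "'a::euclidean_space \<Rightarrow> real"
  assumes "f differentiable (at x)"
  shows "GDERIV f x :> grad f x"
proof -
  obtain f' where f': "(f has_derivative f') (at x)"
    using assms unfolding differentiable_def by blast
  then have lin: "bounded_linear f'" by (rule has_derivative_bounded_linear)
  define D where "D = (\<Sum>b\<in>Basis. f' b *\<^sub>R b)"
  have "f' h = h \<bullet> D" for h
  proof -
    have "f' h = f' (\<Sum>b\<in>Basis. (h \<bullet> b) *\<^sub>R b)" by (simp add: euclidean_representation)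
    also have "\<dots> = (\<Sum>b\<in>Basis. (h \<bullet> b) * f' b)"
      using bounded_linear.linear[OF lin] by (simp add: linear_sum linear_cmul)
    also have "\<dots> = h \<bullet> D" by (simp add: D_def inner_sum_right mult.commute)
    finally show ?thesis .
  qed
  then have "f' = (\<lambda>h. h \<bullet> D)" by blast
  then have D: "GDERIV f x :> D" using f' by (simp add: gderiv_def)
  have "E = D" if "GDERIV f x :> E" for E
  proof -
    have "(\<lambda>h. h \<bullet> E) = (\<lambda>h. h \<bullet> D)"
      using that D unfolding gderiv_def by (rule has_derivative_unique)
    then show ?thesis by (metis inner_commute vector_eq_rdot)
  qed
  with D show ?thesis unfolding grad_def by (metis (no_types, lifting) theI')
qed

lemma gderiv_along_line:
  fixes f :: "'a::euclidean_space \<Rightarrow> real"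
  assumes "GDERIV f (a + t *\<^sub>R d) :> D"
  shows "((\<lambda>t. f (a + t *\<^sub>R d)) has_real_derivative D \<bullet> d) (at t)"
proof -
  have "((\<lambda>t. a + t *\<^sub>R d) has_derivative (\<lambda>h. h *\<^sub>R d)) (at t)"
    by (auto intro!: derivative_eq_intros)
  from has_derivative_compose[OF this assms[unfolded gderiv_def]]
  show ?thesis
    by (simp add: has_field_derivative_def inner_commute mult_commute_abs)
qed

text \<open>Along the segment from \<open>x\<close> to \<open>y\<close>, the Lipschitz bound on the gradient makes the derivative of
  the left side minus the right side nonpositive.\<close>

lemma smooth_upper_bound:
  fixes f :: "'a::euclidean_space \<Rightarrow> real"
  assumes "L_smooth L f"
  shows "f y \<le> f x + grad f x \<bullet> (y - x) + L / 2 * (norm (y - x))\<^sup>2"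
proof -
  define d where "d = y - x"
  define q where "q t = f (x + t *\<^sub>R d) - t * (grad f x \<bullet> d) - L / 2 * t\<^sup>2 * (norm d)\<^sup>2" for t
  have diff: "GDERIV f z :> grad f z" for z
    using assms grad_gderiv unfolding L_smooth_def by blast
  have lip: "norm (grad f u - grad f v) \<le> L * norm (u - v)" for u v
    using assms unfolding L_smooth_def lipschitz_on_def dist_norm by blast
  have "q 1 \<le> q 0"
  proof (rule DERIV_nonpos_imp_nonincreasing[of 0 1 q])
    show "(0::real) \<le> 1" by simp
    fix t :: real assume t: "0 \<le> t" "t \<le> 1"
    have "(q has_real_derivative
        grad f (x + t *\<^sub>R d) \<bullet> d - grad f x \<bullet> d - L * t * (norm d)\<^sup>2) (at t)"
      unfolding q_def by (auto intro!: derivative_eq_intros gderiv_along_line diff)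
    moreover have "grad f (x + t *\<^sub>R d) \<bullet> d - grad f x \<bullet> d - L * t * (norm d)\<^sup>2 \<le> 0"
    proof -
      have "(grad f (x + t *\<^sub>R d) - grad f x) \<bullet> d \<le> norm (grad f (x + t *\<^sub>R d) - grad f x) * norm d"
        by (rule norm_cauchy_schwarz)
      also have "\<dots> \<le> (L * norm (t *\<^sub>R d)) * norm d"
        using lip[of "x + t *\<^sub>R d" x] by (intro mult_right_mono) auto
      also have "\<dots> = L * t * (norm d)\<^sup>2" using t by (simp add: power2_eq_square)
      finally show ?thesis by (simp add: inner_diff_left)
    qed
    ultimately show "\<exists>z. (q has_real_derivative z) (at t) \<and> z \<le> 0" by blast
  qed
  then show ?thesis by (simp add: q_def d_def)
qed

lemma convex_above_tangent:
  fixes f :: "'a::euclidean_space \<Rightarrow> real"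
  assumes "convex_on UNIV f" "GDERIV f x :> D"
  shows "f x + D \<bullet> (y - x) \<le> f y"
proof -
  define h where "h t = f (x + t *\<^sub>R (y - x))" for t
  have der: "(h has_real_derivative D \<bullet> (y - x)) (at 0)"
    unfolding h_def by (rule gderiv_along_line) (use assms in simp)
  have "convex_on UNIV h"
  proof (intro convex_onI)
    fix t a b :: real assume t: "0 < t" "t < 1"
    have "x + ((1 - t) * a + t * b) *\<^sub>R (y - x)
        = (1 - t) *\<^sub>R (x + a *\<^sub>R (y - x)) + t *\<^sub>R (x + b *\<^sub>R (y - x))"
      by (simp add: algebra_simps)
    then show "h ((1 - t) *\<^sub>R a + t *\<^sub>R b) \<le> (1 - t) * h a + t * h b"
      unfolding h_def using convex_onD[OF assms(1), of t] t by simp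
  qed simp
  then have "h 1 - h 0 \<ge> (D \<bullet> (y - x)) * (1 - 0)"
    by (rule convex_on_imp_above_tangent) (use der in auto)
  then show ?thesis by (simp add: h_def)
qed

text \<open>The argument of Baillon and Haddad. The function \<open>\<phi> - G x \<bullet> _\<close> is minimal at \<open>x\<close>, and a gradient
  step of length \<open>1 / K\<close> from \<open>y\<close> decreases it by \<open>|G y - G x|\<^sup>2 / (2 K)\<close>, so \<open>y\<close> lies at least that
  much above the minimum. Adding the same bound with \<open>x\<close> and \<open>y\<close> exchanged cancels \<open>\<phi>\<close>.\<close>

lemma cocoercive_of_bounds:
  fixes \<phi> :: "'a::real_inner \<Rightarrow> real" and G :: "'a \<Rightarrow> 'a"
  assumes K: "0 < K"
    and lower: "\<And>x y. \<phi> x + G x \<bullet> (y - x) \<le> \<phi> y"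
    and upper: "\<And>x y. \<phi> y \<le> \<phi> x + G x \<bullet> (y - x) + K / 2 * (norm (y - x))\<^sup>2"
  shows "(norm (G x - G y))\<^sup>2 \<le> K * ((G x - G y) \<bullet> (x - y))"
proof -
  have half: "(norm (G x - G y))\<^sup>2 / (2 * K) \<le> \<phi> y - \<phi> x - G x \<bullet> (y - x)" for x y
  proof -
    define e where "e = G y - G x"
    define w where "w = y - (1 / K) *\<^sub>R e"
    have "\<phi> x + G x \<bullet> (w - x) \<le> \<phi> y + G y \<bullet> (w - y) + K / 2 * (norm (w - y))\<^sup>2"
      using lower[of x w] upper[of w y] by linarith
    moreover have "G x \<bullet> (w - x) = G x \<bullet> (y - x) - (G x \<bullet> e) / K"
      by (simp add: w_def inner_diff_right)
    moreover have "G y \<bullet> (w - y) = - (G y \<bullet> e) / K" by (simp add: w_def)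
    moreover have "K / 2 * (norm (w - y))\<^sup>2 = (e \<bullet> e) / (2 * K)"
      using K unfolding power2_norm_eq_inner by (simp add: w_def)
    moreover have "(G y \<bullet> e) / K - (G x \<bullet> e) / K = (e \<bullet> e) / K"
      by (simp add: e_def inner_diff_left diff_divide_distrib)
    moreover have "(e \<bullet> e) / K = 2 * ((e \<bullet> e) / (2 * K))" using K by simp
    ultimately have "(e \<bullet> e) / (2 * K) \<le> \<phi> y - \<phi> x - G x \<bullet> (y - x)" by argo
    then show ?thesis by (simp add: e_def power2_norm_eq_inner[symmetric] norm_minus_commute)
  qed
  have "(norm (G x - G y))\<^sup>2 / (2 * K) + (norm (G y - G x))\<^sup>2 / (2 * K)
      \<le> - (G x \<bullet> (y - x)) - G y \<bullet> (x - y)"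
    using half[of x y] half[of y x] by linarith
  then have "(norm (G x - G y))\<^sup>2 / K \<le> (G x - G y) \<bullet> (x - y)"
    by (simp add: norm_minus_commute inner_diff_left inner_diff_right field_simps)
  then show ?thesis using K by (simp add: field_simps)
qed

text \<open>Subtracting \<open>\<mu>/2 |_|\<^sup>2\<close> from \<open>f\<close> leaves a convex function with a quadratic upper bound of
  curvature \<open>L - \<mu>\<close>. Cocoercivity of its gradient, written in terms of \<open>grad f\<close>, is the claim.\<close>

lemma smooth_strongly_convex_cocoercive:
  fixes f :: "'a::euclidean_space \<Rightarrow> real"
  assumes sm: "L_smooth L f" and sc: "strongly_convex \<mu> f"
  shows "(norm (grad f x - grad f y))\<^sup>2 + \<mu> * L * (norm (x - y))\<^sup>2
    \<le> (\<mu> + L) * ((grad f x - grad f y) \<bullet> (x - y))"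
    and "\<mu> \<le> L"
proof -
  define \<phi> where "\<phi> z = f z - \<mu> / 2 * (norm z)\<^sup>2" for z
  define G where "G z = grad f z - \<mu> *\<^sub>R z" for z
  have diff: "GDERIV f z :> grad f z" for z
    using sm grad_gderiv unfolding L_smooth_def by blast
  have "GDERIV \<phi> z :> G z" for z
    using diff[of z] unfolding gderiv_def \<phi>_def power2_norm_eq_inner G_def
    by (auto intro!: derivative_eq_intros simp: inner_commute inner_diff_right algebra_simps)
  moreover have "convex_on UNIV \<phi>" using sc unfolding strongly_convex_def \<phi>_def .
  ultimately have lower: "\<phi> x + G x \<bullet> (y - x) \<le> \<phi> y" for x y
    using convex_above_tangent by blast
  have quad: "\<mu> / 2 * (norm y)\<^sup>2 = \<mu> / 2 * (norm x)\<^sup>2 + \<mu> * (x \<bullet> (y - x)) + \<mu> / 2 * (norm (y - x))\<^sup>2"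
    for x y :: 'a
    by (simp add: power2_norm_eq_inner inner_diff_left inner_diff_right inner_commute algebra_simps)
  have upper: "\<phi> y \<le> \<phi> x + G x \<bullet> (y - x) + (L - \<mu>) / 2 * (norm (y - x))\<^sup>2" for x y
    using smooth_upper_bound[OF sm, of y x] quad[of y x]
    by (simp add: \<phi>_def G_def inner_diff_left algebra_simps diff_divide_distrib)
  show "\<mu> \<le> L"
  proof -
    obtain b :: 'a where b: "b \<in> Basis" using nonempty_Basis by blast
    have "0 \<le> (L - \<mu>) / 2 * (norm (b - 0))\<^sup>2" using lower[of 0 b] upper[of b 0] by linarith
    then show ?thesis using b by simp
  qed
  \<comment> \<open>The curvature \<open>L - \<mu>\<close> may be zero, so it is first enlarged by \<open>\<epsilon>\<close>.\<close>
  have "(norm (G x - G y))\<^sup>2 \<le> (L - \<mu> + \<epsilon>) * ((G x - G y) \<bullet> (x - y))" if "0 < \<epsilon>" for \<epsilon>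
  proof (rule cocoercive_of_bounds[OF _ lower])
    show "0 < L - \<mu> + \<epsilon>" using that \<open>\<mu> \<le> L\<close> by simp
    fix x y :: 'a
    have "(L - \<mu>) / 2 * (norm (y - x))\<^sup>2 \<le> (L - \<mu> + \<epsilon>) / 2 * (norm (y - x))\<^sup>2"
      using that by (intro mult_right_mono) auto
    then show "\<phi> y \<le> \<phi> x + G x \<bullet> (y - x) + (L - \<mu> + \<epsilon>) / 2 * (norm (y - x))\<^sup>2"
      using upper[of y x] by linarith
  qed
  note eps = this
  have "(norm (G x - G y))\<^sup>2 \<le> (L - \<mu>) * ((G x - G y) \<bullet> (x - y))"
  proof (rule field_le_epsilon)
    fix e :: real assume "0 < e"
    define p where "p = (G x - G y) \<bullet> (x - y)"
    define \<epsilon> where "\<epsilon> = e / (\<bar>p\<bar> + 1)"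
    have "0 < \<epsilon>" using \<open>0 < e\<close> by (simp add: \<epsilon>_def)
    moreover have "\<epsilon> * p \<le> e"
    proof -
      have "\<epsilon> * p \<le> \<epsilon> * (\<bar>p\<bar> + 1)" using \<open>0 < \<epsilon>\<close> by (intro mult_left_mono) auto
      then show ?thesis by (simp add: \<epsilon>_def)
    qed
    ultimately show "(norm (G x - G y))\<^sup>2 \<le> (L - \<mu>) * ((G x - G y) \<bullet> (x - y)) + e"
      using eps[of \<epsilon>] by (simp add: p_def[symmetric] distrib_right)
  qed
  moreover have "G x - G y = (grad f x - grad f y) - \<mu> *\<^sub>R (x - y)"
    by (simp add: G_def algebra_simps)
  ultimately show "(norm (grad f x - grad f y))\<^sup>2 + \<mu> * L * (norm (x - y))\<^sup>2
    \<le> (\<mu> + L) * ((grad f x - grad f y) \<bullet> (x - y))"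
    by (simp only: power2_norm_eq_inner inner_diff_left inner_diff_right inner_scaleR_left
        inner_scaleR_right inner_commute)
      (simp add: algebra_simps)
qed

text \<open>In the expansion of the squared norm, cocoercivity bounds the cross term, and the bound on the step
  size is exactly what lets it absorb the square of the difference of gradients.\<close>

lemma gradient_step_contraction:
  fixes f :: "'a::euclidean_space \<Rightarrow> real"
  assumes sm: "L_smooth L f" and sc: "strongly_convex \<mu> f" and "0 < \<mu>"
    and \<gamma>: "0 < \<gamma>" "\<gamma> \<le> 2 / (\<mu> + L)"
  shows "(norm ((x - \<gamma> *\<^sub>R grad f x) - (y - \<gamma> *\<^sub>R grad f y)))\<^sup>2
    \<le> (1 - 2 * \<gamma> * \<mu> * L / (\<mu> + L)) * (norm (x - y))\<^sup>2"
proof -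
  define d where "d = x - y"
  define e where "e = grad f x - grad f y"
  have s: "0 < \<mu> + L" using smooth_strongly_convex_cocoercive(2)[OF sm sc] \<open>0 < \<mu>\<close> by simp
  have co: "(e \<bullet> e + \<mu> * L * (d \<bullet> d)) / (\<mu> + L) \<le> e \<bullet> d"
    using smooth_strongly_convex_cocoercive(1)[OF sm sc, of x y] s
    by (simp add: e_def d_def power2_norm_eq_inner divide_le_eq mult.commute)
  have "(norm ((x - \<gamma> *\<^sub>R grad f x) - (y - \<gamma> *\<^sub>R grad f y)))\<^sup>2 = (norm (d - \<gamma> *\<^sub>R e))\<^sup>2"
    by (simp add: d_def e_def algebra_simps)
  also have "\<dots> = d \<bullet> d - 2 * \<gamma> * (e \<bullet> d) + \<gamma> * (\<gamma> * (e \<bullet> e))"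
    by (simp add: power2_norm_eq_inner inner_diff_left inner_diff_right inner_commute algebra_simps)
  also have "\<dots> \<le> d \<bullet> d - 2 * \<gamma> * ((e \<bullet> e + \<mu> * L * (d \<bullet> d)) / (\<mu> + L))
      + \<gamma> * (2 / (\<mu> + L) * (e \<bullet> e))"
    using co \<gamma> by (intro add_mono diff_mono mult_left_mono mult_right_mono) auto
  also have "\<dots> = (1 - 2 * \<gamma> * \<mu> * L / (\<mu> + L)) * (d \<bullet> d)"
  proof -
    have "2 * \<gamma> * ((e \<bullet> e + \<mu> * L * (d \<bullet> d)) / (\<mu> + L))
        = \<gamma> * (2 / (\<mu> + L) * (e \<bullet> e)) + 2 * \<gamma> * \<mu> * L / (\<mu> + L) * (d \<bullet> d)"
      by (simp add: add_divide_distrib algebra_simps)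
    then show ?thesis by (simp add: algebra_simps)
  qed
  finally show ?thesis by (simp add: d_def power2_norm_eq_inner)
qed

section \<open>The proximal operator\<close>

text \<open>Fermat's rule. Compare \<open>u\<close> with the points \<open>u + t (y - u)\<close>: convexity bounds \<open>g\<close> there by the
  chord, and dividing by \<open>t\<close> turns the increment of \<open>h\<close> into its directional derivative.\<close>

lemma minimiser_subgradient:
  fixes h :: "'a::euclidean_space \<Rightarrow> real" and g :: "'a \<Rightarrow> ereal"
  assumes g: "convex_fun g" "proper_fun g"
    and h: "GDERIV h u :> D"
    and min: "is_arg_min (\<lambda>y. ereal (h y) + g y) (\<lambda>_. True) u"
  shows "\<bar>g u\<bar> \<noteq> \<infinity>" and "g u - ereal (D \<bullet> (y - u)) \<le> g y"
proof -
  have le: "ereal (h u) + g u \<le> ereal (h y) + g y" for y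
    using min by (auto simp: is_arg_min_linorder)
  obtain y0 where "g y0 \<noteq> \<infinity>" using g(2) by (auto simp: proper_fun_def)
  then have "g u \<noteq> \<infinity>" using le[of y0] by (cases "g y0") auto
  moreover have nminf: "g y \<noteq> -\<infinity>" for y using g(2) by (simp add: proper_fun_def)
  ultimately show fin: "\<bar>g u\<bar> \<noteq> \<infinity>" by (metis ereal_infinity_cases)
  then obtain gu where gu: "g u = ereal gu" by auto
  show "g u - ereal (D \<bullet> (y - u)) \<le> g y"
  proof (cases "g y = \<infinity>")
    case False
    then obtain gy where gy: "g y = ereal gy" using nminf[of y] by (cases "g y") auto
    define q where "q t = h (u + t *\<^sub>R (y - u))" for t
    have "(q has_real_derivative D \<bullet> (y - u)) (at 0)"
      unfolding q_def by (rule gderiv_along_line) (use h in simp)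
    then have lim: "((\<lambda>t. (q (0 + t) - q 0) / t) \<longlongrightarrow> D \<bullet> (y - u)) (at_right 0)"
      unfolding DERIV_def by (rule tendsto_within_subset) simp
    have "eventually (\<lambda>t. gu - gy \<le> (q (0 + t) - q 0) / t) (at_right (0::real))"
      using eventually_at_right_less[of 0] eventually_at_right_real[of 0 1, simplified]
    proof eventually_elim
      case (elim t)
      have "ereal (h u) + g u \<le> ereal (q t) + g (u + t *\<^sub>R (y - u))"
        unfolding q_def by (rule le)
      also have "u + t *\<^sub>R (y - u) = (1 - t) *\<^sub>R u + t *\<^sub>R y" by (simp add: algebra_simps)
      also have "g \<dots> \<le> ereal (1 - t) * g u + ereal t * g y"
        using g(1) elim by (simp add: convex_fun_def)
      finally have "h u + gu \<le> q t + ((1 - t) * gu + t * gy)"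
        by (simp add: gu gy add_left_mono)
      then have "(gu - gy) * t \<le> q t - q 0" by (simp add: q_def algebra_simps)
      then show ?case using elim by (simp add: pos_le_divide_eq)
    qed
    then have "gu - gy \<le> D \<bullet> (y - u)"
      by (rule tendsto_lowerbound[OF lim]) simp
    then show ?thesis by (simp add: gu gy)
  qed simp
qed

lemma lower_semicont_superlevel_open:
  fixes g :: "'a::topological_space \<Rightarrow> ereal"
  assumes "lower_semicont g" "c < g x"
  shows "eventually (\<lambda>y. c < g y) (nhds x)"
proof -
  have "c < Liminf (at x) g"
    using assms by (metis lower_semicont_def order_less_le_trans)
  then have "eventually (\<lambda>y. c < g y) (at x)" by (rule less_LiminfD)
  then show ?thesis using assms(2) by (auto simp: eventually_nhds_conv_at)
qed

text \<open>The affine minorant of \<open>g\<close> makes the objective coercive, and lower semicontinuity makes its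
  sublevel sets closed. The sublevel sets above the infimum are thus nested nonempty compact sets, and
  a common point is a minimiser.\<close>

lemma prox_objective_attains_minimum:
  fixes g :: "'a::euclidean_space \<Rightarrow> ereal"
  assumes lsc: "lower_semicont g" and pr: "proper_fun g" and \<gamma>: "0 < \<gamma>"
    and minor: "\<And>y. ereal (b + p \<bullet> y) \<le> g y"
  shows "\<exists>u. is_arg_min (\<lambda>y. g y + ereal (1 / (2 * \<gamma>) * (norm (y - a))\<^sup>2)) (\<lambda>_. True) u"
proof -
  define q where "q y = 1 / (2 * \<gamma>) * (norm (y - a))\<^sup>2" for y
  define h where "h y = g y + ereal (q y)" for y
  obtain y0 where y0: "g y0 \<noteq> \<infinity>" using pr by (auto simp: proper_fun_def)
  have nminf: "g y \<noteq> -\<infinity>" for y using pr by (simp add: proper_fun_def)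
  obtain r0 where r0: "h y0 = ereal r0"
    using y0 nminf[of y0] by (cases "g y0") (auto simp: h_def)
  have closed: "closed {y. h y \<le> c}" for c :: ereal
  proof -
    have "open {y. c < h y}"
    proof (subst open_subopen, clarify)
      fix y assume y: "c < h y"
      have "c - ereal (q y) < g y" using y unfolding h_def by (cases c; cases "g y") auto
      then obtain r where r: "c - ereal (q y) < ereal r" "ereal r < g y"
        using ereal_dense2 by blast
      have "eventually (\<lambda>z. c < ereal r + ereal (q z)) (nhds y)"
      proof (cases c)
        case (real s)
        have "isCont q y" unfolding q_def by (intro continuous_intros)
        then have "(q \<longlongrightarrow> q y) (nhds y)" by (simp add: isCont_def tendsto_nhds_iff)
        moreover have "s - r < q y" using r real by simp
        ultimately have "eventually (\<lambda>z. s - r < q z) (nhds y)" by (rule order_tendstoD)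
        then show ?thesis by eventually_elim (simp add: real)
      qed (use r in auto)
      then have "eventually (\<lambda>z. c < h z) (nhds y)"
        using lower_semicont_superlevel_open[OF lsc r(2)]
      proof eventually_elim
        case (elim z)
        then show ?case unfolding h_def
          by (metis add_right_mono less_imp_le order_less_le_trans)
      qed
      then show "\<exists>T. open T \<and> y \<in> T \<and> T \<subseteq> {y. c < h y}"
        unfolding eventually_nhds by blast
    qed
    moreover have "{y. h y \<le> c} = - {y. c < h y}" by auto
    ultimately show ?thesis by (metis closed_Compl)
  qed
  have bounded: "bounded {y. h y \<le> ereal r}" for r
  proof -
    define s where "s = norm p"
    define \<eta> where "\<eta> = \<bar>r - (b + p \<bullet> a)\<bar>"
    \<comment> \<open>Beyond distance \<open>R\<close>, the quadratic term exceeds \<open>(|p| + 1 + \<eta>) |y - a|\<close> and so beats the minorant.\<close>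
    define R where "R = 2 * \<gamma> * (s + 1 + \<eta>) + 1"
    have "norm (y - a) \<le> R" if "h y \<le> ereal r" for y
    proof (rule ccontr)
      assume "\<not> ?thesis"
      then have big: "R < norm (y - a)" by simp
      have "ereal (b + p \<bullet> y) + ereal (q y) \<le> ereal r"
        using that minor[of y] unfolding h_def by (metis add_right_mono order_trans)
      then have "b + p \<bullet> y + q y \<le> r" by simp
      moreover have "p \<bullet> y = p \<bullet> a + p \<bullet> (y - a)" by (simp add: inner_diff_right)
      moreover have "- (s * norm (y - a)) \<le> p \<bullet> (y - a)"
        using Cauchy_Schwarz_ineq2[of p "y - a"] by (simp add: s_def)
      ultimately have 1: "q y - s * norm (y - a) \<le> \<eta>" unfolding \<eta>_def by linarith
      have "R \<ge> 1" using \<gamma> by (simp add: R_def s_def \<eta>_def)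
      have "(s + 1 + \<eta>) \<le> 1 / (2 * \<gamma>) * norm (y - a)"
        using big \<gamma> by (simp add: R_def field_simps)
      then have "(s + 1 + \<eta>) * norm (y - a) \<le> q y"
        unfolding q_def power2_eq_square by (simp only: mult.assoc[symmetric]) (rule mult_right_mono, auto)
      then have "(1 + \<eta>) * norm (y - a) \<le> \<eta>"
        using 1 by (simp add: algebra_simps)
      moreover have "(1 + \<eta>) * 1 \<le> (1 + \<eta>) * norm (y - a)"
        using big \<open>R \<ge> 1\<close> by (intro mult_left_mono) (auto simp: \<eta>_def)
      ultimately show False by simp
    qed
    then show ?thesis by (auto simp: bounded_any_center[of _ a] dist_norm norm_minus_commute)
  qed
  define m where "m = (INF y. h y)"
  have "m \<le> h y0" unfolding m_def by (rule INF_lower) simp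
  show ?thesis
  proof (cases "m = h y0")
    case True
    then have "\<not> h y < h y0" for y by (metis INF_lower UNIV_I m_def not_le)
    then show ?thesis by (auto simp: is_arg_min_def h_def q_def)
  next
    case False
    then have "m < h y0" using \<open>m \<le> h y0\<close> by simp
    have "{y. h y \<le> h y0} \<inter> (\<Inter>c\<in>{c. m < c}. {y. h y \<le> c}) \<noteq> {}"
    proof (rule compact_imp_fip_image)
      show "compact {y. h y \<le> h y0}"
        unfolding compact_eq_bounded_closed using closed bounded r0 by simp
      show "closed {y. h y \<le> c}" for c by (rule closed)
      fix I :: "ereal set" assume I: "finite I" "I \<subseteq> {c. m < c}"
      define c where "c = Min (insert (h y0) I)"
      have "m < c" unfolding c_def using I \<open>m < h y0\<close> by (subst Min_gr_iff) auto
      then obtain u where u: "h u < c" unfolding m_def by (auto simp: INF_less_iff)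
      have "c \<le> d" if "d \<in> insert (h y0) I" for d unfolding c_def using I that by (intro Min_le) auto
      then have "u \<in> {y. h y \<le> h y0} \<inter> (\<Inter>c\<in>I. {y. h y \<le> c})" using u by force
      then show "{y. h y \<le> h y0} \<inter> (\<Inter>c\<in>I. {y. h y \<le> c}) \<noteq> {}" by blast
    qed
    then obtain u where u: "\<And>c. m < c \<Longrightarrow> h u \<le> c" by auto
    have "h u \<le> m"
      by (rule dense_ge) (rule u)
    then have "\<not> h y < h u" for y by (metis INF_lower UNIV_I m_def not_le order_trans)
    then show ?thesis by (auto simp: is_arg_min_def h_def q_def)
  qed
qed


text \<open>Fermat's rule for the objective of \<open>prox\<close> is a variational inequality (\<open>prox_sub\<close> below). Adding it
  at the two points \<open>prox a\<close> and \<open>prox b\<close> gives nonexpansiveness; adding it to the slope inequality at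
  \<open>xs\<close> gives the fixed point. The slope at \<open>xs\<close> also is the affine minorant that makes \<open>prox\<close> well
  defined.\<close>

lemma prox_nonexpansive_and_fixed:
  fixes g :: "'a::euclidean_space \<Rightarrow> ereal"
  assumes g: "convex_fun g" "proper_fun g" "lower_semicont g" and \<gamma>: "0 < \<gamma>"
    and xs: "g xs \<noteq> \<infinity>" and sub: "\<And>y. g xs - ereal (D \<bullet> (y - xs)) \<le> g y"
  shows "norm (prox \<gamma> g a - prox \<gamma> g b) \<le> norm (a - b)"
    and "prox \<gamma> g (xs - \<gamma> *\<^sub>R D) = xs"
proof -
  have nminf: "g y \<noteq> -\<infinity>" for y using g(2) by (simp add: proper_fun_def)
  obtain gs where gs: "g xs = ereal gs" using xs nminf[of xs] by (cases "g xs") auto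
  have prox_sub: "\<exists>gu. g (prox \<gamma> g a) = ereal gu \<and>
      (\<forall>y gy. g y = ereal gy \<longrightarrow> gu + (1 / \<gamma>) * ((a - prox \<gamma> g a) \<bullet> (y - prox \<gamma> g a)) \<le> gy)" for a
  proof -
    define q where "q y = 1 / (2 * \<gamma>) * (norm (y - a))\<^sup>2" for y
    define u where "u = prox \<gamma> g a"
    have "ereal ((gs + D \<bullet> xs) + (- D) \<bullet> y) \<le> g y" for y
      using sub[of y] by (simp add: gs inner_diff_right algebra_simps)
    then have "\<exists>u. is_arg_min (\<lambda>y. g y + ereal (q y)) (\<lambda>_. True) u"
      unfolding q_def by (rule prox_objective_attains_minimum[OF g(3,2) \<gamma>])
    then have "is_arg_min (\<lambda>y. g y + ereal (q y)) (\<lambda>_. True) u"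
      unfolding u_def prox_def arg_min_def q_def by (rule someI_ex)
    then have min: "is_arg_min (\<lambda>y. ereal (q y) + g y) (\<lambda>_. True) u"
      by (simp add: add.commute)
    have der: "GDERIV q u :> (1 / \<gamma>) *\<^sub>R (u - a)"
      unfolding q_def gderiv_def power2_norm_eq_inner inner_scaleR_right using \<gamma>
      by (auto intro!: derivative_eq_intros simp: inner_commute inner_diff_right field_simps)
    obtain gu where gu: "g u = ereal gu"
      using minimiser_subgradient(1)[OF g(1,2) der min] by auto
    moreover have "gu + (1 / \<gamma>) * ((a - u) \<bullet> (y - u)) \<le> gy" if "g y = ereal gy" for y gy
      using minimiser_subgradient(2)[OF g(1,2) der min, of y] that gu
      by (simp add: inner_diff_left diff_divide_distrib)
    ultimately show ?thesis unfolding u_def by blast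
  qed
  show "norm (prox \<gamma> g a - prox \<gamma> g b) \<le> norm (a - b)"
  proof -
    define u v where "u = prox \<gamma> g a" and "v = prox \<gamma> g b"
    obtain gu gv where "g u = ereal gu" "g v = ereal gv"
      "gu + (1 / \<gamma>) * ((a - u) \<bullet> (v - u)) \<le> gv" "gv + (1 / \<gamma>) * ((b - v) \<bullet> (u - v)) \<le> gu"
      using prox_sub[of a] prox_sub[of b] unfolding u_def v_def by blast
    then have "(1 / \<gamma>) * ((a - u) \<bullet> (v - u) + (b - v) \<bullet> (u - v)) \<le> 0"
      by (simp only: distrib_left)
    then have "(a - u) \<bullet> (v - u) + (b - v) \<bullet> (u - v) \<le> 0"
      using \<gamma> by (simp add: divide_le_0_iff)
    moreover have "(a - u) \<bullet> (v - u) + (b - v) \<bullet> (u - v) = (u - v) \<bullet> (u - v) - (a - b) \<bullet> (u - v)"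
      by (simp add: inner_diff_left inner_diff_right)
    ultimately have "(norm (u - v))\<^sup>2 \<le> norm (a - b) * norm (u - v)"
      using norm_cauchy_schwarz[of "a - b" "u - v"] by (simp add: power2_norm_eq_inner)
    then show ?thesis
      unfolding u_def[symmetric] v_def[symmetric] by (cases "u = v") (auto simp: power2_eq_square)
  qed
  show "prox \<gamma> g (xs - \<gamma> *\<^sub>R D) = xs"
  proof -
    define u where "u = prox \<gamma> g (xs - \<gamma> *\<^sub>R D)"
    obtain gu where gu: "g u = ereal gu"
      "gu + (1 / \<gamma>) * ((xs - \<gamma> *\<^sub>R D - u) \<bullet> (xs - u)) \<le> gs"
      using prox_sub[of "xs - \<gamma> *\<^sub>R D"] gs unfolding u_def by blast
    have "gs - D \<bullet> (u - xs) \<le> gu" using sub[of u] gs gu by simp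
    moreover have "(1 / \<gamma>) * ((xs - \<gamma> *\<^sub>R D - u) \<bullet> (xs - u))
        = (1 / \<gamma>) * ((xs - u) \<bullet> (xs - u)) + D \<bullet> (u - xs)"
      unfolding inner_diff_left inner_diff_right inner_scaleR_left
      using \<gamma> by (simp add: field_simps)
    ultimately have "(1 / \<gamma>) * ((xs - u) \<bullet> (xs - u)) \<le> 0" using gu(2) by linarith
    then have "(norm (xs - u))\<^sup>2 \<le> 0" using \<gamma> by (simp add: divide_le_0_iff power2_norm_eq_inner)
    then have "xs = u" by simp
    then show ?thesis by (simp add: u_def)
  qed
qed

section \<open>Symmetric matrices\<close>

lemma symmetric_matrix_inner:
  fixes A :: "real^'n^'n"
  assumes "transpose A = A"
  shows "(A *v x) \<bullet> y = x \<bullet> (A *v y)"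
  by (metis assms dot_lmul_matrix transpose_matrix_vector)

text \<open>Minimise the Rayleigh quotient over the unit sphere of \<open>V\<close>. At a minimiser \<open>v\<close> with value \<open>m\<close>, the
  form \<open>x \<bullet> A x - m |x|\<^sup>2\<close> is nonnegative on \<open>V\<close> and vanishes, so it is stationary. Its derivative in
  the direction \<open>w = A v - m v\<close> is \<open>2 |w|\<^sup>2\<close>, hence \<open>w = 0\<close>.\<close>

lemma symmetric_invariant_subspace_min_eigenvector:
  fixes A :: "real^'n^'n"
  assumes sym: "transpose A = A" and V: "subspace V" "V \<noteq> {0}"
    and inv: "\<And>x. x \<in> V \<Longrightarrow> A *v x \<in> V"
  shows "\<exists>v m. v \<in> V \<and> norm v = 1 \<and> A *v v = m *\<^sub>R v \<and>
    (\<forall>x\<in>V. m * (norm x)\<^sup>2 \<le> x \<bullet> (A *v x))"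
proof -
  define K where "K = V \<inter> sphere 0 1"
  obtain x0 where x0: "x0 \<in> V" "x0 \<noteq> 0" using V subspace_0 by blast
  then have "(1 / norm x0) *\<^sub>R x0 \<in> K" using V(1) by (simp add: K_def subspace_scale)
  moreover have "compact K" unfolding K_def
    using closed_Int_compact[OF closed_subspace[OF V(1)]] by simp
  moreover have "continuous_on K (\<lambda>x. x \<bullet> (A *v x))"
    by (intro continuous_intros matrix_vector_mult_linear_continuous_on)
  ultimately obtain v where v: "v \<in> K" and min: "\<And>x. x \<in> K \<Longrightarrow> v \<bullet> (A *v v) \<le> x \<bullet> (A *v x)"
    using continuous_attains_inf[of K "\<lambda>x. x \<bullet> (A *v x)"] by blast
  define m where "m = v \<bullet> (A *v v)"
  have low: "m * (norm x)\<^sup>2 \<le> x \<bullet> (A *v x)" if x: "x \<in> V" for x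
  proof (cases "x = 0")
    case False
    have "(1 / norm x) *\<^sub>R x \<in> K" using x V(1) False by (simp add: K_def subspace_scale)
    then have "m \<le> ((1 / norm x) *\<^sub>R x) \<bullet> (A *v ((1 / norm x) *\<^sub>R x))" unfolding m_def by (rule min)
    also have "\<dots> = (x \<bullet> (A *v x)) / (norm x)\<^sup>2"
      by (simp add: matrix_vector_mult_scaleR power2_eq_square)
    finally show ?thesis using False by (simp add: pos_le_divide_eq)
  qed simp
  have vV: "v \<in> V" "norm v = 1" using v by (auto simp: K_def)
  define w where "w = A *v v - m *\<^sub>R v"
  have wV: "w \<in> V" unfolding w_def using V(1) vV inv by (intro subspace_diff subspace_scale) auto
  define q where "q = w \<bullet> (A *v w) - m * (w \<bullet> w)"
  have key: "0 \<le> 2 * t * (w \<bullet> w) + t\<^sup>2 * q" for t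
  proof -
    have "v + t *\<^sub>R w \<in> V" using V(1) vV wV by (intro subspace_add subspace_scale)
    from low[OF this] have "0 \<le> (v + t *\<^sub>R w) \<bullet> (A *v (v + t *\<^sub>R w)) - m * ((v + t *\<^sub>R w) \<bullet> (v + t *\<^sub>R w))"
      by (simp add: power2_norm_eq_inner)
    also have "\<dots> = (v \<bullet> (A *v v) - m * (v \<bullet> v)) + t * (w \<bullet> (A *v v) + v \<bullet> (A *v w) - 2 * m * (v \<bullet> w)) + t\<^sup>2 * q"
      by (simp add: q_def matrix_vector_right_distrib matrix_vector_mult_scaleR inner_add_left
          inner_add_right inner_commute algebra_simps power2_eq_square)
    also have "v \<bullet> (A *v v) - m * (v \<bullet> v) = 0"
      using vV by (simp add: m_def norm_eq_1)
    also have "w \<bullet> (A *v v) + v \<bullet> (A *v w) - 2 * m * (v \<bullet> w) = 2 * (w \<bullet> w)"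
    proof -
      have "v \<bullet> (A *v w) = w \<bullet> (A *v v)"
        using symmetric_matrix_inner[OF sym, of v w] by (simp add: inner_commute)
      moreover have "w \<bullet> (A *v v) - m * (v \<bullet> w) = w \<bullet> w"
      proof -
        have "w \<bullet> (A *v v - m *\<^sub>R v) = w \<bullet> (A *v v) - m * (v \<bullet> w)"
          by (simp add: inner_diff_right inner_commute)
        then show ?thesis by (simp add: w_def[symmetric])
      qed
      ultimately show ?thesis by linarith
    qed
    finally show ?thesis by (simp add: algebra_simps)
  qed
  have "w \<bullet> w = 0"
  proof (rule ccontr)
    assume "w \<bullet> w \<noteq> 0"
    then have W: "0 < w \<bullet> w" by simp
    \<comment> \<open>A negative \<open>t\<close> so small that the linear term of \<open>key\<close> dominates.\<close>
    define t where "t = - (w \<bullet> w) / (\<bar>q\<bar> + 1)"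
    have t: "t < 0" using W by (simp add: t_def divide_neg_pos)
    have "- (w \<bullet> w) \<le> t * q"
    proof -
      have "(- t) * q \<le> (- t) * (\<bar>q\<bar> + 1)" using t by (intro mult_left_mono) auto
      then show ?thesis by (simp add: t_def)
    qed
    then have "t * (2 * (w \<bullet> w) + t * q) < 0" 
      by (intro mult_neg_pos[OF t]) (use W in linarith)
    then show False using key[of t] by (simp add: algebra_simps power2_eq_square)
  qed
  then have "A *v v = m *\<^sub>R v" by (simp add: w_def)
  with vV low show ?thesis by blast
qed

text \<open>Split off one eigenvector; its orthogonal complement in \<open>V\<close> is invariant because \<open>A\<close> is symmetric.\<close>

lemma symmetric_eigenbasis:
  fixes A :: "real^'n^'n"
  assumes sym: "transpose A = A" and "subspace V" "\<And>x. x \<in> V \<Longrightarrow> A *v x \<in> V"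
  shows "\<exists>B e. finite B \<and> pairwise orthogonal B \<and> (\<forall>v\<in>B. norm v = 1 \<and> A *v v = e v *\<^sub>R v) \<and> span B = V"
  using assms(2,3)
proof (induction "dim V" arbitrary: V rule: less_induct)
  case less
  show ?case
  proof (cases "V = {0}")
    case True
    then show ?thesis by (intro exI[of _ "{}"]) auto
  next
    case False
    obtain v m where v: "v \<in> V" "norm v = 1" "A *v v = m *\<^sub>R v"
      using symmetric_invariant_subspace_min_eigenvector[OF sym less(2) False less(3)] by blast
    define W where "W = V \<inter> {x. v \<bullet> x = 0}"
    have W: "subspace W" unfolding W_def
      by (rule subspace_inter[OF less(2) subspace_hyperplane])
    moreover have "A *v x \<in> W" if "x \<in> W" for x
      using that less(3) v symmetric_matrix_inner[OF sym, of v x] by (auto simp: W_def)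
    moreover have "dim W < dim V"
    proof (rule ccontr)
      assume "\<not> dim W < dim V"
      then have "W = V"
        using W less(2) by (intro subspace_dim_equal) (auto simp: W_def)
      then have "v \<bullet> v = 0" using v(1) unfolding W_def by blast
      then show False using v(2) by auto
    qed
    ultimately have "\<exists>B e. finite B \<and> pairwise orthogonal B \<and>
        (\<forall>v\<in>B. norm v = 1 \<and> A *v v = e v *\<^sub>R v) \<and> span B = W"
      by (intro less(1)) auto
    then obtain B e where B: "finite B" "pairwise orthogonal B"
      "\<forall>v\<in>B. norm v = 1 \<and> A *v v = e v *\<^sub>R v" "span B = W"
      by blast
    have BW: "b \<in> W" if "b \<in> B" for b using that B(4) span_base by blast
    have vv: "v \<bullet> v = 1" using v(2) by (simp add: norm_eq_sqrt_inner)
    have "v \<notin> B" using BW[of v] vv by (auto simp: W_def)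
    have "span (insert v B) = V"
    proof
      have "insert v B \<subseteq> V" using BW v(1) by (auto simp: W_def)
      then show "span (insert v B) \<subseteq> V" using less(2) by (rule span_minimal)
      show "V \<subseteq> span (insert v B)"
      proof
        fix x assume "x \<in> V"
        then have "x - (v \<bullet> x) *\<^sub>R v \<in> V" using v(1) less(2) by (simp add: subspace_diff subspace_scale)
        moreover have "v \<bullet> (x - (v \<bullet> x) *\<^sub>R v) = 0" using vv by (simp add: inner_diff_right)
        ultimately have "x - (v \<bullet> x) *\<^sub>R v \<in> span B" unfolding B(4) W_def by blast
        then show "x \<in> span (insert v B)" unfolding span_insert by blast
      qed
    qed
    moreover have "pairwise orthogonal (insert v B)"
      using B(2) BW unfolding pairwise_insert by (auto simp: W_def orthogonal_def inner_commute)
    moreover have "\<forall>b\<in>insert v B. norm b = 1 \<and> A *v b = (e(v := m)) b *\<^sub>R b"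
      using B(3) v \<open>v \<notin> B\<close> by auto
    ultimately show ?thesis using B(1)
      by (intro exI[of _ "insert v B"] exI[of _ "e(v := m)"]) simp
  qed
qed

definition eigenbasis :: "real^'n^'n \<Rightarrow> (real^'n) set \<Rightarrow> (real^'n \<Rightarrow> real) \<Rightarrow> bool" where
  "eigenbasis A B e \<longleftrightarrow> finite B \<and> pairwise orthogonal B \<and> (\<forall>v\<in>B. norm v = 1 \<and> A *v v = e v *\<^sub>R v) \<and>
     span B = UNIV"

lemma symmetric_eigenbasis_exists:
  assumes "transpose A = A"
  shows "\<exists>B e. eigenbasis A B e"
  using symmetric_eigenbasis[OF assms, of UNIV] by (simp add: eigenbasis_def)

lemma eigenbasis_expansion:
  assumes "eigenbasis A B e"
  shows "(\<Sum>v\<in>B. (v \<bullet> x) *\<^sub>R v) = x" and "A *v x = (\<Sum>v\<in>B. (e v * (v \<bullet> x)) *\<^sub>R v)"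
proof -
  show exp: "(\<Sum>v\<in>B. (v \<bullet> x) *\<^sub>R v) = x"
    using orthonormal_basis_expand[of B x] assms by (simp add: eigenbasis_def inner_commute)
  have "A *v x = A *v (\<Sum>v\<in>B. (v \<bullet> x) *\<^sub>R v)" by (simp add: exp)
  also have "\<dots> = (\<Sum>v\<in>B. (v \<bullet> x) *\<^sub>R (A *v v))"
    by (simp add: linear_sum[OF matrix_vector_mul_linear] matrix_vector_mult_scaleR)
  also have "\<dots> = (\<Sum>v\<in>B. (e v * (v \<bullet> x)) *\<^sub>R v)"
    using assms by (intro sum.cong) (auto simp: eigenbasis_def mult.commute)
  finally show "A *v x = (\<Sum>v\<in>B. (e v * (v \<bullet> x)) *\<^sub>R v)" .
qed

text \<open>The set of eigenvalues is finite, since each of them occurs in an eigenbasis, so its \<open>Min\<close> is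
  meaningful. It equals the minimum of the Rayleigh quotient.\<close>

lemma lambda_min_symmetric:
  fixes A :: "real^'n^'n"
  assumes sym: "transpose A = A"
  shows "\<exists>v. norm v = 1 \<and> A *v v = lambda_min A *\<^sub>R v"
    and "lambda_min A * (norm x)\<^sup>2 \<le> x \<bullet> (A *v x)"
proof -
  have "(UNIV :: (real^'n) set) \<noteq> {0}" using UNIV_not_singleton by blast
  then obtain v m where v: "norm v = 1" "A *v v = m *\<^sub>R v"
    and m: "\<forall>x. m * (norm x)\<^sup>2 \<le> x \<bullet> (A *v x)"
    using symmetric_invariant_subspace_min_eigenvector[OF sym, of UNIV] by auto
  obtain B e where eb: "eigenbasis A B e" using symmetric_eigenbasis_exists[OF sym] by blast
  then have B: "finite B" "pairwise orthogonal B" "\<And>v. v \<in> B \<Longrightarrow> norm v = 1"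
    "\<And>v. v \<in> B \<Longrightarrow> A *v v = e v *\<^sub>R v" by (auto simp: eigenbasis_def)
  have "eigenvalues A \<subseteq> e ` B"
  proof
    fix r assume "r \<in> eigenvalues A"
    then obtain x where x: "x \<noteq> 0" "A *v x = r *\<^sub>R x" by (auto simp: eigenvalues_def)
    have "\<exists>b\<in>B. b \<bullet> x \<noteq> 0"
    proof (rule ccontr)
      assume "\<not> ?thesis"
      then have "(\<Sum>v\<in>B. (v \<bullet> x) *\<^sub>R v) = 0" by (intro sum.neutral) simp
      then show False using eigenbasis_expansion(1)[OF eb, of x] x(1) by simp
    qed
    then obtain b where b: "b \<in> B" "b \<bullet> x \<noteq> 0" by blast
    have "r * (b \<bullet> x) = e b * (b \<bullet> x)"
      using symmetric_matrix_inner[OF sym, of b x] B(4)[OF b(1)] x(2)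
      by (simp only: inner_scaleR_left inner_scaleR_right)
    then show "r \<in> e ` B" using b by auto
  qed
  then have fin: "finite (eigenvalues A)" using B(1) finite_surj by blast
  have "lambda_min A = m" unfolding lambda_min_def
  proof (rule Min_eqI[OF fin])
    have "v \<noteq> 0" using v(1) by auto
    then show "m \<in> eigenvalues A" using v(2) by (auto simp: eigenvalues_def)
    fix r assume "r \<in> eigenvalues A"
    then obtain x where x: "x \<noteq> 0" "A *v x = r *\<^sub>R x" by (auto simp: eigenvalues_def)
    then show "m \<le> r" using m[rule_format, of x] by (simp add: power2_norm_eq_inner)
  qed
  then show "\<exists>v. norm v = 1 \<and> A *v v = lambda_min A *\<^sub>R v"
    and "lambda_min A * (norm x)\<^sup>2 \<le> x \<bullet> (A *v x)" using v m by auto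
qed

lemma le_lambda_min_iff:
  fixes A :: "real^'n^'n"
  assumes sym: "transpose A = A"
  shows "t \<le> lambda_min A \<longleftrightarrow> (\<forall>x. t * (norm x)\<^sup>2 \<le> x \<bullet> (A *v x))"
proof
  show "\<forall>x. t * (norm x)\<^sup>2 \<le> x \<bullet> (A *v x)" if "t \<le> lambda_min A"
  proof
    fix x :: "real^'n"
    have "t * (norm x)\<^sup>2 \<le> lambda_min A * (norm x)\<^sup>2" using that by (rule mult_right_mono) simp
    then show "t * (norm x)\<^sup>2 \<le> x \<bullet> (A *v x)" using lambda_min_symmetric(2)[OF sym, of x] by linarith
  qed
  obtain v where v: "norm v = 1" "A *v v = lambda_min A *\<^sub>R v"
    using lambda_min_symmetric(1)[OF sym] by blast
  show "t \<le> lambda_min A" if "\<forall>x. t * (norm x)\<^sup>2 \<le> x \<bullet> (A *v x)"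
    using that[rule_format, of v] v norm_eq_1[of v] by simp
qed

lemma psd_sqrt_exists:
  fixes A :: "real^'n^'n"
  assumes "pos_semidef A"
  shows "\<exists>B. pos_semidef B \<and> B ** B = A"
proof -
  have sym: "transpose A = A" and psd: "\<And>x. 0 \<le> x \<bullet> (A *v x)" using assms by (auto simp: pos_semidef_def)
  obtain B e where eb: "eigenbasis A B e" using symmetric_eigenbasis_exists[OF sym] by blast
  then have B: "finite B" "pairwise orthogonal B" "\<And>v. v \<in> B \<Longrightarrow> norm v = 1"
    "\<And>v. v \<in> B \<Longrightarrow> A *v v = e v *\<^sub>R v" by (auto simp: eigenbasis_def)
  have e: "0 \<le> e v" if "v \<in> B" for v
    using psd[of v] B(3,4)[OF that] by (simp add: norm_eq_1)
  define r where "r x = (\<Sum>v\<in>B. (sqrt (e v) * (v \<bullet> x)) *\<^sub>R v)" for x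
  have "linear r"
    by (rule linearI) (simp_all add: r_def inner_add_right algebra_simps sum.distrib scaleR_sum_right)
  then have R: "matrix r *v x = r x" for x by (simp add: matrix_works)
  have dot: "v \<bullet> r x = sqrt (e v) * (v \<bullet> x)" if v: "v \<in> B" for v x
  proof -
    have "v \<bullet> r x = (\<Sum>u\<in>B. sqrt (e u) * (u \<bullet> x) * (v \<bullet> u))" by (simp add: r_def inner_sum_right)
    also have "\<dots> = (\<Sum>u\<in>B. if u = v then sqrt (e v) * (v \<bullet> x) else 0)"
    proof (rule sum.cong)
      fix u assume u: "u \<in> B"
      have "v \<bullet> v = 1" using B(3)[OF v] by (simp add: norm_eq_1)
      moreover have "v \<bullet> u = 0" if "u \<noteq> v"
        using pairwiseD[OF B(2) v u] that by (simp add: orthogonal_def)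
      ultimately show "sqrt (e u) * (u \<bullet> x) * (v \<bullet> u) = (if u = v then sqrt (e v) * (v \<bullet> x) else 0)"
        by (cases "u = v") simp_all
    qed simp
    finally show ?thesis using B(1) v by simp
  qed
  have rsym: "x \<bullet> r y = r x \<bullet> y" for x y
    unfolding r_def inner_sum_right inner_sum_left
    by (rule sum.cong) (simp_all add: inner_commute)
  have "transpose (matrix r) = matrix r"
  proof -
    have "x \<bullet> (transpose (matrix r) *v y) = x \<bullet> (matrix r *v y)" for x y
    proof -
      have "x \<bullet> (transpose (matrix r) *v y) = (y v* matrix r) \<bullet> x"
        by (simp only: transpose_matrix_vector inner_commute)
      also have "\<dots> = y \<bullet> r x" by (simp only: dot_lmul_matrix R)
      also have "\<dots> = x \<bullet> r y" unfolding rsym[of x y] by (rule inner_commute)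
      finally show ?thesis by (simp only: R)
    qed
    then have "transpose (matrix r) *v y = matrix r *v y" for y
      using vector_eq_ldot[of "transpose (matrix r) *v y" "matrix r *v y"] by blast
    then show ?thesis unfolding matrix_eq by blast
  qed
  moreover have "0 \<le> x \<bullet> r x" for x
    unfolding r_def inner_sum_right
  proof (rule sum_nonneg)
    fix v assume "v \<in> B"
    have "x \<bullet> (sqrt (e v) * (v \<bullet> x)) *\<^sub>R v = sqrt (e v) * (v \<bullet> x)\<^sup>2"
      by (simp add: inner_commute power2_eq_square)
    also have "\<dots> \<ge> 0" using e[OF \<open>v \<in> B\<close>] by simp
    finally show "0 \<le> x \<bullet> (sqrt (e v) * (v \<bullet> x)) *\<^sub>R v" .
  qed
  moreover have "matrix r ** matrix r = A"
  proof -
    have "(matrix r ** matrix r) *v x = A *v x" for x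
    proof -
      have "r (r x) = (\<Sum>v\<in>B. (sqrt (e v) * (sqrt (e v) * (v \<bullet> x))) *\<^sub>R v)"
        unfolding r_def[of "r x"] using dot by (intro sum.cong) auto
      also have "\<dots> = A *v x"
        unfolding eigenbasis_expansion(2)[OF eb] using e by (intro sum.cong) (auto simp: mult.assoc[symmetric])
      finally show ?thesis by (simp add: R matrix_vector_mul_assoc[symmetric])
    qed
    then show ?thesis unfolding matrix_eq by blast
  qed
  ultimately show ?thesis unfolding pos_semidef_def by (intro exI[of _ "matrix r"]) (simp add: R)
qed

text \<open>If \<open>v\<close> is an eigenvector of \<open>B - C\<close> for \<open>e\<close>, then \<open>0 = |B v|\<^sup>2 - |C v|\<^sup>2 = e (v \<bullet> B v + v \<bullet> C v)\<close>.
  If \<open>e\<close> were nonzero, both nonnegative summands would vanish, and so would their difference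
  \<open>e |v|\<^sup>2\<close>.\<close>

lemma psd_sqrt_unique:
  fixes B C :: "real^'n^'n"
  assumes B: "pos_semidef B" and C: "pos_semidef C" and eq: "B ** B = C ** C"
  shows "B = C"
proof -
  have sB: "transpose B = B" and sC: "transpose C = C" using B C by (auto simp: pos_semidef_def)
  define D where "D = B - C"
  have sD: "transpose D = D"
    using sB sC by (simp add: D_def transpose_def vec_eq_iff)
  obtain E e where eb: "eigenbasis D E e" using symmetric_eigenbasis_exists[OF sD] by blast
  then have E: "finite E" "pairwise orthogonal E" "\<And>v. v \<in> E \<Longrightarrow> norm v = 1"
    "\<And>v. v \<in> E \<Longrightarrow> D *v v = e v *\<^sub>R v" by (auto simp: eigenbasis_def)
  have "e v = 0" if v: "v \<in> E" for v
  proof (rule ccontr)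
    assume ne: "e v \<noteq> 0"
    have Bv: "B *v v = C *v v + e v *\<^sub>R v"
      using E(4)[OF v] by (simp add: D_def matrix_vector_mult_diff_rdistrib algebra_simps)
    have nB: "(B *v v) \<bullet> (B *v v) = (C *v v) \<bullet> (C *v v)"
      by (simp add: symmetric_matrix_inner[OF sB] symmetric_matrix_inner[OF sC] matrix_vector_mul_assoc eq)
    have "(B *v v) \<bullet> (B *v v) - (C *v v) \<bullet> (C *v v) = e v * (v \<bullet> (B *v v) + v \<bullet> (C *v v))"
      unfolding Bv inner_add_left inner_add_right inner_scaleR_left inner_scaleR_right
      by (simp add: inner_commute[of "C *v v" v] algebra_simps)
    then have "v \<bullet> (B *v v) + v \<bullet> (C *v v) = 0" using ne nB by simp
    moreover have "0 \<le> v \<bullet> (B *v v)" "0 \<le> v \<bullet> (C *v v)" using B C by (auto simp: pos_semidef_def)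
    ultimately have "v \<bullet> (B *v v) = 0" "v \<bullet> (C *v v) = 0" by linarith+
    then have "e v * (v \<bullet> v) = 0" unfolding Bv by (simp add: inner_add_right)
    then show False using ne E(3)[OF v] by auto
  qed
  then have "D *v x = 0" for x unfolding eigenbasis_expansion(2)[OF eb] by simp
  then have "D = 0" unfolding matrix_eq by simp
  then show ?thesis by (simp add: D_def)
qed

lemma mat_sqrt_eqI:
  assumes "pos_semidef B" "B ** B = A"
  shows "mat_sqrt A = B"
  unfolding mat_sqrt_def using assms psd_sqrt_unique by (intro the_equality) auto

lemma mat_sqrt_psd:
  assumes "pos_semidef A"
  shows "pos_semidef (mat_sqrt A)" "mat_sqrt A ** mat_sqrt A = A"
proof -
  obtain B where "pos_semidef B" "B ** B = A" using psd_sqrt_exists[OF assms] by blast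
  then show "pos_semidef (mat_sqrt A)" "mat_sqrt A ** mat_sqrt A = A"
    using mat_sqrt_eqI[of B A] by simp_all
qed

section \<open>Square roots of average projections\<close>

text \<open>The average projection of an admissible selection has this property (\<open>subunit_pd_avg_proj\<close>). It makes the
  square root an invertible nonexpansive map and puts the smallest eigenvalue into \<open>(0, 1]\<close>.\<close>

definition subunit_pd :: "real^'n^'n \<Rightarrow> bool" where
  "subunit_pd P \<longleftrightarrow> transpose P = P \<and> (\<forall>x. x \<noteq> 0 \<longrightarrow> 0 < x \<bullet> (P *v x)) \<and> (\<forall>x. x \<bullet> (P *v x) \<le> (norm x)\<^sup>2)"

lemma matrix_inv_inverse:
  fixes A :: "real^'n^'n"
  assumes "invertible A"
  shows "A ** matrix_inv A = mat 1" "matrix_inv A ** A = mat 1"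
proof -
  have "A ** matrix_inv A = mat 1 \<and> matrix_inv A ** A = mat 1"
    unfolding matrix_inv_def using assms[unfolded invertible_def] by (rule someI_ex)
  then show "A ** matrix_inv A = mat 1" "matrix_inv A ** A = mat 1" by blast+
qed

lemma matrix_inv_involutive:
  fixes A :: "real^'n^'n"
  assumes "invertible A"
  shows "matrix_inv (matrix_inv A) = A"
proof -
  have "invertible (matrix_inv A)" using matrix_inv_inverse[OF assms] unfolding invertible_def by blast
  then have "matrix_inv (matrix_inv A) = (A ** matrix_inv A) ** matrix_inv (matrix_inv A)"
    using matrix_inv_inverse[OF assms] by simp
  also have "\<dots> = A"
    using matrix_inv_inverse[OF \<open>invertible (matrix_inv A)\<close>] by (simp add: matrix_mul_assoc[symmetric])
  finally show ?thesis .
qed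

context
  fixes P :: "real^'n^'n"
  assumes P: "subunit_pd P"
begin

lemma subunit_pd_sqrt:
  shows "transpose (mat_sqrt P) = mat_sqrt P" "mat_sqrt P ** mat_sqrt P = P"
    and "pos_semidef (mat_sqrt P)"
proof -
  have "0 \<le> x \<bullet> (P *v x)" for x
    using P unfolding subunit_pd_def by (cases "x = 0") (auto intro: less_imp_le)
  then have "pos_semidef P" using P unfolding pos_semidef_def subunit_pd_def by blast
  then show "mat_sqrt P ** mat_sqrt P = P" "pos_semidef (mat_sqrt P)" by (simp_all add: mat_sqrt_psd)
  then show "transpose (mat_sqrt P) = mat_sqrt P" by (simp add: pos_semidef_def)
qed

lemma norm_subunit_pd_sqrt:
  shows "(norm (mat_sqrt P *v x))\<^sup>2 = x \<bullet> (P *v x)" and "norm (mat_sqrt P *v x) \<le> norm x"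
proof -
  show eq: "(norm (mat_sqrt P *v x))\<^sup>2 = x \<bullet> (P *v x)"
    unfolding power2_norm_eq_inner symmetric_matrix_inner[OF subunit_pd_sqrt(1)]
    by (simp add: matrix_vector_mul_assoc subunit_pd_sqrt(2))
  show "norm (mat_sqrt P *v x) \<le> norm x"
    by (rule power2_le_imp_le) (use P in \<open>simp_all add: eq subunit_pd_def\<close>)
qed

lemma invertible_subunit_pd_sqrt: "invertible (mat_sqrt P)"
proof -
  have "x = 0" if "mat_sqrt P *v x = 0" for x
  proof (rule ccontr)
    assume "x \<noteq> 0"
    then have "0 < x \<bullet> (P *v x)" using P unfolding subunit_pd_def by blast
    then show False using norm_subunit_pd_sqrt(1)[of x] that by simp
  qed
  then show ?thesis
    unfolding invertible_left_inverse matrix_left_invertible_ker by blast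
qed

lemma inv_sqrt_cancel:
  shows "mat_sqrt P *v (inv_sqrt P *v x) = x" "inv_sqrt P *v (mat_sqrt P *v x) = x"
    and "matrix_inv (inv_sqrt P) = mat_sqrt P"
  using matrix_inv_inverse[OF invertible_subunit_pd_sqrt] matrix_inv_involutive[OF invertible_subunit_pd_sqrt]
  by (simp_all add: inv_sqrt_def matrix_vector_mul_assoc)

lemma lambda_min_subunit_pd: "0 < lambda_min P" "lambda_min P \<le> 1"
proof -
  obtain v where v: "norm v = 1" "P *v v = lambda_min P *\<^sub>R v"
    using lambda_min_symmetric(1)[of P] P unfolding subunit_pd_def by blast
  have eq: "v \<bullet> (P *v v) = lambda_min P" using v norm_eq_1[of v] by simp
  have "v \<noteq> 0" using v(1) by auto
  then have "0 < v \<bullet> (P *v v)" "v \<bullet> (P *v v) \<le> (norm v)\<^sup>2"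
    using P unfolding subunit_pd_def by blast+
  then show "0 < lambda_min P" "lambda_min P \<le> 1" unfolding eq using v(1) by simp_all
qed

end

section \<open>Measurability of matrix functions\<close>

lemma borel_measurable_vec_iff:
  fixes f :: "'a \<Rightarrow> real^'n"
  shows "f \<in> borel_measurable M \<longleftrightarrow> (\<forall>i. (\<lambda>x. f x $ i) \<in> borel_measurable M)"
  unfolding borel_measurable_euclidean_space[where f=f] by (auto simp: Basis_vec_def inner_axis)

lemma borel_measurable_matrix_iff:
  fixes f :: "'a \<Rightarrow> real^'n^'m"
  shows "f \<in> borel_measurable M \<longleftrightarrow> (\<forall>i j. (\<lambda>x. f x $ i $ j) \<in> borel_measurable M)"
  unfolding borel_measurable_euclidean_space[where f=f]
  by (auto simp: Basis_vec_def inner_axis)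

lemma borel_measurable_matrix_vector_mult:
  fixes f :: "'a \<Rightarrow> real^'n^'m"
  assumes "f \<in> borel_measurable M" "g \<in> borel_measurable M"
  shows "(\<lambda>x. f x *v g x) \<in> borel_measurable M"
proof -
  have [measurable]: "(\<lambda>x. f x $ i $ j) \<in> borel_measurable M" "(\<lambda>x. g x $ j) \<in> borel_measurable M" for i j
    using assms unfolding borel_measurable_matrix_iff borel_measurable_vec_iff by auto
  show ?thesis unfolding borel_measurable_vec_iff matrix_vector_mult_def by simp
qed

lemma borel_measurable_det:
  fixes f :: "'a \<Rightarrow> real^'n^'n"
  assumes [measurable]: "\<And>i j. (\<lambda>x. f x $ i $ j) \<in> borel_measurable M"
  shows "(\<lambda>x. det (f x)) \<in> borel_measurable M"
  unfolding det_def by measurable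

text \<open>Cramer's rule expresses the inverse by determinants, which are polynomials in the entries.\<close>

lemma borel_measurable_matrix_inv_mult:
  fixes f :: "'a \<Rightarrow> real^'n^'n"
  assumes f: "f \<in> borel_measurable M" and g: "g \<in> borel_measurable M"
    and inv: "\<And>x. x \<in> space M \<Longrightarrow> invertible (f x)"
  shows "(\<lambda>x. matrix_inv (f x) *v g x) \<in> borel_measurable M"
proof -
  have [measurable]: "(\<lambda>x. f x $ i $ j) \<in> borel_measurable M" "(\<lambda>x. g x $ j) \<in> borel_measurable M" for i j
    using f g unfolding borel_measurable_matrix_iff borel_measurable_vec_iff by auto
  define h where "h x = (\<chi> k. det (\<chi> i j. if j = k then g x $ i else f x $ i $ j) / det (f x))" for x
  have "matrix_inv (f x) *v g x = h x" if "x \<in> space M" for x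
  proof -
    have "f x *v (matrix_inv (f x) *v g x) = g x"
      using matrix_inv_inverse[OF inv[OF that]] by (simp add: matrix_vector_mul_assoc)
    moreover have "det (f x) \<noteq> 0" using inv[OF that] by (simp add: invertible_det_nz)
    ultimately show ?thesis unfolding h_def by (simp add: cramer)
  qed
  moreover have "h \<in> borel_measurable M"
  proof -
    have "(\<lambda>x. (\<chi> i j. if j = k then g x $ i else f x $ i $ j) $ i' $ j') \<in> borel_measurable M" for k i' j'
      by (cases "j' = k") simp_all
    then have [measurable]: "(\<lambda>x. det (\<chi> i j. if j = k then g x $ i else f x $ i $ j)) \<in> borel_measurable M" for k
      by (rule borel_measurable_det)
    have [measurable]: "(\<lambda>x. det (f x)) \<in> borel_measurable M" by (rule borel_measurable_det) simp
    show ?thesis unfolding borel_measurable_vec_iff h_def by simp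
  qed
  ultimately show ?thesis by (simp cong: measurable_cong)
qed

lemma continuous_matrix_vector_mult_left: "continuous_on S (\<lambda>A::real^'n^'m. A *v x)"
  unfolding matrix_vector_mult_def by (intro continuous_intros)

lemma norm_le_of_nonexpansive_matrix:
  fixes B :: "real^'n^'n"
  assumes "\<And>x. norm (B *v x) \<le> norm x"
  shows "norm B \<le> (\<Sum>i\<in>(UNIV::'n set). real CARD('n))"
proof -
  have "onorm ((*v) B) \<le> 1" using assms by (intro onorm_bound) simp_all
  then have "\<bar>B $ i $ j\<bar> \<le> 1" for i j using matrix_component_le_onorm[of B i j] by linarith
  then have "norm (B $ i) \<le> CARD('n)" for i
    using norm_le_l1_cart[of "B $ i"] sum_bounded_above[of UNIV "\<lambda>j. \<bar>B $ i $ j\<bar>" 1] by simp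
  then have "(\<Sum>i\<in>UNIV. norm (B $ i)) \<le> (\<Sum>i\<in>(UNIV::'n set). real CARD('n))" by (intro sum_mono)
  moreover have "norm B \<le> (\<Sum>i\<in>UNIV. norm (B $ i))" unfolding norm_vec_def by (rule L2_set_le_sum) simp
  ultimately show ?thesis by linarith
qed

text \<open>Squaring is continuous and injective on a compact set, so its inverse is continuous on the image.
  The image contains every \<open>subunit_pd\<close> matrix.\<close>

lemma continuous_mat_sqrt:
  "continuous_on ((\<lambda>B. B ** B) ` {B :: real^'n^'n. pos_semidef B \<and> (\<forall>x. norm (B *v x) \<le> norm x)}) mat_sqrt"
proof (rule continuous_on_inv)
  let ?K = "{B :: real^'n^'n. pos_semidef B \<and> (\<forall>x. norm (B *v x) \<le> norm x)}"
  show "continuous_on ?K (\<lambda>B. B ** B)"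
    unfolding matrix_matrix_mult_def by (intro continuous_intros)
  show "\<forall>B\<in>?K. mat_sqrt (B ** B) = B" using mat_sqrt_eqI by blast
  have "closed ?K"
  proof -
    have "closed {B :: real^'n^'n. transpose B = B}"
      unfolding transpose_def by (intro closed_Collect_eq continuous_intros)
    moreover have "closed {B :: real^'n^'n. \<forall>x. 0 \<le> x \<bullet> (B *v x)}"
      by (intro closed_Collect_all closed_Collect_le continuous_intros continuous_matrix_vector_mult_left)
    moreover have "closed {B :: real^'n^'n. \<forall>x. norm (B *v x) \<le> norm x}"
      by (intro closed_Collect_all closed_Collect_le continuous_intros continuous_matrix_vector_mult_left)
    ultimately have "closed ({B :: real^'n^'n. transpose B = B} \<inter> {B. \<forall>x. 0 \<le> x \<bullet> (B *v x)}
        \<inter> {B. \<forall>x. norm (B *v x) \<le> norm x})"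
      by (intro closed_Int)
    moreover have "?K = {B :: real^'n^'n. transpose B = B} \<inter> {B. \<forall>x. 0 \<le> x \<bullet> (B *v x)}
        \<inter> {B. \<forall>x. norm (B *v x) \<le> norm x}"
      by (auto simp: pos_semidef_def)
    ultimately show ?thesis by simp
  qed
  moreover have "bounded ?K"
    unfolding bounded_iff
  proof (intro exI ballI)
    fix B :: "real^'n^'n" assume "B \<in> ?K"
    then show "norm B \<le> (\<Sum>i\<in>(UNIV::'n set). real CARD('n))"
      by (intro norm_le_of_nonexpansive_matrix) simp
  qed
  ultimately show "compact ?K" by (simp add: compact_eq_bounded_closed)
qed

lemma borel_measurable_mat_sqrt:
  fixes f :: "'a \<Rightarrow> real^'n^'n"
  assumes f: "f \<in> borel_measurable M" and pd: "\<And>x. x \<in> space M \<Longrightarrow> subunit_pd (f x)"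
  shows "(\<lambda>x. mat_sqrt (f x)) \<in> borel_measurable M"
proof -
  define S :: "(real^'n^'n) set" where
    "S = (\<lambda>B. B ** B) ` {B. pos_semidef B \<and> (\<forall>x. norm (B *v x) \<le> norm x)}"
  have "f x \<in> S" if "x \<in> space M" for x
    unfolding S_def using subunit_pd_sqrt[OF pd[OF that]] norm_subunit_pd_sqrt(2)[OF pd[OF that]]
    by (intro image_eqI[of _ _ "mat_sqrt (f x)"]) auto
  then have "f \<in> M \<rightarrow>\<^sub>M restrict_space borel S"
    using f by (intro measurable_restrict_space2) auto
  moreover have "mat_sqrt \<in> borel_measurable (restrict_space borel S)"
    unfolding S_def by (rule borel_measurable_continuous_on_restrict[OF continuous_mat_sqrt])
  ultimately show ?thesis by (rule measurable_compose)
qed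

text \<open>The superlevel sets of \<open>lambda_min\<close> are given by closed linear conditions on the matrix.\<close>

lemma borel_measurable_lambda_min:
  fixes f :: "'a \<Rightarrow> real^'n^'n"
  assumes f: "f \<in> borel_measurable M" and sym: "\<And>x. x \<in> space M \<Longrightarrow> transpose (f x) = f x"
  shows "(\<lambda>x. lambda_min (f x)) \<in> borel_measurable M"
  unfolding borel_measurable_iff_ge
proof
  fix t
  define K where "K = {A :: real^'n^'n. \<forall>x. t * (norm x)\<^sup>2 \<le> x \<bullet> (A *v x)}"
  have "closed K" unfolding K_def
    by (intro closed_Collect_all closed_Collect_le continuous_intros continuous_matrix_vector_mult_left)
  moreover have "{x \<in> space M. t \<le> lambda_min (f x)} = f -` K \<inter> space M"
    using le_lambda_min_iff[OF sym] by (auto simp: K_def)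
  ultimately show "{x \<in> space M. t \<le> lambda_min (f x)} \<in> sets M"
    using f by (simp add: measurable_sets_borel borel_closed measurable_sets)
qed

section \<open>Orthogonal and average projections\<close>

text \<open>A point of \<open>F\<close> whose difference from \<open>x\<close> is orthogonal to \<open>F\<close> is the closest point, by Pythagoras.
  Linearity follows since this description of it is linear in \<open>x\<close>.\<close>

lemma subspace_closest_point:
  fixes F :: "(real^'n) set"
  assumes F: "subspace F"
  shows "closest_point F x \<in> F" and "w \<in> F \<Longrightarrow> (x - closest_point F x) \<bullet> w = 0"
    and "linear (closest_point F)"
proof -
  have eq: "closest_point F x = y" if y: "y \<in> F" and orth: "\<And>w. w \<in> F \<Longrightarrow> (x - y) \<bullet> w = 0" for x y
  proof -
    define p where "p = closest_point F x"
    have p: "p \<in> F" unfolding p_def using F subspace_0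
      by (intro closest_point_in_set closed_subspace) auto
    have "norm (x - p) \<le> norm (x - y)"
      unfolding p_def using closest_point_le[OF closed_subspace[OF F] y, of x] by (simp add: dist_norm)
    then have "(norm (x - p))\<^sup>2 \<le> (norm (x - y))\<^sup>2" by (simp add: power_mono)
    moreover have "(norm (x - p))\<^sup>2 = (norm (x - y))\<^sup>2 + (norm (y - p))\<^sup>2"
    proof -
      have "x - p = (x - y) + (y - p)" by simp
      moreover have "(x - y) \<bullet> (y - p) = 0" using orth y p F by (simp add: subspace_diff)
      ultimately show ?thesis by (simp only: norm_add_Pythagorean orthogonal_def)
    qed
    ultimately have "(norm (y - p))\<^sup>2 \<le> 0" by linarith
    then show ?thesis by (simp add: p_def)
  qed
  have ex: "\<exists>y\<in>F. \<forall>w\<in>F. (x - y) \<bullet> w = 0" for x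
  proof -
    obtain y z where "y \<in> span F" "\<And>w. w \<in> span F \<Longrightarrow> orthogonal z w" "x = y + z"
      using orthogonal_subspace_decomp_exists[of F x] by metis
    then show ?thesis using span_eq_iff[THEN iffD2, OF F] by (intro bexI[of _ y]) (auto simp: orthogonal_def)
  qed
  have props: "closest_point F x \<in> F \<and> (\<forall>w\<in>F. (x - closest_point F x) \<bullet> w = 0)" for x
    using ex[of x] eq[of _ x] by blast
  then show "closest_point F x \<in> F" "w \<in> F \<Longrightarrow> (x - closest_point F x) \<bullet> w = 0" by blast+
  show "linear (closest_point F)"
  proof (rule linearI)
    fix u v :: "real^'n" and c :: real
    show "closest_point F (u + v) = closest_point F u + closest_point F v"
    proof (rule eq)
      show "closest_point F u + closest_point F v \<in> F" using props F by (simp add: subspace_add)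
      show "(u + v - (closest_point F u + closest_point F v)) \<bullet> w = 0" if "w \<in> F" for w
        using props[of u] props[of v] that by (simp add: inner_diff_left inner_add_left)
    qed
    show "closest_point F (c *\<^sub>R u) = c *\<^sub>R closest_point F u"
    proof (rule eq)
      show "c *\<^sub>R closest_point F u \<in> F" using props F by (simp add: subspace_scale)
      show "(c *\<^sub>R u - c *\<^sub>R closest_point F u) \<bullet> w = 0" if "w \<in> F" for w
        using props[of u] that by (simp add: inner_diff_left)
    qed
  qed
qed

lemma orth_proj_subspace:
  fixes F :: "(real^'n) set"
  assumes F: "subspace F"
  shows "orth_proj F *v x \<in> F" and "w \<in> F \<Longrightarrow> (x - orth_proj F *v x) \<bullet> w = 0"
    and "transpose (orth_proj F) = orth_proj F"
    and "(norm (orth_proj F *v x))\<^sup>2 = x \<bullet> (orth_proj F *v x)"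
    and "norm (orth_proj F *v x) \<le> norm x"
    and "orth_proj F *v x = 0 \<longleftrightarrow> x \<in> orthogonal_comp F"
proof -
  have mv: "orth_proj F *v x = closest_point F x" for x
    unfolding orth_proj_def using subspace_closest_point(3)[OF F] by (simp add: matrix_works)
  show mem: "orth_proj F *v x \<in> F" for x unfolding mv by (rule subspace_closest_point[OF F])
  show orth: "w \<in> F \<Longrightarrow> (x - orth_proj F *v x) \<bullet> w = 0" for x w
    unfolding mv by (rule subspace_closest_point(2)[OF F])
  have idem: "x \<bullet> (orth_proj F *v y) = (orth_proj F *v x) \<bullet> (orth_proj F *v y)" for x y
    using orth[OF mem, of x y] by (simp add: inner_diff_left)
  have sym: "x \<bullet> (orth_proj F *v y) = (orth_proj F *v x) \<bullet> y" for x y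
    using idem[of x y] idem[of y x] by (simp add: inner_commute)
  have "transpose (orth_proj F) *v y = orth_proj F *v y" for y
  proof -
    have "x \<bullet> (transpose (orth_proj F) *v y) = x \<bullet> (orth_proj F *v y)" for x
    proof -
      have "x \<bullet> (transpose (orth_proj F) *v y) = (y v* orth_proj F) \<bullet> x"
        by (simp only: transpose_matrix_vector inner_commute)
      also have "\<dots> = y \<bullet> (orth_proj F *v x)" by (simp only: dot_lmul_matrix)
      also have "\<dots> = x \<bullet> (orth_proj F *v y)" unfolding sym[of x y] by (rule inner_commute)
      finally show ?thesis .
    qed
    then show ?thesis using vector_eq_ldot[of "transpose (orth_proj F) *v y" "orth_proj F *v y"] by blast
  qed
  then show "transpose (orth_proj F) = orth_proj F" unfolding matrix_eq by blast
  show sq: "(norm (orth_proj F *v x))\<^sup>2 = x \<bullet> (orth_proj F *v x)"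
    using idem[of x x] by (simp add: power2_norm_eq_inner)
  show "norm (orth_proj F *v x) \<le> norm x"
  proof -
    have "(norm (orth_proj F *v x))\<^sup>2 \<le> norm x * norm (orth_proj F *v x)"
      unfolding sq by (rule norm_cauchy_schwarz)
    then show ?thesis by (cases "orth_proj F *v x = 0") (auto simp: power2_eq_square)
  qed
  show "orth_proj F *v x = 0 \<longleftrightarrow> x \<in> orthogonal_comp F"
  proof
    assume "orth_proj F *v x = 0"
    then show "x \<in> orthogonal_comp F"
      using orth[of _ x] by (auto simp: orthogonal_comp_def orthogonal_def inner_commute)
  next
    assume "x \<in> orthogonal_comp F"
    then have "x \<bullet> (orth_proj F *v x) = 0"
      using mem[of x] by (auto simp: orthogonal_comp_def orthogonal_def inner_commute)
    then show "orth_proj F *v x = 0" using sq by simp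
  qed
qed

text \<open>The two summands are orthogonal, and \<open>|P x|\<^sup>2 = x \<bullet> P x\<close> for an orthogonal projection \<open>P\<close>.\<close>

lemma norm_projected_update:
  fixes F :: "(real^'n) set"
  assumes F: "subspace F"
  shows "(norm (orth_proj F *v a + (b - orth_proj F *v b)))\<^sup>2
    = (norm b)\<^sup>2 + a \<bullet> (orth_proj F *v a) - b \<bullet> (orth_proj F *v b)"
proof -
  have "(orth_proj F *v a) \<bullet> (b - orth_proj F *v b) = 0"
    using orth_proj_subspace(2)[OF F orth_proj_subspace(1)[OF F]] by (simp add: inner_commute)
  then have 1: "(norm (orth_proj F *v a + (b - orth_proj F *v b)))\<^sup>2
      = (norm (orth_proj F *v a))\<^sup>2 + (norm (b - orth_proj F *v b))\<^sup>2"
    by (simp only: norm_add_Pythagorean orthogonal_def)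
  have "(norm (b - orth_proj F *v b))\<^sup>2
      = (norm b)\<^sup>2 - 2 * (b \<bullet> (orth_proj F *v b)) + (norm (orth_proj F *v b))\<^sup>2"
    unfolding power2_norm_eq_inner inner_diff_left inner_diff_right
    by (simp add: inner_commute[of "orth_proj F *v b" b])
  then show ?thesis using 1 unfolding orth_proj_subspace(4)[OF F] by linarith
qed

lemma space_subspace_algebra: "space subspace_algebra = {F. subspace F}"
  by (simp add: subspace_algebra_def)

lemma measurable_orth_proj: "orth_proj \<in> borel_measurable subspace_algebra"
  unfolding subspace_algebra_def by (rule measurable_vimage_algebra1) simp

context
  fixes \<nu> :: "(real^'n) set measure"
  assumes \<nu>: "\<nu> \<in> space (prob_algebra subspace_algebra)"
begin

lemma law_prob_space: "prob_space \<nu>" "sets \<nu> = sets subspace_algebra" "space \<nu> = {F. subspace F}"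
  using \<nu> sets_eq_imp_space_eq[of \<nu> subspace_algebra]
  by (auto simp: space_prob_algebra space_subspace_algebra)

lemma integrable_orth_proj: "integrable \<nu> orth_proj"
proof -
  interpret prob_space \<nu> by (rule law_prob_space)
  have "orth_proj \<in> borel_measurable \<nu>"
    using measurable_orth_proj by (simp cong: measurable_cong_sets add: law_prob_space(2))
  moreover have "AE F in \<nu>. norm (orth_proj F) \<le> (\<Sum>i\<in>(UNIV::'n set). real CARD('n))"
    by (intro AE_I2 norm_le_of_nonexpansive_matrix orth_proj_subspace(5)) (simp add: law_prob_space(3))
  ultimately show ?thesis by (intro integrable_const_bound)
qed

lemma avg_proj_inner:
  "integrable \<nu> (\<lambda>F. x \<bullet> (orth_proj F *v y))"
  "(\<integral>F. x \<bullet> (orth_proj F *v y) \<partial>\<nu>) = x \<bullet> (avg_proj \<nu> *v y)"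
proof -
  have "linear (\<lambda>A :: real^'n^'n. x \<bullet> (A *v y))"
    by (rule linearI) (simp_all add: matrix_vector_mult_add_rdistrib inner_add_right scaleR_matrix_vector_assoc[symmetric])
  then have bl: "bounded_linear (\<lambda>A :: real^'n^'n. x \<bullet> (A *v y))"
    by (simp add: linear_conv_bounded_linear)
  show "integrable \<nu> (\<lambda>F. x \<bullet> (orth_proj F *v y))"
    by (rule integrable_bounded_linear[OF bl integrable_orth_proj])
  show "(\<integral>F. x \<bullet> (orth_proj F *v y) \<partial>\<nu>) = x \<bullet> (avg_proj \<nu> *v y)"
    unfolding avg_proj_def by (rule integral_bounded_linear[OF bl integrable_orth_proj])
qed

text \<open>The quadratic form of the average projection is the expected squared norm of the projected vector.
  If it vanished at \<open>x\<close>, then \<open>x\<close> would almost surely be orthogonal to the random subspace, which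
  admissibility excludes.\<close>

lemma subunit_pd_avg_proj:
  assumes adm: "admissible \<nu>"
  shows "subunit_pd (avg_proj \<nu>)"
  unfolding subunit_pd_def
proof (intro conjI allI impI)
  interpret prob_space \<nu> by (rule law_prob_space)
  have sub: "subspace F" if "F \<in> space \<nu>" for F using that by (simp add: law_prob_space)
  have "x \<bullet> (avg_proj \<nu> *v y) = y \<bullet> (avg_proj \<nu> *v x)" for x y
    unfolding avg_proj_inner(2)[symmetric]
  proof (rule Bochner_Integration.integral_cong)
    fix F assume "F \<in> space \<nu>"
    then show "x \<bullet> (orth_proj F *v y) = y \<bullet> (orth_proj F *v x)"
      using symmetric_matrix_inner[OF orth_proj_subspace(3)[OF sub], of F x y] by (simp add: inner_commute)
  qed simp
  then have "x \<bullet> (transpose (avg_proj \<nu>) *v y) = x \<bullet> (avg_proj \<nu> *v y)" for x y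
    unfolding transpose_matrix_vector
    using dot_lmul_matrix[of y "avg_proj \<nu>" x] inner_commute[of x "y v* avg_proj \<nu>"] by simp
  then have "transpose (avg_proj \<nu>) *v y = avg_proj \<nu> *v y" for y
    using vector_eq_ldot[of "transpose (avg_proj \<nu>) *v y" "avg_proj \<nu> *v y"] by blast
  then show "transpose (avg_proj \<nu>) = avg_proj \<nu>" unfolding matrix_eq by blast
  fix x :: "real^'n"
  have "x \<bullet> (avg_proj \<nu> *v x) = (\<integral>F. (norm (orth_proj F *v x))\<^sup>2 \<partial>\<nu>)"
    unfolding avg_proj_inner(2)[symmetric]
    using orth_proj_subspace(4)[OF sub] by (intro Bochner_Integration.integral_cong) auto
  have int: "integrable \<nu> (\<lambda>F. (norm (orth_proj F *v x))\<^sup>2)"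
    using avg_proj_inner(1)[of x x] by (rule Bochner_Integration.integrable_cong[THEN iffD1, rotated 2])
      (simp_all add: orth_proj_subspace(4)[OF sub])
  have eq: "x \<bullet> (avg_proj \<nu> *v x) = (\<integral>F. (norm (orth_proj F *v x))\<^sup>2 \<partial>\<nu>)" by fact
  have "(\<integral>F. (norm (orth_proj F *v x))\<^sup>2 \<partial>\<nu>) \<le> (\<integral>F. (norm x)\<^sup>2 \<partial>\<nu>)"
    using int orth_proj_subspace(5)[OF sub] by (intro integral_mono power_mono) auto
  then show "x \<bullet> (avg_proj \<nu> *v x) \<le> (norm x)\<^sup>2" unfolding eq by (simp add: prob_space)
  assume "x \<noteq> 0"
  show "0 < x \<bullet> (avg_proj \<nu> *v x)"
  proof (rule ccontr)
    assume "\<not> ?thesis"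
    moreover have "0 \<le> x \<bullet> (avg_proj \<nu> *v x)" unfolding eq by simp
    ultimately have "(\<integral>F. (norm (orth_proj F *v x))\<^sup>2 \<partial>\<nu>) = 0" unfolding eq by linarith
    then have "AE F in \<nu>. orth_proj F *v x = 0"
      using integral_nonneg_eq_0_iff_AE[OF int] by simp
    then have "AE F in \<nu>. F \<in> {F \<in> space \<nu>. x \<in> orthogonal_comp F}"
      by (rule AE_mp) (auto intro!: AE_I2 simp: orth_proj_subspace(6) law_prob_space(3))
    moreover have "{F \<in> space \<nu>. x \<in> orthogonal_comp F} \<in> sets \<nu>"
    proof -
      have "(\<lambda>F. orth_proj F *v x) \<in> borel_measurable \<nu>"
        using measurable_orth_proj by (intro borel_measurable_matrix_vector_mult)
          (simp_all cong: measurable_cong_sets add: law_prob_space(2))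
      then have "{F \<in> space \<nu>. orth_proj F *v x = 0} \<in> sets \<nu>" by measurable
      moreover have "{F \<in> space \<nu>. orth_proj F *v x = 0} = {F \<in> space \<nu>. x \<in> orthogonal_comp F}"
        using orth_proj_subspace(6)[OF sub] by blast
      ultimately show ?thesis by simp
    qed
    ultimately have "measure \<nu> {F \<in> space \<nu>. x \<in> orthogonal_comp F} = 1"
      by (simp add: prob_eq_1)
    then show False using adm \<open>x \<noteq> 0\<close> unfolding admissible_def by fastforce
  qed
qed

lemma expected_projected_update:
  "(\<integral>\<^sup>+F. ennreal ((norm (orth_proj F *v a + (b - orth_proj F *v b)))\<^sup>2) \<partial>\<nu>)
    = ennreal ((norm b)\<^sup>2 + a \<bullet> (avg_proj \<nu> *v a) - b \<bullet> (avg_proj \<nu> *v b))"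
proof -
  interpret prob_space \<nu> by (rule law_prob_space)
  have int: "integrable \<nu> (\<lambda>F. (norm b)\<^sup>2 + a \<bullet> (orth_proj F *v a) - b \<bullet> (orth_proj F *v b))"
    by (intro Bochner_Integration.integrable_add Bochner_Integration.integrable_diff avg_proj_inner) simp
  have eq: "(norm (orth_proj F *v a + (b - orth_proj F *v b)))\<^sup>2
      = (norm b)\<^sup>2 + a \<bullet> (orth_proj F *v a) - b \<bullet> (orth_proj F *v b)" if "F \<in> space \<nu>" for F
    using that by (intro norm_projected_update) (simp add: law_prob_space)
  have "(\<integral>\<^sup>+F. ennreal ((norm (orth_proj F *v a + (b - orth_proj F *v b)))\<^sup>2) \<partial>\<nu>)
      = (\<integral>\<^sup>+F. ennreal ((norm b)\<^sup>2 + a \<bullet> (orth_proj F *v a) - b \<bullet> (orth_proj F *v b)) \<partial>\<nu>)"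
    using eq by (intro nn_integral_cong) simp
  also have "\<dots> = ennreal (\<integral>F. (norm b)\<^sup>2 + a \<bullet> (orth_proj F *v a) - b \<bullet> (orth_proj F *v b) \<partial>\<nu>)"
    using eq by (intro nn_integral_eq_integral int AE_I2) (metis zero_le_power2)
  also have "(\<integral>F. (norm b)\<^sup>2 + a \<bullet> (orth_proj F *v a) - b \<bullet> (orth_proj F *v b) \<partial>\<nu>)
      = (norm b)\<^sup>2 + a \<bullet> (avg_proj \<nu> *v a) - b \<bullet> (avg_proj \<nu> *v b)"
    using avg_proj_inner by (simp add: prob_space)
  finally show ?thesis .
qed

end

section \<open>One iteration\<close>

locale composite_problem =
  fixes f :: "real^'n \<Rightarrow> real" and g :: "real^'n \<Rightarrow> ereal"
    and L \<mu> \<gamma> :: real and xs :: "real^'n"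
  assumes smooth: "L_smooth L f" and \<mu>_pos: "0 < \<mu>" and strong: "strongly_convex \<mu> f"
    and g_convex: "convex_fun g" and g_proper: "proper_fun g" and g_lsc: "lower_semicont g"
    and minimiser: "is_arg_min (\<lambda>x. ereal (f x) + g x) (\<lambda>_. True) xs"
    and \<gamma>_pos: "0 < \<gamma>" and \<gamma>_le: "\<gamma> \<le> 2 / (\<mu> + L)"
begin

text \<open>The point whose image under \<open>prox\<close> is the minimiser.\<close>

definition us :: "real^'n" where "us = xs - \<gamma> *\<^sub>R grad f xs"

text \<open>A gradient step contracts squared distances by \<open>1 - \<kappa>\<close>, and \<open>\<alpha> = \<kappa> \<lambda>\<^sub>m\<^sub>i\<^sub>n(P)\<close>.\<close>

definition \<kappa> :: real where "\<kappa> = 2 * \<gamma> * \<mu> * L / (\<mu> + L)"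

lemma \<mu>_le_L: "\<mu> \<le> L" by (rule smooth_strongly_convex_cocoercive(2)[OF smooth strong])

lemma \<kappa>_bounds: "0 < \<kappa>" "\<kappa> \<le> 1"
proof -
  have pos: "0 < \<mu> + L" "0 < \<mu>" "0 < L" using \<mu>_pos \<mu>_le_L by auto
  then show "0 < \<kappa>" using \<gamma>_pos by (simp add: \<kappa>_def)
  have "\<kappa> = (2 * \<mu> * L / (\<mu> + L)) * \<gamma>" by (simp add: \<kappa>_def)
  also have "\<dots> \<le> (2 * \<mu> * L / (\<mu> + L)) * (2 / (\<mu> + L))"
    using pos \<gamma>_le by (intro mult_left_mono) auto
  also have "\<dots> = 4 * \<mu> * L / (\<mu> + L)\<^sup>2" by (simp add: power2_eq_square)
  also have "\<dots> \<le> 1"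
  proof -
    have "4 * \<mu> * L \<le> (\<mu> + L)\<^sup>2" using sum_squares_ge_zero[of "\<mu> - L" 0]
      by (simp add: power2_eq_square algebra_simps)
    then show ?thesis using pos by simp
  qed
  finally show "\<kappa> \<le> 1" .
qed

lemma alpha_eq: "alpha \<gamma> \<mu> L P = \<kappa> * lambda_min P"
  by (simp add: alpha_def \<kappa>_def)

lemma alpha_bounds:
  assumes "subunit_pd P"
  shows "0 < alpha \<gamma> \<mu> L P" "alpha \<gamma> \<mu> L P \<le> 1"
  using lambda_min_subunit_pd[OF assms] \<kappa>_bounds mult_mono[of \<kappa> 1 "lambda_min P" 1]
  by (simp_all add: alpha_eq)

lemma minimiser_slope: "g xs \<noteq> \<infinity>" "g xs - ereal (grad f xs \<bullet> (y - xs)) \<le> g y"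
proof -
  have "GDERIV f xs :> grad f xs" using smooth grad_gderiv unfolding L_smooth_def by blast
  from minimiser_subgradient[OF g_convex g_proper this minimiser]
  show "g xs \<noteq> \<infinity>" "g xs - ereal (grad f xs \<bullet> (y - xs)) \<le> g y" by auto
qed

lemma prox_nonexpansive: "norm (prox \<gamma> g a - prox \<gamma> g b) \<le> norm (a - b)"
  by (rule prox_nonexpansive_and_fixed(1)[OF g_convex g_proper g_lsc \<gamma>_pos minimiser_slope])

lemma prox_us: "prox \<gamma> g us = xs"
  unfolding us_def by (rule prox_nonexpansive_and_fixed(2)[OF g_convex g_proper g_lsc \<gamma>_pos minimiser_slope])

lemma gradient_step: "(norm ((x - \<gamma> *\<^sub>R grad f x) - us))\<^sup>2 \<le> (1 - \<kappa>) * (norm (x - xs))\<^sup>2"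
  using gradient_step_contraction[OF smooth strong \<mu>_pos \<gamma>_pos \<gamma>_le, of x xs]
  by (simp add: us_def \<kappa>_def)

text \<open>The square root of \<open>P\<close> sends \<open>Q us\<close> to \<open>us\<close>, and \<open>prox\<close> sends \<open>us\<close> to \<open>xs\<close>.\<close>

lemma prox_error:
  assumes P: "subunit_pd P"
  shows "(norm (prox \<gamma> g (mat_sqrt P *v z) - xs))\<^sup>2
      \<le> (z - inv_sqrt P *v us) \<bullet> (P *v (z - inv_sqrt P *v us))"
    and "norm (prox \<gamma> g (mat_sqrt P *v z) - xs) \<le> norm (z - inv_sqrt P *v us)"
proof -
  have "mat_sqrt P *v (z - inv_sqrt P *v us) = mat_sqrt P *v z - us"
    by (simp add: matrix_vector_mult_diff_distrib inv_sqrt_cancel[OF P])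
  then have le: "norm (prox \<gamma> g (mat_sqrt P *v z) - xs) \<le> norm (mat_sqrt P *v (z - inv_sqrt P *v us))"
    using prox_nonexpansive[of "mat_sqrt P *v z" us] by (simp add: prox_us)
  then show "(norm (prox \<gamma> g (mat_sqrt P *v z) - xs))\<^sup>2
      \<le> (z - inv_sqrt P *v us) \<bullet> (P *v (z - inv_sqrt P *v us))"
    unfolding norm_subunit_pd_sqrt(1)[OF P, symmetric] by (simp add: power_mono)
  show "norm (prox \<gamma> g (mat_sqrt P *v z) - xs) \<le> norm (z - inv_sqrt P *v us)"
    using le norm_subunit_pd_sqrt(2)[OF P] by (rule order_trans)
qed

text \<open>The heart of the proof: the gain from the gradient step and the loss of the old component are both
  measured in the norm of \<open>P\<close>, and \<open>\<lambda>\<^sub>m\<^sub>i\<^sub>n(P)\<close> enters only when the difference is compared with the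
  Euclidean norm at the end.\<close>

lemma expected_contraction:
  fixes \<nu> :: "(real^'n) set measure" and z :: "real^'n"
  assumes \<nu>: "\<nu> \<in> space (prob_algebra subspace_algebra)" and adm: "admissible \<nu>"
  defines "P \<equiv> avg_proj \<nu>"
  defines "x \<equiv> prox \<gamma> g (mat_sqrt P *v z)"
  defines "y \<equiv> inv_sqrt P *v (x - \<gamma> *\<^sub>R grad f x)"
  defines "zs \<equiv> inv_sqrt P *v us"
  shows "(\<integral>\<^sup>+F. ennreal ((norm (orth_proj F *v y + (mat 1 - orth_proj F) *v z - zs))\<^sup>2) \<partial>\<nu>)
    \<le> ennreal ((1 - alpha \<gamma> \<mu> L P) * (norm (z - zs))\<^sup>2)"
proof -
  have P: "subunit_pd P" unfolding P_def by (rule subunit_pd_avg_proj[OF \<nu> adm])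
  define a b where "a = y - zs" and "b = z - zs"
  have "orth_proj F *v y + (mat 1 - orth_proj F) *v z - zs = orth_proj F *v a + (b - orth_proj F *v b)" for F
    by (simp add: a_def b_def matrix_vector_mult_diff_distrib matrix_vector_mult_diff_rdistrib)
  then have "(\<integral>\<^sup>+F. ennreal ((norm (orth_proj F *v y + (mat 1 - orth_proj F) *v z - zs))\<^sup>2) \<partial>\<nu>)
      = ennreal ((norm b)\<^sup>2 + a \<bullet> (P *v a) - b \<bullet> (P *v b))"
    unfolding P_def by (simp only: expected_projected_update[OF \<nu>])
  also have "\<dots> \<le> ennreal ((1 - alpha \<gamma> \<mu> L P) * (norm b)\<^sup>2)"
  proof (rule ennreal_leI)
    have "mat_sqrt P *v a = (x - \<gamma> *\<^sub>R grad f x) - us"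
      by (simp add: a_def y_def zs_def matrix_vector_mult_diff_distrib inv_sqrt_cancel[OF P])
    then have "a \<bullet> (P *v a) = (norm ((x - \<gamma> *\<^sub>R grad f x) - us))\<^sup>2"
      using norm_subunit_pd_sqrt(1)[OF P, of a] by simp
    also have "\<dots> \<le> (1 - \<kappa>) * (norm (x - xs))\<^sup>2" by (rule gradient_step)
    also have "\<dots> \<le> (1 - \<kappa>) * (b \<bullet> (P *v b))"
      using prox_error(1)[OF P, of z] \<kappa>_bounds unfolding x_def b_def zs_def by (intro mult_left_mono) auto
    finally have "(norm b)\<^sup>2 + a \<bullet> (P *v a) - b \<bullet> (P *v b) \<le> (norm b)\<^sup>2 - \<kappa> * (b \<bullet> (P *v b))"
      by (simp add: algebra_simps)
    also have "\<dots> \<le> (norm b)\<^sup>2 - \<kappa> * (lambda_min P * (norm b)\<^sup>2)"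
      using P \<kappa>_bounds lambda_min_symmetric(2)[of P b] unfolding subunit_pd_def
      by (intro diff_mono mult_left_mono) auto
    finally show "(norm b)\<^sup>2 + a \<bullet> (P *v a) - b \<bullet> (P *v b) \<le> (1 - alpha \<gamma> \<mu> L P) * (norm b)\<^sup>2"
      by (simp add: alpha_eq algebra_simps)
  qed
  finally show ?thesis by (simp add: b_def)
qed

lemma rescaling_error:
  assumes P: "subunit_pd P" and P': "subunit_pd P'"
  shows "norm ((inv_sqrt P' ** matrix_inv (inv_sqrt P)) *v z - inv_sqrt P' *v us)
    \<le> spectral_norm (inv_sqrt P' ** matrix_inv (inv_sqrt P)) * norm (z - inv_sqrt P *v us)"
proof -
  let ?R = "inv_sqrt P' ** matrix_inv (inv_sqrt P)"
  have "?R *v z - inv_sqrt P' *v us = ?R *v (z - inv_sqrt P *v us)"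
    by (simp add: matrix_vector_mult_diff_distrib matrix_vector_mul_assoc[symmetric]
        inv_sqrt_cancel[OF P])
  also have "norm \<dots> \<le> spectral_norm ?R * norm (z - inv_sqrt P *v us)"
    unfolding spectral_norm_def by (rule onorm) (rule matrix_vector_mul_bounded_linear)
  finally show ?thesis .
qed

end

section \<open>Adaptation times\<close>

text \<open>Statements about the enumeration are reduced to the finite set \<open>A \<inter> {..k}\<close>. When \<open>A\<close> is random,
  this set takes finitely many values, so every function of it is measurable with respect to the past.\<close>

lemma enumerate_le_iff:
  fixes A :: "nat set"
  assumes A: "infinite A"
  shows "enumerate A n \<le> k \<longleftrightarrow> n < card (A \<inter> {..k})"
proof -
  define c where "c = (LEAST n. k < enumerate A n)"
  have "k < enumerate A (Suc k)" using le_enumerate[OF A, of "Suc k"] by simp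
  then have c: "k < enumerate A c" unfolding c_def by (rule LeastI)
  have iff: "enumerate A n \<le> k \<longleftrightarrow> n < c" for n
  proof
    show "n < c" if "enumerate A n \<le> k"
      using that c enumerate_mono_le_iff[OF A, of c n] by (meson not_le order_less_le_trans le_less_trans leD)
    show "enumerate A n \<le> k" if "n < c" using not_less_Least[OF that[unfolded c_def]] by simp
  qed
  have "A \<inter> {..k} = enumerate A ` {..<c}"
  proof
    show "A \<inter> {..k} \<subseteq> enumerate A ` {..<c}"
    proof
      fix a assume a: "a \<in> A \<inter> {..k}"
      then obtain n where "a = enumerate A n" using enumerate_Ex[OF A] by auto
      then show "a \<in> enumerate A ` {..<c}" using a iff[of n] by auto
    qed
    show "enumerate A ` {..<c} \<subseteq> A \<inter> {..k}" using iff enumerate_in_set[OF A] by auto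
  qed
  then have "card (A \<inter> {..k}) = c"
    using strict_mono_enumerate[OF A] by (simp add: card_image strict_mono_imp_inj_on inj_on_subset)
  then show ?thesis using iff by simp
qed

context
  fixes A :: "nat set"
  assumes A: "infinite A" "0 \<in> A"
begin

lemma card_upto_pos: "0 < card (A \<inter> {..k})"
  using A by (auto simp: card_gt_0_iff)

lemma cycle_iff: "enumerate A l \<le> k \<and> k < enumerate A (Suc l) \<longleftrightarrow> l = cycle A k"
  and cycle_eq_card: "cycle A k = card (A \<inter> {..k}) - 1"
proof -
  have iff: "enumerate A l \<le> k \<and> k < enumerate A (Suc l) \<longleftrightarrow> l = card (A \<inter> {..k}) - 1" for l
    using card_upto_pos[of k] enumerate_le_iff[OF A(1), of "Suc l" k] enumerate_le_iff[OF A(1), of l k] by auto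
  then show eq: "cycle A k = card (A \<inter> {..k}) - 1" unfolding cycle_def by (intro the_equality) auto
  show "enumerate A l \<le> k \<and> k < enumerate A (Suc l) \<longleftrightarrow> l = cycle A k" unfolding eq by (rule iff)
qed

lemma cycle_Suc: "cycle A (Suc k) = (if Suc k \<in> A then Suc (cycle A k) else cycle A k)"
proof -
  have "A \<inter> {..Suc k} = (if Suc k \<in> A then insert (Suc k) (A \<inter> {..k}) else A \<inter> {..k})"
    by (auto simp: atMost_Suc)
  then show ?thesis using card_upto_pos[of k] by (simp add: cycle_eq_card)
qed

lemma cycle_0: "cycle A 0 = 0"
proof -
  have "A \<inter> {..0} = {0}" using A by auto
  then show ?thesis by (simp add: cycle_eq_card)
qed

lemma enumerate_cycle_eq_Max: "enumerate A (cycle A k) = Max (A \<inter> {..k})"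
proof (rule Max_eqI[symmetric])
  have b: "enumerate A (cycle A k) \<le> k" "k < enumerate A (Suc (cycle A k))" using cycle_iff by blast+
  show "enumerate A (cycle A k) \<in> A \<inter> {..k}" using b enumerate_in_set[OF A(1)] by simp
  fix a assume a: "a \<in> A \<inter> {..k}"
  then obtain n where n: "a = enumerate A n" using enumerate_Ex A(1) by (metis IntE)
  have "n \<le> cycle A k"
    using a b(2) unfolding n by (metis IntD2 atMost_iff enumerate_mono_le_iff[OF A(1)] le_less_trans less_Suc_eq_le not_le order.trans)
  then show "a \<le> enumerate A (cycle A k)" unfolding n using enumerate_mono_le_iff[OF A(1)] by blast
qed simp

lemma enumerate_cycle_Suc:
  "enumerate A (cycle A (Suc k)) = (if Suc k \<in> A then Suc k else enumerate A (cycle A k))"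
proof -
  have "A \<inter> {..Suc k} = (if Suc k \<in> A then insert (Suc k) (A \<inter> {..k}) else A \<inter> {..k})"
    by (auto simp: atMost_Suc)
  moreover have "Max (insert (Suc k) (A \<inter> {..k})) = Suc k" by (rule Max_eqI) auto
  ultimately show ?thesis by (simp add: enumerate_cycle_eq_Max)
qed

end

section \<open>One path of the algorithm\<close>

text \<open>For \<open>w = 0\<close> the right side is infinite, except that \<open>0 / 0 = 0\<close>; hence the last hypothesis.\<close>

lemma ennreal_quotient_mono:
  fixes a b v w :: real
  assumes "0 \<le> a" "0 \<le> b" "0 < v" "0 \<le> w" "a * w \<le> b * v" "b = 0 \<Longrightarrow> a = 0"
  shows "ennreal a / ennreal v \<le> ennreal b / ennreal w"
proof (cases "w = 0")
  case True
  then show ?thesis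
    using assms by (cases "b = 0") (auto simp: ennreal_divide_zero)
next
  case False
  then have "a / v \<le> b / w" using assms by (simp add: frac_le_eq divide_le_eq field_simps)
  then show ?thesis using assms False by (simp add: divide_ennreal ennreal_leI)
qed

context composite_problem
begin

text \<open>The vector \<open>z\<close> after an iteration and before a possible rescaling. Since the current \<open>x\<close> is a
  function of \<open>P\<close> and \<open>z\<close>, the pair of them is the whole state.\<close>

definition update :: "real^'n^'n \<Rightarrow> (real^'n) set \<Rightarrow> real^'n \<Rightarrow> real^'n" where
  "update P F z = (let x = prox \<gamma> g (mat_sqrt P *v z)
     in orth_proj F *v (inv_sqrt P *v (x - \<gamma> *\<^sub>R grad f x)) + (mat 1 - orth_proj F) *v z)"

end

text \<open>A deterministic path, for given average projections \<open>P l\<close>, subspaces \<open>F k\<close> and adaptation times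
  \<open>A\<close>.\<close>

locale adaptive_path = composite_problem f g L \<mu> \<gamma> xs
  for f :: "real^'n \<Rightarrow> real" and g :: "real^'n \<Rightarrow> ereal" and L \<mu> \<gamma> :: real and xs :: "real^'n" +
  fixes P :: "nat \<Rightarrow> real^'n^'n" and F :: "nat \<Rightarrow> (real^'n) set" and A :: "nat set"
    and c :: "nat \<Rightarrow> nat" and \<beta> :: real and z0 :: "real^'n"
  assumes P: "\<And>l. subunit_pd (P l)"
    and A: "infinite A" "0 \<in> A" "1 \<notin> A" and \<beta>: "\<beta> < 1"
    and adapt: "\<And>l. (spectral_norm (inv_sqrt (P (Suc l)) ** matrix_inv (inv_sqrt (P l))))\<^sup>2
          * (1 - alpha \<gamma> \<mu> L (P l)) ^ c (Suc l) \<le> 1 - \<beta>"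
    and times: "\<And>l. enumerate A (Suc l) = max 1 (enumerate A l) + c (Suc l)"
begin

abbreviation "state k \<equiv> arpsd f g \<gamma> (\<lambda>l. inv_sqrt (P l)) F A z0 k"
definition "xpt k = fst (state k)"
definition "zvec k = fst (snd (state k))"
definition "cyc k = cycle A (Suc k)"
definition "raw k = update (P (cyc k)) (F (Suc k)) (zvec k)"

lemma cyc_0: "cyc 0 = 0"
  using cycle_Suc[OF A(1,2), of 0] A(3) by (simp add: cyc_def cycle_0[OF A(1,2)])

lemma cyc_Suc: "cyc (Suc k) = (if Suc (Suc k) \<in> A then Suc (cyc k) else cyc k)"
  unfolding cyc_def by (rule cycle_Suc[OF A(1,2)])

text \<open>A rescaling does not change \<open>Q\<^sup>-\<^sup>1 z\<close>, so \<open>x\<close> remains the proximal point of it when \<open>Q\<close> is replaced.\<close>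

lemma path_invariant:
  "snd (snd (state k)) = cyc k \<and> xpt k = prox \<gamma> g (mat_sqrt (P (cyc k)) *v zvec k)"
proof (induction k)
  case 0
  show ?case by (simp add: cyc_0 xpt_def zvec_def inv_sqrt_cancel(3)[OF P])
next
  case (Suc k)
  obtain x z l where s: "state k = (x, z, l)" by (cases "state k")
  show ?case using Suc
    by (simp add: s xpt_def zvec_def cyc_Suc Let_def inv_sqrt_cancel(3)[OF P]
        matrix_vector_mul_assoc[symmetric] inv_sqrt_cancel(1)[OF P])
qed

lemma zvec_0: "zvec 0 = z0" by (simp add: zvec_def)

lemma path_step:
  "xpt (Suc k) = prox \<gamma> g (mat_sqrt (P (cyc k)) *v raw k)"
  "zvec (Suc k) = (if Suc (Suc k) \<in> A
     then (inv_sqrt (P (Suc (cyc k))) ** matrix_inv (inv_sqrt (P (cyc k)))) *v raw k else raw k)"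
proof -
  obtain x z l where s: "state k = (x, z, l)" by (cases "state k")
  then have l: "l = cyc k" and x: "x = prox \<gamma> g (mat_sqrt (P (cyc k)) *v zvec k)" and z: "z = zvec k"
    using path_invariant[of k] by (auto simp: xpt_def zvec_def)
  show "xpt (Suc k) = prox \<gamma> g (mat_sqrt (P (cyc k)) *v raw k)"
    "zvec (Suc k) = (if Suc (Suc k) \<in> A
     then (inv_sqrt (P (Suc (cyc k))) ** matrix_inv (inv_sqrt (P (cyc k)))) *v raw k else raw k)"
    using x unfolding xpt_def[of "Suc k"] zvec_def[of "Suc k"] arpsd.simps s l z raw_def update_def
    by (simp_all add: Let_def inv_sqrt_cancel(3)[OF P])
qed

text \<open>The squared error of \<open>z\<close> after iteration \<open>k\<close> is \<open>err k\<close>; \<open>raw_err k\<close> is that of the next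
  iteration before rescaling. The quantity \<open>age k\<close> counts the iterations already done in the current
  cycle; cycle 0 starts with iteration 1 although its adaptation time is 0, whence the maximum. The
  weights are the guaranteed rates that belong to the two errors.\<close>

definition "err k = (norm (zvec k - inv_sqrt (P (cyc k)) *v us))\<^sup>2"
definition "raw_err k = (norm (raw k - inv_sqrt (P (cyc k)) *v us))\<^sup>2"
definition "\<rho> k = 1 - alpha \<gamma> \<mu> L (P (cyc k))"
definition "age k = Suc k - max 1 (enumerate A (cyc k))"
definition "weight k = \<rho> k ^ age k * (1 - \<beta>) ^ cyc k"
definition "raw_weight k = \<rho> k ^ Suc (age k) * (1 - \<beta>) ^ cyc k"

lemma \<rho>_bounds: "0 \<le> \<rho> k" "\<rho> k \<le> 1"
  using alpha_bounds[OF P[of "cyc k"]] by (simp_all add: \<rho>_def)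

lemma weight_0: "weight 0 = 1"
  by (simp add: weight_def cyc_0 age_def)

lemma start_le: "enumerate A (cyc k) \<le> Suc k"
  unfolding cyc_def using cycle_iff[OF A(1,2)] by blast

lemma age_Suc: "Suc (Suc k) \<notin> A \<Longrightarrow> age (Suc k) = Suc (age k)"
  using start_le[of k] cyc_Suc[of k] by (auto simp: age_def)

lemma age_adapt: "Suc (Suc k) \<in> A \<Longrightarrow> c (Suc (cyc k)) = Suc (age k) \<and> age (Suc k) = 0"
  using enumerate_cycle_Suc[OF A(1,2), of "Suc k"] cyc_Suc[of k] times[of "cyc k"] start_le[of k]
  unfolding cyc_def age_def by auto

text \<open>Without an adaptation both sides agree. With one, the squared norm of the rescaling matrix times the
  contraction of the completed cycle is at most \<open>1 - \<beta>\<close>, which is the factor that every completed cycle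
  contributes to the weight.\<close>

lemma err_quotient_le:
  "ennreal (err (Suc k)) / ennreal (weight (Suc k)) \<le> ennreal (raw_err k) / ennreal (raw_weight k)"
proof (cases "Suc (Suc k) \<in> A")
  case False
  then have "err (Suc k) = raw_err k" "weight (Suc k) = raw_weight k"
    by (simp_all add: err_def raw_err_def path_step cyc_Suc weight_def raw_weight_def age_Suc \<rho>_def)
  then show ?thesis by simp
next
  case True
  define s where "s = spectral_norm (inv_sqrt (P (Suc (cyc k))) ** matrix_inv (inv_sqrt (P (cyc k))))"
  have w: "weight (Suc k) = (1 - \<beta>) ^ Suc (cyc k)"
    using age_adapt[OF True] True by (simp add: weight_def cyc_Suc)
  have c: "s\<^sup>2 * \<rho> k ^ Suc (age k) \<le> 1 - \<beta>"
    using adapt[of "cyc k"] age_adapt[OF True] by (simp add: s_def \<rho>_def)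
  have "norm (zvec (Suc k) - inv_sqrt (P (cyc (Suc k))) *v us)
      \<le> s * norm (raw k - inv_sqrt (P (cyc k)) *v us)"
    using rescaling_error[OF P P] True by (simp add: path_step cyc_Suc s_def)
  then have e: "err (Suc k) \<le> s\<^sup>2 * raw_err k"
    unfolding err_def raw_err_def power_mult_distrib[symmetric] by (rule power_mono) simp
  show ?thesis
  proof (rule ennreal_quotient_mono)
    have "err (Suc k) * raw_weight k \<le> (s\<^sup>2 * raw_err k) * raw_weight k"
      using e \<rho>_bounds \<beta> by (intro mult_right_mono) (auto simp: raw_weight_def)
    also have "\<dots> = raw_err k * ((s\<^sup>2 * \<rho> k ^ Suc (age k)) * (1 - \<beta>) ^ cyc k)"
      by (simp add: raw_weight_def mult_ac)
    also have "\<dots> \<le> raw_err k * ((1 - \<beta>) * (1 - \<beta>) ^ cyc k)"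
      using c \<beta> by (intro mult_left_mono mult_right_mono) (auto simp: raw_err_def)
    finally show "err (Suc k) * raw_weight k \<le> raw_err k * weight (Suc k)" by (simp add: w)
    show "err (Suc k) = 0" if "raw_err k = 0"
    proof -
      have "err (Suc k) \<le> 0" using e that by simp
      moreover have "0 \<le> err (Suc k)" by (simp add: err_def)
      ultimately show ?thesis by linarith
    qed
  qed (use \<beta> \<rho>_bounds in \<open>auto simp: w err_def raw_err_def raw_weight_def\<close>)
qed

text \<open>The weight counts every iteration of the current cycle, while the exponent of the rate factor is the
  distance to the adaptation time, which in all cycles but the first is smaller by one. So the rate
  factor is at least the weight.\<close>

lemma prox_error_quotient_le:
  assumes "\<And>l. avg_proj (law l) = P l"
  shows "ennreal ((norm (xpt (Suc k) - xs))\<^sup>2)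
     / ennreal (rate_factor \<gamma> \<mu> L \<beta> law A (Suc k) (cycle A (Suc k)))
   \<le> ennreal (raw_err k) / ennreal (raw_weight k)"
proof -
  have num: "(norm (xpt (Suc k) - xs))\<^sup>2 \<le> raw_err k"
    unfolding raw_err_def path_step by (intro power_mono prox_error(2) P) simp
  have den: "raw_weight k \<le> rate_factor \<gamma> \<mu> L \<beta> law A (Suc k) (cycle A (Suc k))"
  proof -
    have "Suc k - enumerate A (cyc k) \<le> Suc (age k)" using start_le[of k] by (auto simp: age_def)
    then have "\<rho> k ^ Suc (age k) \<le> \<rho> k ^ (Suc k - enumerate A (cyc k))"
      using \<rho>_bounds by (intro power_decreasing) auto
    then show ?thesis
      using \<beta> unfolding raw_weight_def rate_factor_def assms cyc_def[symmetric] \<rho>_def[symmetric]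
      by (intro mult_right_mono) auto
  qed
  have nonneg: "0 \<le> raw_weight k" "0 \<le> raw_err k"
    using \<rho>_bounds \<beta> by (simp_all add: raw_weight_def raw_err_def)
  show ?thesis
  proof (cases "rate_factor \<gamma> \<mu> L \<beta> law A (Suc k) (cycle A (Suc k)) = 0")
    case True
    then have "raw_weight k = 0" using nonneg den by linarith
    with True show ?thesis
      using num by (simp only:) (intro divide_right_mono_ennreal ennreal_leI)
  next
    case False
    show ?thesis
    proof (rule ennreal_quotient_mono)
      show "0 < rate_factor \<gamma> \<mu> L \<beta> law A (Suc k) (cycle A (Suc k))"
        using False nonneg den by linarith
      show "(norm (xpt (Suc k) - xs))\<^sup>2 * raw_weight k
          \<le> raw_err k * rate_factor \<gamma> \<mu> L \<beta> law A (Suc k) (cycle A (Suc k))"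
        using num den nonneg by (intro mult_mono)
      show "(norm (xpt (Suc k) - xs))\<^sup>2 = 0" if "raw_err k = 0"
        using num that zero_le_power2[of "norm (xpt (Suc k) - xs)"] by linarith
    qed (use nonneg in auto)
  qed
qed

lemma prox_error_0: "norm (xpt 0 - xs) \<le> norm (z0 - inv_sqrt (P 0) *v us)"
  using path_invariant[of 0] prox_error(2)[OF P, of 0 z0] by (simp add: cyc_0 zvec_0)

lemma rate_factor_0: "rate_factor \<gamma> \<mu> L \<beta> law A 0 (cycle A 0) = 1"
  by (simp add: rate_factor_def cycle_0[OF A(1,2)])

end

section \<open>Disintegration along a conditional law\<close>

text \<open>The law of \<open>(\<omega>, X \<omega>)\<close> and the mixture of the laws \<open>K \<omega>\<close> over the past agree on rectangles, by
  the defining property of conditional expectation, and rectangles generate the product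
  \<open>\<sigma>\<close>-algebra.\<close>

lemma conditional_law_disintegration:
  assumes "prob_space M" and sub: "subalgebra M F" and X: "X \<in> M \<rightarrow>\<^sub>M N"
    and K: "K \<in> F \<rightarrow>\<^sub>M prob_algebra N"
    and law: "\<And>B. B \<in> sets N \<Longrightarrow> AE \<omega> in M.
      real_cond_exp M F (indicator {\<omega>\<in>space M. X \<omega> \<in> B}) \<omega> = measure (K \<omega>) B"
    and h: "h \<in> borel_measurable (F \<Otimes>\<^sub>M N)"
  shows "(\<integral>\<^sup>+\<omega>. h (\<omega>, X \<omega>) \<partial>M) = (\<integral>\<^sup>+\<omega>. (\<integral>\<^sup>+x. h (\<omega>, x) \<partial>K \<omega>) \<partial>M)"
proof -
  interpret prob_space M by fact
  interpret finite_measure_subalgebra M F using sub by unfold_locales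
  have spF: "space F = space M" and setsF: "sets F \<subseteq> sets M" using sub by (auto simp: subalgebra_def)
  define M' where "M' = restr_to_subalg M F"
  have sM': "sets M' = sets F" "space M' = space M"
    unfolding M'_def using sub by (simp_all add: sets_restr_to_subalg space_restr_to_subalg)
  have nn: "(\<integral>\<^sup>+\<omega>. u \<omega> \<partial>M') = (\<integral>\<^sup>+\<omega>. u \<omega> \<partial>M)" if "u \<in> borel_measurable F" for u
    unfolding M'_def by (rule nn_integral_subalgebra2[OF sub that])
  have K': "K \<in> F \<rightarrow>\<^sub>M subprob_algebra N" using K by (rule measurable_prob_algebraD)
  have Kp: "prob_space (K \<omega>)" "sets (K \<omega>) = sets N" "space (K \<omega>) = space N" if "\<omega> \<in> space M" for \<omega>
    using measurable_space[OF K, of \<omega>] that sets_eq_imp_space_eq[of "K \<omega>" N]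
    by (auto simp: spF space_prob_algebra)
  define R where "R \<omega> = distr (K \<omega>) (F \<Otimes>\<^sub>M N) (Pair \<omega>)" for \<omega>
  have RF: "R \<in> F \<rightarrow>\<^sub>M subprob_algebra (F \<Otimes>\<^sub>M N)"
    unfolding R_def by (rule measurable_distr2[OF _ K']) simp
  then have R: "R \<in> M' \<rightarrow>\<^sub>M subprob_algebra (F \<Otimes>\<^sub>M N)"
    using measurable_cong_sets[OF sM'(1) refl] by blast
  have pairm: "(\<lambda>\<omega>. (\<omega>, X \<omega>)) \<in> M \<rightarrow>\<^sub>M F \<Otimes>\<^sub>M N"
  proof -
    have "(\<lambda>\<omega>. \<omega>) \<in> F \<rightarrow>\<^sub>M F" by simp
    then show ?thesis by (rule measurable_Pair[OF measurable_from_subalg[OF sub] X])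
  qed
  have Pm: "Pair \<omega> \<in> K \<omega> \<rightarrow>\<^sub>M F \<Otimes>\<^sub>M N" if "\<omega> \<in> space M" for \<omega>
    using measurable_Pair1'[of \<omega> F N] that spF measurable_cong_sets[OF Kp(2)[OF that] refl] by blast
  have ne: "space M' \<noteq> {}" using not_empty sM' by simp
  have "distr M (F \<Otimes>\<^sub>M N) (\<lambda>\<omega>. (\<omega>, X \<omega>)) = M' \<bind> R"
  proof (rule measure_eqI_generator_eq[where A="\<lambda>_. space F \<times> space N"])
    let ?E = "{a \<times> b |a b. a \<in> sets F \<and> b \<in> sets N}"
    show "Int_stable ?E" by (rule Int_stable_pair_measure_generator)
    show "?E \<subseteq> Pow (space F \<times> space N)" by (rule pair_measure_closed)
    show "sets (distr M (F \<Otimes>\<^sub>M N) (\<lambda>\<omega>. (\<omega>, X \<omega>))) = sigma_sets (space F \<times> space N) ?E"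
      by (simp add: sets_pair_measure)
    show "sets (M' \<bind> R) = sigma_sets (space F \<times> space N) ?E"
      using sets_bind[of M' R "F \<Otimes>\<^sub>M N"] ne by (simp add: sets_pair_measure R_def)
    show "range (\<lambda>_::nat. space F \<times> space N) \<subseteq> ?E" by auto
    show "(\<Union>i::nat. space F \<times> space N) = space F \<times> space N" by simp
    show "emeasure (distr M (F \<Otimes>\<^sub>M N) (\<lambda>\<omega>. (\<omega>, X \<omega>))) (space F \<times> space N) \<noteq> \<infinity>" for i :: nat
      using pairm by (subst emeasure_distr) auto
    fix Y assume "Y \<in> ?E"
    then obtain a b where Y: "Y = a \<times> b" and a: "a \<in> sets F" and b: "b \<in> sets N" by blast
    have aM: "a \<in> sets M" using a setsF by blast
    have XB: "{\<omega>\<in>space M. X \<omega> \<in> b} \<in> sets M" using measurable_sets[OF X b] by (simp add: vimage_def Int_def conj_commute)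
    have YF: "Y \<in> sets (F \<Otimes>\<^sub>M N)" unfolding Y using a b by simp
    have meas: "(\<lambda>\<omega>. measure (K \<omega>) b) \<in> borel_measurable F"
      using K' b by (rule measurable_compose[OF _ measurable_measure_subprob_algebra])
    have "emeasure (distr M (F \<Otimes>\<^sub>M N) (\<lambda>\<omega>. (\<omega>, X \<omega>))) Y = emeasure M (a \<inter> {\<omega>\<in>space M. X \<omega> \<in> b})"
      using YF sets.sets_into_space[OF aM]
      by (subst emeasure_distr[OF pairm]) (auto simp: Y intro!: arg_cong[where f="emeasure M"])
    also have "\<dots> = ennreal (\<integral>\<omega>. indicator (a \<inter> {\<omega>\<in>space M. X \<omega> \<in> b}) \<omega> \<partial>M)"
      using aM XB by (simp add: emeasure_eq_measure)
    also have "(\<integral>\<omega>. indicator (a \<inter> {\<omega>\<in>space M. X \<omega> \<in> b}) \<omega> \<partial>M) = (\<integral>\<omega>\<in>a. indicator {\<omega>\<in>space M. X \<omega> \<in> b} \<omega> \<partial>M)"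
      unfolding set_lebesgue_integral_def
      by (intro Bochner_Integration.integral_cong) (auto simp: indicator_def)
    also have "\<dots> = (\<integral>\<omega>\<in>a. real_cond_exp M F (indicator {\<omega>\<in>space M. X \<omega> \<in> b}) \<omega> \<partial>M)"
      using XB by (intro real_cond_exp_intA[OF _ a]) (simp add: integrable_real_indicator less_top[symmetric])
    also have "\<dots> = (\<integral>\<omega>\<in>a. measure (K \<omega>) b \<partial>M)"
      using law[OF b] aM measurable_from_subalg[OF sub meas] measurable_from_subalg[OF sub borel_measurable_cond_exp]
      unfolding set_lebesgue_integral_def by (intro integral_cong_AE) auto
    also have "ennreal \<dots> = (\<integral>\<^sup>+\<omega>. ennreal (indicator a \<omega> * measure (K \<omega>) b) \<partial>M)"
    proof -
      have "integrable M (\<lambda>\<omega>. indicator a \<omega> * measure (K \<omega>) b)"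
      proof (rule integrable_const_bound[where B=1])
        show "AE \<omega> in M. norm (indicator a \<omega> * measure (K \<omega>) b :: real) \<le> 1"
          using Kp(1) by (auto intro!: AE_I2 prob_space.prob_le_1 simp: indicator_def)
        show "(\<lambda>\<omega>. indicator a \<omega> * measure (K \<omega>) b) \<in> borel_measurable M"
          using aM measurable_from_subalg[OF sub meas] by simp
      qed
      then show ?thesis unfolding set_lebesgue_integral_def
        by (subst nn_integral_eq_integral) auto
    qed
    also have "\<dots> = (\<integral>\<^sup>+\<omega>. ennreal (indicator a \<omega> * measure (K \<omega>) b) \<partial>M')"
      using a meas by (intro nn[symmetric]) auto
    also have "\<dots> = (\<integral>\<^sup>+\<omega>. emeasure (R \<omega>) Y \<partial>M')"
    proof (rule nn_integral_cong)
      fix \<omega> assume "\<omega> \<in> space M'"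
      then have \<omega>: "\<omega> \<in> space M" by (simp add: sM')
      interpret K: prob_space "K \<omega>" by (rule Kp(1)[OF \<omega>])
      have "emeasure (R \<omega>) Y = emeasure (K \<omega>) (Pair \<omega> -` Y \<inter> space (K \<omega>))"
        unfolding R_def by (rule emeasure_distr[OF Pm[OF \<omega>] YF])
      also have "Pair \<omega> -` Y \<inter> space (K \<omega>) = (if \<omega> \<in> a then b else {})"
        using sets.sets_into_space[OF b] Kp(3)[OF \<omega>] by (auto simp: Y)
      finally show "ennreal (indicator a \<omega> * measure (K \<omega>) b) = emeasure (R \<omega>) Y"
        by (auto simp: K.emeasure_eq_measure)
    qed
    also have "\<dots> = emeasure (M' \<bind> R) Y" by (rule emeasure_bind[OF ne R YF, symmetric])
    finally show "emeasure (distr M (F \<Otimes>\<^sub>M N) (\<lambda>\<omega>. (\<omega>, X \<omega>))) Y = emeasure (M' \<bind> R) Y" .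
  qed
  note eq = this
  have "(\<integral>\<^sup>+\<omega>. h (\<omega>, X \<omega>) \<partial>M) = (\<integral>\<^sup>+p. h p \<partial>(M' \<bind> R))"
    unfolding eq[symmetric] by (rule nn_integral_distr[OF pairm, symmetric]) (use h in simp)
  also have "\<dots> = (\<integral>\<^sup>+\<omega>. (\<integral>\<^sup>+p. h p \<partial>R \<omega>) \<partial>M')" by (rule nn_integral_bind[OF h R])
  also have "\<dots> = (\<integral>\<^sup>+\<omega>. (\<integral>\<^sup>+p. h p \<partial>R \<omega>) \<partial>M)"
    by (intro nn measurable_compose[OF RF nn_integral_measurable_subprob_algebra[OF h]])
  also have "\<dots> = (\<integral>\<^sup>+\<omega>. (\<integral>\<^sup>+x. h (\<omega>, x) \<partial>K \<omega>) \<partial>M)"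
    using h by (intro nn_integral_cong) (simp add: R_def nn_integral_distr[OF Pm])
  finally show ?thesis .
qed

section \<open>Measurability of the iterates\<close>

lemma borel_measurable_inv_sqrt_mult:
  fixes P :: "'a \<Rightarrow> real^'n^'n"
  assumes "P \<in> borel_measurable N" "z \<in> borel_measurable N" "\<And>x. x \<in> space N \<Longrightarrow> subunit_pd (P x)"
  shows "(\<lambda>x. inv_sqrt (P x) *v z x) \<in> borel_measurable N"
  unfolding inv_sqrt_def
  by (intro borel_measurable_matrix_inv_mult borel_measurable_mat_sqrt assms invertible_subunit_pd_sqrt)

lemma (in composite_problem) borel_measurable_update:
  assumes P: "P \<in> borel_measurable N" and G: "G \<in> N \<rightarrow>\<^sub>M subspace_algebra" and z: "z \<in> borel_measurable N"
    and pd: "\<And>x. x \<in> space N \<Longrightarrow> subunit_pd (P x)"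
  shows "(\<lambda>x. update (P x) (G x) (z x)) \<in> borel_measurable N"
proof -
  have "1-lipschitz_on UNIV (prox \<gamma> g)"
    using prox_nonexpansive by (simp add: lipschitz_on_def dist_norm)
  then have prox: "continuous_on UNIV (prox \<gamma> g)" by (rule lipschitz_on_continuous_on)
  have grad: "continuous_on UNIV (grad f)"
    using smooth lipschitz_on_continuous_on unfolding L_smooth_def by blast
  have O: "(\<lambda>x. orth_proj (G x)) \<in> borel_measurable N"
    by (rule measurable_compose[OF G measurable_orth_proj])
  define p where "p x = prox \<gamma> g (mat_sqrt (P x) *v z x)" for x
  have p: "p \<in> borel_measurable N"
    unfolding p_def
    by (intro borel_measurable_continuous_on[OF prox] borel_measurable_matrix_vector_mult
        borel_measurable_mat_sqrt P z pd)
  have "(\<lambda>x. orth_proj (G x) *v (inv_sqrt (P x) *v (p x - \<gamma> *\<^sub>R grad f (p x)))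
      + (z x - orth_proj (G x) *v z x)) \<in> borel_measurable N"
    by (intro borel_measurable_add borel_measurable_diff borel_measurable_matrix_vector_mult
        borel_measurable_inv_sqrt_mult borel_measurable_scaleR borel_measurable_const
        borel_measurable_continuous_on[OF grad] O P p z pd)
  then show ?thesis
    by (simp add: update_def p_def Let_def matrix_vector_mult_diff_rdistrib)
qed

text \<open>For every \<open>\<omega>\<close> the run is an \<open>adaptive_path\<close>. The abbreviations below turn its quantities into
  random variables.\<close>

locale adaptive_run = composite_problem f g L \<mu> \<gamma> xs + prob_space M
  for f :: "real^'n \<Rightarrow> real" and g :: "real^'n \<Rightarrow> ereal" and L \<mu> \<gamma> :: real and xs :: "real^'n"
    and M :: "'w measure" +
  fixes C :: "(real^'n) set set" and S :: "nat \<Rightarrow> 'w \<Rightarrow> (real^'n) set"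
    and \<nu>0 :: "(real^'n) set measure" and law :: "nat \<Rightarrow> 'w \<Rightarrow> (real^'n) set measure"
    and A :: "'w \<Rightarrow> nat set" and c :: "nat \<Rightarrow> 'w \<Rightarrow> nat" and lam \<beta> :: real and z0 :: "real^'n"
  assumes lam_pos: "0 < lam" and \<beta>_eq: "\<beta> = \<gamma> * \<mu> * L * lam / (\<mu> + L)"
    and randomness: "arpsd_randomness M C S \<nu>0 law A"
    and strategy: "adaptation_strategy \<gamma> \<mu> L lam \<beta> M S law A c"
begin

abbreviation "\<F> k \<equiv> sel_filtration M S k"
abbreviation "Ps \<omega> \<equiv> (\<lambda>l. avg_proj (law l \<omega>))"
abbreviation "Ss \<omega> \<equiv> (\<lambda>j. S j \<omega>)"
abbreviation "z k \<omega> \<equiv> adaptive_path.zvec f g \<gamma> (Ps \<omega>) (Ss \<omega>) (A \<omega>) z0 k"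
abbreviation "raw k \<omega> \<equiv> adaptive_path.raw f g \<gamma> (Ps \<omega>) (Ss \<omega>) (A \<omega>) z0 k"
abbreviation "cyc k \<omega> \<equiv> adaptive_path.cyc (A \<omega>) k"
abbreviation "age k \<omega> \<equiv> adaptive_path.age (A \<omega>) k"
abbreviation "err k \<omega> \<equiv> adaptive_path.err f g \<gamma> xs (Ps \<omega>) (Ss \<omega>) (A \<omega>) z0 k"
abbreviation "raw_err k \<omega> \<equiv> adaptive_path.raw_err f g \<gamma> xs (Ps \<omega>) (Ss \<omega>) (A \<omega>) z0 k"
abbreviation "weight k \<omega> \<equiv> adaptive_path.weight L \<mu> \<gamma> (Ps \<omega>) (A \<omega>) \<beta> k"
abbreviation "raw_weight k \<omega> \<equiv> adaptive_path.raw_weight L \<mu> \<gamma> (Ps \<omega>) (A \<omega>) \<beta> k"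
abbreviation "xp k \<omega> \<equiv> adaptive_path.xpt f g \<gamma> (Ps \<omega>) (Ss \<omega>) (A \<omega>) z0 k"

definition "current_law k \<omega> = law (cyc k \<omega>) \<omega>"
definition "current_proj k \<omega> = avg_proj (current_law k \<omega>)"

lemma S_measurable: "1 \<le> k \<Longrightarrow> S k \<in> M \<rightarrow>\<^sub>M subspace_algebra"
  using randomness unfolding arpsd_randomness_def by blast

lemma law_valid:
  assumes "\<omega> \<in> space M"
  shows "law l \<omega> \<in> space (prob_algebra subspace_algebra)" "admissible (law l \<omega>)"
  using randomness assms unfolding arpsd_randomness_def by blast+

lemma law_0: "\<omega> \<in> space M \<Longrightarrow> law 0 \<omega> = \<nu>0"
  using randomness unfolding arpsd_randomness_def by blast

lemma Ps_subunit_pd: "\<omega> \<in> space M \<Longrightarrow> subunit_pd (Ps \<omega> l)"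
  by (intro subunit_pd_avg_proj law_valid)

lemma current_proj_subunit_pd: "\<omega> \<in> space M \<Longrightarrow> subunit_pd (current_proj k \<omega>)"
  unfolding current_proj_def current_law_def by (rule Ps_subunit_pd)

text \<open>The strategy can only be followed if \<open>lam\<close> is at most 1, as no average projection has a larger
  eigenvalue; and \<open>\<beta> = \<kappa> lam / 2\<close>.\<close>

lemma \<beta>_lt_1: "\<beta> < 1"
proof -
  obtain \<omega> where \<omega>: "\<omega> \<in> space M" using not_empty by blast
  have "lam \<le> lambda_min (avg_proj (law (Suc 0) \<omega>))"
    using strategy \<omega> unfolding adaptation_strategy_def by blast
  also have "\<dots> \<le> 1" by (rule lambda_min_subunit_pd(2)[OF Ps_subunit_pd[OF \<omega>]])
  finally have "\<kappa> * lam \<le> 1" using \<kappa>_bounds lam_pos mult_mono[of \<kappa> 1 lam 1] by simp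
  moreover have "\<beta> = \<kappa> * lam / 2" using \<mu>_pos \<mu>_le_L by (simp add: \<beta>_eq \<kappa>_def divide_simps)
  ultimately show ?thesis by simp
qed

lemma path:
  assumes \<omega>: "\<omega> \<in> space M"
  shows "adaptive_path f g L \<mu> \<gamma> xs (Ps \<omega>) (A \<omega>) (\<lambda>l. c l \<omega>) \<beta>"
proof unfold_locales
  show "subunit_pd (Ps \<omega> l)" for l by (rule Ps_subunit_pd[OF \<omega>])
  show "0 \<in> A \<omega>" "1 \<notin> A \<omega>" using randomness \<omega> unfolding arpsd_randomness_def by blast+
  show "\<beta> < 1" by (rule \<beta>_lt_1)
qed (use strategy \<omega> in \<open>unfold adaptation_strategy_def, blast+\<close>)

lemma adaptation_times: "\<omega> \<in> space M \<Longrightarrow> infinite (A \<omega>)" "\<omega> \<in> space M \<Longrightarrow> 0 \<in> A \<omega>" "\<omega> \<in> space M \<Longrightarrow> 1 \<notin> A \<omega>"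
  using adaptive_path.A[OF path] by blast+

lemma sets_filtration:
  "sets (\<F> k) = sigma_sets (space M)
     {S j -` B \<inter> space M |j B. 1 \<le> j \<and> j \<le> k \<and> B \<in> sets subspace_algebra}"
  unfolding sel_filtration_def by (rule sets_measure_of) auto

lemma space_filtration: "space (\<F> k) = space M"
  unfolding sel_filtration_def by (rule space_measure_of) auto

lemma subalgebra_filtration: "subalgebra M (\<F> k)"
  unfolding subalgebra_def space_filtration sets_filtration
  using S_measurable by (auto intro!: sets.sigma_sets_subset dest: measurable_sets)

lemma filtration_mono: "i \<le> j \<Longrightarrow> sets (\<F> i) \<subseteq> sets (\<F> j)"
  unfolding sets_filtration by (rule sigma_sets_mono') force

lemma filtration: "filtration (space M) (sel_filtration M S)"
  by unfold_locales (auto simp: space_filtration dest: filtration_mono)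

lemma measurable_filtration_mono: "i \<le> j \<Longrightarrow> h \<in> \<F> i \<rightarrow>\<^sub>M N \<Longrightarrow> h \<in> \<F> j \<rightarrow>\<^sub>M N"
  using measurable_mono[of N N "\<F> i" "\<F> j"] filtration_mono by (auto simp: space_filtration)

lemma adapted_cong:
  assumes "\<And>\<omega>. \<omega> \<in> space M \<Longrightarrow> u \<omega> = v \<omega>" and "v \<in> \<F> k \<rightarrow>\<^sub>M N"
  shows "u \<in> \<F> k \<rightarrow>\<^sub>M N"
  using measurable_cong[of "\<F> k" u v N] assms by (simp add: space_filtration)

lemma S_adapted: "1 \<le> j \<Longrightarrow> j \<le> k \<Longrightarrow> S j \<in> \<F> k \<rightarrow>\<^sub>M subspace_algebra"
proof (rule measurableI)
  assume j: "1 \<le> j" "j \<le> k"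
  show "S j \<omega> \<in> space subspace_algebra" if "\<omega> \<in> space (\<F> k)" for \<omega>
    using measurable_space[OF S_measurable[OF j(1)]] that by (simp add: space_filtration)
  show "S j -` B \<inter> space (\<F> k) \<in> sets (\<F> k)" if "B \<in> sets subspace_algebra" for B
    unfolding sets_filtration space_filtration using j that by (intro sigma_sets.Basic) blast
qed

text \<open>The decision to start a new cycle with iteration \<open>k + 1\<close> is taken at the end of iteration \<open>k\<close>, so
  adaptations are known one step ahead.\<close>

lemma adaptation_event:
  assumes "i \<le> Suc k"
  shows "{\<omega> \<in> space M. i \<in> A \<omega>} \<in> sets (\<F> k)"
proof -
  consider "i = 0" | "i = 1" | j where "i = Suc j" "1 \<le> j" "j \<le> k"
    using assms by (cases i) (auto simp: Suc_le_eq)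
  then show ?thesis
  proof cases
    case 1
    then have "{\<omega> \<in> space M. i \<in> A \<omega>} = space (\<F> k)" using adaptation_times by (auto simp: space_filtration)
    then show ?thesis by simp
  next
    case 2
    then have "{\<omega> \<in> space M. i \<in> A \<omega>} = {}" using adaptation_times by auto
    then show ?thesis by (simp only: sets.empty_sets)
  next
    case 3
    have "Measurable.pred (\<F> j) (\<lambda>\<omega>. Suc j \<in> A \<omega>)"
      using randomness 3 unfolding arpsd_randomness_def by blast
    then have "{\<omega> \<in> space M. i \<in> A \<omega>} \<in> sets (\<F> j)"
      unfolding 3(1) by (simp add: pred_def space_filtration)
    then show ?thesis using filtration_mono 3 by blast
  qed
qed

lemma past_adaptations_measurable:
  "(\<lambda>\<omega>. A \<omega> \<inter> {..Suc k}) \<in> \<F> k \<rightarrow>\<^sub>M count_space (Pow {..Suc k})"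
proof (subst measurable_count_space_eq2)
  show "finite (Pow {..Suc k})" by simp
  have "(\<lambda>\<omega>. A \<omega> \<inter> {..Suc k}) -` {D} \<inter> space (\<F> k) \<in> sets (\<F> k)" if D: "D \<subseteq> {..Suc k}" for D
  proof -
    have ev: "{\<omega> \<in> space (\<F> k). i \<in> A \<omega>} \<in> sets (\<F> k)" if "i \<in> {..Suc k}" for i
      using adaptation_event[of i k] that by (simp add: space_filtration)
    have ev': "{\<omega> \<in> space (\<F> k). i \<in> A \<omega> \<longleftrightarrow> i \<in> D} \<in> sets (\<F> k)" if "i \<in> {..Suc k}" for i
      using ev[OF that] sets.sets_Collect_neg[OF ev[OF that]] by (cases "i \<in> D") simp_all
    have "{\<omega> \<in> space (\<F> k). \<forall>i\<in>{..Suc k}. i \<in> A \<omega> \<longleftrightarrow> i \<in> D} \<in> sets (\<F> k)"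
      by (rule sets.sets_Collect_finite_All[OF ev']) simp_all
    moreover have "A \<omega> \<inter> {..Suc k} = D \<longleftrightarrow> (\<forall>i\<in>{..Suc k}. i \<in> A \<omega> \<longleftrightarrow> i \<in> D)" for \<omega>
      using D by blast
    then have "(\<lambda>\<omega>. A \<omega> \<inter> {..Suc k}) -` {D} \<inter> space (\<F> k)
        = {\<omega> \<in> space (\<F> k). \<forall>i\<in>{..Suc k}. i \<in> A \<omega> \<longleftrightarrow> i \<in> D}"
      by (simp only: vimage_def Int_def singleton_iff mem_Collect_eq conj_commute)
    ultimately show ?thesis by simp
  qed
  then show "(\<lambda>\<omega>. A \<omega> \<inter> {..Suc k}) \<in> space (\<F> k) \<rightarrow> Pow {..Suc k} \<and>
      (\<forall>D\<in>Pow {..Suc k}. (\<lambda>\<omega>. A \<omega> \<inter> {..Suc k}) -` {D} \<inter> space (\<F> k) \<in> sets (\<F> k))" by auto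
qed

lemma function_of_past_adaptations_measurable:
  fixes h :: "nat set \<Rightarrow> 'b"
  assumes "\<And>\<omega>. \<omega> \<in> space M \<Longrightarrow> u \<omega> = h (A \<omega> \<inter> {..Suc k})"
  shows "u \<in> \<F> k \<rightarrow>\<^sub>M count_space UNIV"
proof -
  have "(\<lambda>\<omega>. h (A \<omega> \<inter> {..Suc k})) \<in> \<F> k \<rightarrow>\<^sub>M count_space UNIV"
    by (rule measurable_compose[OF past_adaptations_measurable]) simp
  with assms show ?thesis by (rule adapted_cong)
qed

lemma cyc_measurable: "cyc k \<in> \<F> k \<rightarrow>\<^sub>M count_space UNIV"
proof (rule function_of_past_adaptations_measurable)
  fix \<omega> assume \<omega>: "\<omega> \<in> space M"
  show "cyc k \<omega> = (\<lambda>D. card D - 1) (A \<omega> \<inter> {..Suc k})"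
    unfolding adaptive_path.cyc_def[OF path[OF \<omega>]] by (rule cycle_eq_card[OF adaptation_times(1,2)[OF \<omega>]])
qed

lemma age_measurable: "age k \<in> \<F> k \<rightarrow>\<^sub>M count_space UNIV"
proof (rule function_of_past_adaptations_measurable)
  fix \<omega> assume \<omega>: "\<omega> \<in> space M"
  show "age k \<omega> = (\<lambda>D. Suc k - max 1 (Max D)) (A \<omega> \<inter> {..Suc k})"
    unfolding adaptive_path.age_def[OF path[OF \<omega>]] adaptive_path.cyc_def[OF path[OF \<omega>]]
      enumerate_cycle_eq_Max[OF adaptation_times(1,2)[OF \<omega>]] ..
qed

text \<open>The law of cycle \<open>j + 1\<close> is known at the previous adaptation time, and this time is at most \<open>k\<close> if
  iteration \<open>k + 1\<close> belongs to that cycle.\<close>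

lemma current_law_measurable: "current_law k \<in> \<F> k \<rightarrow>\<^sub>M prob_algebra subspace_algebra"
proof -
  obtain \<omega>0 where "\<omega>0 \<in> space M" using not_empty by blast
  then have \<nu>0: "\<nu>0 \<in> space (prob_algebra subspace_algebra)" using law_valid(1)[of \<omega>0 0] law_0 by simp
  \<comment> \<open>On each cycle number the law is measurable only on the event that this cycle is running, so it is
  completed by the constant law \<open>\<nu>0\<close> elsewhere.\<close>
  have piece: "(\<lambda>\<omega>. if cyc k \<omega> = l then law l \<omega> else \<nu>0) \<in> \<F> k \<rightarrow>\<^sub>M prob_algebra subspace_algebra" for l
  proof (cases l)
    case 0
    have "(\<lambda>\<omega>. \<nu>0) \<in> \<F> k \<rightarrow>\<^sub>M prob_algebra subspace_algebra" using \<nu>0 by simp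
    then show ?thesis unfolding 0 by (rule adapted_cong[rotated]) (simp add: law_0)
  next
    case (Suc j)
    let ?\<tau> = "\<lambda>\<omega>. enumerate (A \<omega>) j"
    let ?T = "filtration.pre_sigma (space M) (sel_filtration M S) ?\<tau>"
    have st: "stopping_time (sel_filtration M S) ?\<tau>"
      using randomness unfolding arpsd_randomness_def by blast
    have lawm: "law (Suc j) \<in> ?T \<rightarrow>\<^sub>M prob_algebra subspace_algebra"
      using strategy unfolding adaptation_strategy_def by blast
    have ev: "{\<omega> \<in> space M. cyc k \<omega> = Suc j} \<in> sets (\<F> k)"
      using measurable_sets[OF cyc_measurable, of "{Suc j}" k] by (simp add: space_filtration vimage_def Int_def conj_commute)
    have le: "?\<tau> \<omega> \<le> k" if "\<omega> \<in> space M" "cyc k \<omega> = Suc j" for \<omega>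
      using adaptive_path.start_le[OF path[OF that(1)], of k] that(2) enumerate_step[OF adaptation_times(1)[OF that(1)], of j]
      by simp
    show ?thesis
    proof (rule measurableI)
      fix \<omega> assume "\<omega> \<in> space (\<F> k)"
      then show "(if cyc k \<omega> = l then law l \<omega> else \<nu>0) \<in> space (prob_algebra subspace_algebra)"
        using \<nu>0 law_valid(1) by (simp add: space_filtration)
    next
      fix B :: "(real^'n) set measure set" assume B: "B \<in> sets (prob_algebra subspace_algebra)"
      have "law (Suc j) -` B \<inter> space M \<in> sets ?T"
        using measurable_sets[OF lawm B] by (simp add: filtration.space_pre_sigma[OF filtration])
      then have "{\<omega> \<in> law (Suc j) -` B \<inter> space M. ?\<tau> \<omega> \<le> k} \<in> sets (\<F> k)"
        by (rule filtration.sets_pre_sigmaD[OF filtration st])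
      then have "({\<omega> \<in> law (Suc j) -` B \<inter> space M. ?\<tau> \<omega> \<le> k} \<inter> {\<omega> \<in> space M. cyc k \<omega> = Suc j})
          \<union> (if \<nu>0 \<in> B then space (\<F> k) - {\<omega> \<in> space M. cyc k \<omega> = Suc j} else {}) \<in> sets (\<F> k)"
        using ev by auto
      also have "({\<omega> \<in> law (Suc j) -` B \<inter> space M. ?\<tau> \<omega> \<le> k} \<inter> {\<omega> \<in> space M. cyc k \<omega> = Suc j})
          \<union> (if \<nu>0 \<in> B then space (\<F> k) - {\<omega> \<in> space M. cyc k \<omega> = Suc j} else {})
          = (\<lambda>\<omega>. if cyc k \<omega> = l then law l \<omega> else \<nu>0) -` B \<inter> space (\<F> k)"
        unfolding Suc using le by (auto simp: space_filtration split: if_splits)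
      finally show "(\<lambda>\<omega>. if cyc k \<omega> = l then law l \<omega> else \<nu>0) -` B \<inter> space (\<F> k) \<in> sets (\<F> k)" .
    qed
  qed
  have "(\<lambda>\<omega>. if cyc k \<omega> = cyc k \<omega> then law (cyc k \<omega>) \<omega> else \<nu>0) \<in> \<F> k \<rightarrow>\<^sub>M prob_algebra subspace_algebra"
    by (rule measurable_compose_countable[OF piece cyc_measurable])
  then show ?thesis unfolding current_law_def by simp
qed

lemma current_proj_measurable: "current_proj k \<in> borel_measurable (\<F> k)"
  unfolding current_proj_def avg_proj_def
  by (rule measurable_compose[OF measurable_prob_algebraD[OF current_law_measurable]
        integral_measurable_subprob_algebra[OF measurable_orth_proj]])

lemma current_proj_eq: "Ps \<omega> (cyc k \<omega>) = current_proj k \<omega>" by (simp add: current_proj_def current_law_def)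

lemma raw_eq: "\<omega> \<in> space M \<Longrightarrow> raw k \<omega> = update (current_proj k \<omega>) (S (Suc k) \<omega>) (z k \<omega>)"
  by (simp add: adaptive_path.raw_def[OF path] current_proj_eq)

text \<open>Both cases of the update of \<open>z\<close> are covered by one formula: the new \<open>Q\<close> applied to the old
  \<open>Q\<^sup>-\<^sup>1\<close> of the unscaled vector.\<close>

lemma z_measurable: "z k \<in> borel_measurable (\<F> k)"
proof (induction k)
  case 0
  show ?case
    by (rule adapted_cong[where v="\<lambda>\<omega>. z0"]) (simp_all add: adaptive_path.zvec_0[OF path])
next
  case (Suc k)
  have current_proj': "current_proj k \<in> borel_measurable (\<F> (Suc k))"
    by (rule measurable_filtration_mono[OF _ current_proj_measurable]) simp
  have pd: "subunit_pd (current_proj i \<omega>)" if "\<omega> \<in> space (\<F> (Suc k))" for i \<omega>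
    using that current_proj_subunit_pd by (simp add: space_filtration)
  have z': "z k \<in> borel_measurable (\<F> (Suc k))" by (rule measurable_filtration_mono[OF _ Suc]) simp
  have S': "S (Suc k) \<in> \<F> (Suc k) \<rightarrow>\<^sub>M subspace_algebra" by (rule S_adapted) simp_all
  have raw': "(\<lambda>\<omega>. update (current_proj k \<omega>) (S (Suc k) \<omega>) (z k \<omega>)) \<in> borel_measurable (\<F> (Suc k))"
    by (rule borel_measurable_update[OF current_proj' S' z']) (rule pd)
  have rescaled: "(\<lambda>\<omega>. mat_sqrt (current_proj k \<omega>) *v update (current_proj k \<omega>) (S (Suc k) \<omega>) (z k \<omega>)) \<in> borel_measurable (\<F> (Suc k))"
    by (rule borel_measurable_matrix_vector_mult[OF borel_measurable_mat_sqrt[OF current_proj'] raw']) (rule pd)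
  have meas: "(\<lambda>\<omega>. inv_sqrt (current_proj (Suc k) \<omega>) *v (mat_sqrt (current_proj k \<omega>) *v update (current_proj k \<omega>) (S (Suc k) \<omega>) (z k \<omega>)))
      \<in> borel_measurable (\<F> (Suc k))"
    by (rule borel_measurable_inv_sqrt_mult[OF current_proj_measurable rescaled]) (rule pd)
  have "z (Suc k) \<omega> = inv_sqrt (current_proj (Suc k) \<omega>) *v (mat_sqrt (current_proj k \<omega>) *v update (current_proj k \<omega>) (S (Suc k) \<omega>) (z k \<omega>))"
    if \<omega>: "\<omega> \<in> space M" for \<omega>
  proof (cases "Suc (Suc k) \<in> A \<omega>")
    case True
    then have "cyc (Suc k) \<omega> = Suc (cyc k \<omega>)" by (simp add: adaptive_path.cyc_Suc[OF path[OF \<omega>]])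
    then show ?thesis
      using True raw_eq[OF \<omega>] current_proj_eq[of \<omega> "Suc k"] current_proj_eq[of \<omega> k]
      by (simp add: adaptive_path.path_step(2)[OF path[OF \<omega>]] matrix_vector_mul_assoc[symmetric]
          inv_sqrt_cancel(3)[OF current_proj_subunit_pd[OF \<omega>]])
  next
    case False
    then have "cyc (Suc k) \<omega> = cyc k \<omega>" by (simp add: adaptive_path.cyc_Suc[OF path[OF \<omega>]])
    then have "current_proj (Suc k) \<omega> = current_proj k \<omega>" by (simp add: current_proj_def current_law_def)
    then show ?thesis
      using False raw_eq[OF \<omega>]
      by (simp add: adaptive_path.path_step(2)[OF path[OF \<omega>]] inv_sqrt_cancel(2)[OF current_proj_subunit_pd[OF \<omega>]])
  qed
  from this meas show ?case by (rule adapted_cong)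
qed


section \<open>The supermartingale property\<close>

lemma err_eq:
  assumes \<omega>: "\<omega> \<in> space M"
  shows "err k \<omega> = (norm (z k \<omega> - inv_sqrt (current_proj k \<omega>) *v us))\<^sup>2"
    and "raw_err k \<omega> = (norm (update (current_proj k \<omega>) (S (Suc k) \<omega>) (z k \<omega>) - inv_sqrt (current_proj k \<omega>) *v us))\<^sup>2"
    and "weight k \<omega> = (1 - alpha \<gamma> \<mu> L (current_proj k \<omega>)) ^ age k \<omega> * (1 - \<beta>) ^ cyc k \<omega>"
    and "raw_weight k \<omega> = (1 - alpha \<gamma> \<mu> L (current_proj k \<omega>)) ^ Suc (age k \<omega>) * (1 - \<beta>) ^ cyc k \<omega>"
  using current_proj_eq[of \<omega> k] raw_eq[OF \<omega>, of k]
  by (simp_all add: adaptive_path.err_def[OF path[OF \<omega>]] adaptive_path.raw_err_def[OF path[OF \<omega>]]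
      adaptive_path.weight_def[OF path[OF \<omega>]] adaptive_path.raw_weight_def[OF path[OF \<omega>]]
      adaptive_path.\<rho>_def[OF path[OF \<omega>]])

lemma power_adapted:
  assumes "u \<in> borel_measurable (\<F> k)" "n \<in> \<F> k \<rightarrow>\<^sub>M count_space UNIV"
  shows "(\<lambda>\<omega>. u \<omega> ^ n \<omega> :: real) \<in> borel_measurable (\<F> k)"
proof -
  have "(\<lambda>\<omega>. u \<omega> ^ i) \<in> borel_measurable (\<F> k)" for i :: nat using assms(1) by simp
  then show ?thesis by (rule measurable_compose_countable[OF _ assms(2)])
qed

lemma raw_weight_adapted: "raw_weight k \<in> borel_measurable (\<F> k)"
proof -
  have "(\<lambda>\<omega>. lambda_min (current_proj k \<omega>)) \<in> borel_measurable (\<F> k)"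
    by (rule borel_measurable_lambda_min[OF current_proj_measurable])
      (use current_proj_subunit_pd in \<open>simp add: space_filtration subunit_pd_def\<close>)
  then have "(\<lambda>\<omega>. 1 - alpha \<gamma> \<mu> L (current_proj k \<omega>)) \<in> borel_measurable (\<F> k)"
    unfolding alpha_eq by simp
  moreover have "(\<lambda>\<omega>. Suc (age k \<omega>)) \<in> \<F> k \<rightarrow>\<^sub>M count_space UNIV"
    by (rule measurable_compose[OF age_measurable]) simp
  ultimately have meas: "(\<lambda>\<omega>. (1 - alpha \<gamma> \<mu> L (current_proj k \<omega>)) ^ Suc (age k \<omega>) * (1 - \<beta>) ^ cyc k \<omega>) \<in> borel_measurable (\<F> k)"
    by (intro borel_measurable_times power_adapted cyc_measurable) simp_all
  have "raw_weight k \<omega> = (1 - alpha \<gamma> \<mu> L (current_proj k \<omega>)) ^ Suc (age k \<omega>) * (1 - \<beta>) ^ cyc k \<omega>"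
    if "\<omega> \<in> space M" for \<omega> by (rule err_eq(4)[OF that])
  from this meas show ?thesis by (rule adapted_cong)
qed

text \<open>Given the past, the weight, the average projection and \<open>z\<close> are constants and the subspace has the
  current law, so disintegration reduces the claim to the contraction for a single law. The new factor
  \<open>1 - \<alpha>\<close> of the weight cancels that contraction.\<close>

lemma expected_raw_quotient_le:
  "(\<integral>\<^sup>+\<omega>. ennreal (raw_err k \<omega>) / ennreal (raw_weight k \<omega>) \<partial>M)
    \<le> (\<integral>\<^sup>+\<omega>. ennreal (err k \<omega>) / ennreal (weight k \<omega>) \<partial>M)"
proof -
  define d where "d \<omega> G = ennreal ((norm (update (current_proj k \<omega>) G (z k \<omega>) - inv_sqrt (current_proj k \<omega>) *v us))\<^sup>2)" for \<omega> G
  define h where "h p = d (fst p) (snd p) / ennreal (raw_weight k (fst p))" for p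
  let ?N = "\<F> k \<Otimes>\<^sub>M (subspace_algebra :: (real^'n) set measure)"
  have pd: "subunit_pd (current_proj k \<omega>)" if "\<omega> \<in> space (\<F> k)" for \<omega>
    using that current_proj_subunit_pd by (simp add: space_filtration)
  have fst': "fst \<in> ?N \<rightarrow>\<^sub>M \<F> k" and snd': "snd \<in> ?N \<rightarrow>\<^sub>M subspace_algebra" by simp_all
  have P': "(\<lambda>p. current_proj k (fst p)) \<in> borel_measurable ?N" by (rule measurable_compose[OF fst' current_proj_measurable])
  have z': "(\<lambda>p. z k (fst p)) \<in> borel_measurable ?N" by (rule measurable_compose[OF fst' z_measurable])
  have pd': "subunit_pd (current_proj k (fst p))" if "p \<in> space ?N" for p
    using measurable_space[OF fst' that] by (rule pd)
  have upd: "(\<lambda>p. update (current_proj k (fst p)) (snd p) (z k (fst p))) \<in> borel_measurable ?N"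
    by (rule borel_measurable_update[OF P' snd' z']) (rule pd')
  have us': "(\<lambda>p. inv_sqrt (current_proj k (fst p)) *v us) \<in> borel_measurable ?N"
    by (rule borel_measurable_inv_sqrt_mult[OF P' borel_measurable_const]) (rule pd')
  have wt: "(\<lambda>p. raw_weight k (fst p)) \<in> borel_measurable ?N" by (rule measurable_compose[OF fst' raw_weight_adapted])
  have dm: "(\<lambda>p. d (fst p) (snd p)) \<in> borel_measurable ?N"
    unfolding d_def using borel_measurable_diff[OF upd us'] by simp
  have h: "h \<in> borel_measurable ?N"
    unfolding h_def using dm wt by simp
  have cond: "AE \<omega> in M. real_cond_exp M (\<F> k) (indicator {\<omega>\<in>space M. S (Suc k) \<omega> \<in> B}) \<omega>
      = measure (current_law k \<omega>) B" if "B \<in> sets subspace_algebra" for B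
  proof -
    have "AE \<omega> in M. real_cond_exp M (\<F> k) (indicator {\<omega>\<in>space M. S (Suc k) \<omega> \<in> B}) \<omega>
        = measure (law (cycle (A \<omega>) (Suc k)) \<omega>) B"
      using randomness that unfolding arpsd_randomness_def by blast
    then show ?thesis
      by (rule AE_mp) (auto intro!: AE_I2 simp: current_law_def adaptive_path.cyc_def[OF path])
  qed
  have "(\<integral>\<^sup>+\<omega>. ennreal (raw_err k \<omega>) / ennreal (raw_weight k \<omega>) \<partial>M) = (\<integral>\<^sup>+\<omega>. h (\<omega>, S (Suc k) \<omega>) \<partial>M)"
    by (intro nn_integral_cong) (simp add: h_def d_def err_eq(2))
  also have "\<dots> = (\<integral>\<^sup>+\<omega>. (\<integral>\<^sup>+G. h (\<omega>, G) \<partial>current_law k \<omega>) \<partial>M)"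
    by (rule conditional_law_disintegration[OF prob_space_axioms subalgebra_filtration
          S_measurable current_law_measurable cond h]) simp_all
  also have "\<dots> \<le> (\<integral>\<^sup>+\<omega>. ennreal (err k \<omega>) / ennreal (weight k \<omega>) \<partial>M)"
  proof (rule nn_integral_mono)
    fix \<omega> assume \<omega>: "\<omega> \<in> space M"
    define \<rho> where "\<rho> = 1 - alpha \<gamma> \<mu> L (current_proj k \<omega>)"
    have \<rho>: "0 \<le> \<rho>" using alpha_bounds(2)[OF current_proj_subunit_pd[OF \<omega>, of k]] by (simp add: \<rho>_def)
    have K: "current_law k \<omega> \<in> space (prob_algebra subspace_algebra)" "admissible (current_law k \<omega>)"
      unfolding current_law_def using law_valid[OF \<omega>] by blast+
    have setsK: "sets (current_law k \<omega>) = sets subspace_algebra" using law_prob_space(2)[OF K(1)] .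
    have "d \<omega> \<in> borel_measurable subspace_algebra"
      using measurable_compose[OF measurable_Pair1'[of \<omega> "\<F> k" subspace_algebra] dm] \<omega>
      by (simp add: space_filtration)
    then have dK: "d \<omega> \<in> borel_measurable (current_law k \<omega>)"
      using measurable_cong_sets[OF setsK refl] by blast
    have "(\<integral>\<^sup>+G. h (\<omega>, G) \<partial>current_law k \<omega>) = (\<integral>\<^sup>+G. d \<omega> G \<partial>current_law k \<omega>) / ennreal (raw_weight k \<omega>)"
      unfolding h_def using dK by (simp add: nn_integral_divide)
    also have "(\<integral>\<^sup>+G. d \<omega> G \<partial>current_law k \<omega>) \<le> ennreal (\<rho> * err k \<omega>)"
      using expected_contraction[OF K, of "z k \<omega>"]
      by (simp add: d_def update_def Let_def \<rho>_def err_eq(1)[OF \<omega>] current_proj_def)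
    finally have "(\<integral>\<^sup>+G. h (\<omega>, G) \<partial>current_law k \<omega>) \<le> ennreal (\<rho> * err k \<omega>) / ennreal (raw_weight k \<omega>)"
      by (simp add: divide_right_mono_ennreal)
    also have "\<dots> \<le> ennreal (err k \<omega>) / ennreal (weight k \<omega>)"
    \<comment> \<open>If \<open>\<alpha> = 1\<close> then the new error vanishes and the quotient is \<open>0 / 0 = 0\<close>.\<close>
    proof (cases "\<rho> = 0")
      case True
      then have "ennreal (\<rho> * err k \<omega>) / ennreal (raw_weight k \<omega>) = 0"
        by (simp only: mult_zero_left ennreal_0 ennreal_zero_divide)
      then show ?thesis by (simp only: zero_le)
    next
      case False
      then have "0 < \<rho>" using \<rho> by simp
      then have w: "0 < weight k \<omega>" "raw_weight k \<omega> = \<rho> * weight k \<omega>"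
        using \<beta>_lt_1 unfolding err_eq[OF \<omega>] \<rho>_def[symmetric] by simp_all
      show ?thesis
        using w \<open>0 < \<rho>\<close> by (intro ennreal_quotient_mono) (auto simp: err_eq(1)[OF \<omega>])
    qed
    finally show "(\<integral>\<^sup>+G. h (\<omega>, G) \<partial>current_law k \<omega>) \<le> ennreal (err k \<omega>) / ennreal (weight k \<omega>)" .
  qed
  finally show ?thesis .
qed

lemma expected_quotient_le:
  "(\<integral>\<^sup>+\<omega>. ennreal (err k \<omega>) / ennreal (weight k \<omega>) \<partial>M)
    \<le> ennreal ((norm (z0 - inv_sqrt (avg_proj \<nu>0) *v us))\<^sup>2)"
proof (induction k)
  case 0
  have "(\<integral>\<^sup>+\<omega>. ennreal (err 0 \<omega>) / ennreal (weight 0 \<omega>) \<partial>M)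
      = (\<integral>\<^sup>+\<omega>. ennreal ((norm (z0 - inv_sqrt (avg_proj \<nu>0) *v us))\<^sup>2) \<partial>M)"
  proof (rule nn_integral_cong)
    fix \<omega> assume \<omega>: "\<omega> \<in> space M"
    have "weight 0 \<omega> = 1" by (rule adaptive_path.weight_0[OF path[OF \<omega>]])
    moreover have "err 0 \<omega> = (norm (z0 - inv_sqrt (avg_proj \<nu>0) *v us))\<^sup>2"
      unfolding adaptive_path.err_def[OF path[OF \<omega>]] adaptive_path.cyc_0[OF path[OF \<omega>]]
        adaptive_path.zvec_0[OF path[OF \<omega>]] law_0[OF \<omega>] ..
    ultimately show "ennreal (err 0 \<omega>) / ennreal (weight 0 \<omega>)
        = ennreal ((norm (z0 - inv_sqrt (avg_proj \<nu>0) *v us))\<^sup>2)"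
      by (simp only: ennreal_1 divide_ennreal_def ennreal_inverse_1 mult_1_right)
  qed
  then show ?case by (simp add: emeasure_space_1)
next
  case (Suc k)
  have "(\<integral>\<^sup>+\<omega>. ennreal (err (Suc k) \<omega>) / ennreal (weight (Suc k) \<omega>) \<partial>M)
      \<le> (\<integral>\<^sup>+\<omega>. ennreal (raw_err k \<omega>) / ennreal (raw_weight k \<omega>) \<partial>M)"
    by (intro nn_integral_mono adaptive_path.err_quotient_le[OF path])
  also note expected_raw_quotient_le
  also note Suc
  finally show ?case .
qed

lemma expected_iterate_quotient_le:
  "(\<integral>\<^sup>+\<omega>. ennreal ((norm (xp k \<omega> - xs))\<^sup>2)
      / ennreal (rate_factor \<gamma> \<mu> L \<beta> (\<lambda>l. law l \<omega>) (A \<omega>) k (cycle (A \<omega>) k)) \<partial>M)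
    \<le> ennreal ((norm (z0 - inv_sqrt (avg_proj \<nu>0) *v us))\<^sup>2)"
proof (cases k)
  case 0
  have "ennreal ((norm (xp 0 \<omega> - xs))\<^sup>2)
      / ennreal (rate_factor \<gamma> \<mu> L \<beta> (\<lambda>l. law l \<omega>) (A \<omega>) 0 (cycle (A \<omega>) 0))
    \<le> ennreal ((norm (z0 - inv_sqrt (avg_proj \<nu>0) *v us))\<^sup>2)" if "\<omega> \<in> space M" for \<omega>
    using adaptive_path.prox_error_0[OF path[OF that]] law_0[OF that]
    by (simp add: adaptive_path.rate_factor_0[OF path[OF that]] divide_ennreal_def power_mono ennreal_leI)
  then have "(\<integral>\<^sup>+\<omega>. ennreal ((norm (xp 0 \<omega> - xs))\<^sup>2)
      / ennreal (rate_factor \<gamma> \<mu> L \<beta> (\<lambda>l. law l \<omega>) (A \<omega>) 0 (cycle (A \<omega>) 0)) \<partial>M)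
    \<le> (\<integral>\<^sup>+\<omega>. ennreal ((norm (z0 - inv_sqrt (avg_proj \<nu>0) *v us))\<^sup>2) \<partial>M)"
    by (intro nn_integral_mono)
  then show ?thesis unfolding 0 by (simp add: emeasure_space_1)
next
  case (Suc j)
  have "(\<integral>\<^sup>+\<omega>. ennreal ((norm (xp (Suc j) \<omega> - xs))\<^sup>2)
      / ennreal (rate_factor \<gamma> \<mu> L \<beta> (\<lambda>l. law l \<omega>) (A \<omega>) (Suc j) (cycle (A \<omega>) (Suc j))) \<partial>M)
    \<le> (\<integral>\<^sup>+\<omega>. ennreal (raw_err j \<omega>) / ennreal (raw_weight j \<omega>) \<partial>M)"
    by (intro nn_integral_mono adaptive_path.prox_error_quotient_le[OF path]) simp_all
  also note expected_raw_quotient_le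
  also note expected_quotient_le
  finally show ?thesis unfolding Suc .
qed

lemma iterate_measurable: "xp k \<in> borel_measurable M"
proof -
  have "1-lipschitz_on UNIV (prox \<gamma> g)"
    using prox_nonexpansive by (simp add: lipschitz_on_def dist_norm)
  then have prox: "continuous_on UNIV (prox \<gamma> g)" by (rule lipschitz_on_continuous_on)
  have pd: "subunit_pd (current_proj k \<omega>)" if "\<omega> \<in> space (\<F> k)" for \<omega>
    using that current_proj_subunit_pd by (simp add: space_filtration)
  have "(\<lambda>\<omega>. mat_sqrt (current_proj k \<omega>) *v z k \<omega>) \<in> borel_measurable (\<F> k)"
    by (rule borel_measurable_matrix_vector_mult[OF borel_measurable_mat_sqrt[OF current_proj_measurable] z_measurable]) (rule pd)
  then have meas: "(\<lambda>\<omega>. prox \<gamma> g (mat_sqrt (current_proj k \<omega>) *v z k \<omega>)) \<in> borel_measurable (\<F> k)"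
    by (rule borel_measurable_continuous_on[OF prox])
  have "xp k \<omega> = prox \<gamma> g (mat_sqrt (current_proj k \<omega>) *v z k \<omega>)" if "\<omega> \<in> space M" for \<omega>
    using adaptive_path.path_invariant[OF path[OF that]] current_proj_eq[of \<omega> k] by simp
  from this meas have "xp k \<in> borel_measurable (\<F> k)" by (rule adapted_cong)
  then show ?thesis by (rule measurable_from_subalg[OF subalgebra_filtration])
qed

end

section \<open>Expected convergence\<close>

context adaptive_run
begin

abbreviation "rate k \<omega> \<equiv> rate_factor \<gamma> \<mu> L \<beta> (\<lambda>l. law l \<omega>) (A \<omega>) k (cycle (A \<omega>) k)"

lemma rate_bounds:
  assumes \<omega>: "\<omega> \<in> space M"
  shows "0 \<le> rate k \<omega>" "rate k \<omega> \<le> 1"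
proof -
  have "0 \<le> 1 - \<beta>" "1 - \<beta> \<le> 1"
    using \<beta>_lt_1 lam_pos \<kappa>_bounds \<gamma>_pos \<mu>_pos \<mu>_le_L by (auto simp: \<beta>_eq)
  moreover have "0 \<le> 1 - alpha \<gamma> \<mu> L (Ps \<omega> l)" "1 - alpha \<gamma> \<mu> L (Ps \<omega> l) \<le> 1" for l
    using alpha_bounds[OF Ps_subunit_pd[OF \<omega>, of l]] by simp_all
  ultimately show "0 \<le> rate k \<omega>" "rate k \<omega> \<le> 1"
    unfolding rate_factor_def by (auto intro!: mult_le_one power_le_one)
qed

lemma rate_measurable: "rate k \<in> borel_measurable M"
proof (cases k)
  case 0
  have "rate 0 \<omega> = 1" if "\<omega> \<in> space M" for \<omega> by (rule adaptive_path.rate_factor_0[OF path[OF that]])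
  then show ?thesis unfolding 0 by (subst measurable_cong[where g="\<lambda>_. 1"]) simp_all
next
  case (Suc j)
  have "(\<lambda>\<omega>. lambda_min (current_proj j \<omega>)) \<in> borel_measurable (\<F> j)"
    by (rule borel_measurable_lambda_min[OF current_proj_measurable])
      (use current_proj_subunit_pd in \<open>simp add: space_filtration subunit_pd_def\<close>)
  then have u: "(\<lambda>\<omega>. 1 - alpha \<gamma> \<mu> L (current_proj j \<omega>)) \<in> borel_measurable (\<F> j)"
    unfolding alpha_eq by simp
  have n: "(\<lambda>\<omega>. Suc j - enumerate (A \<omega>) (cyc j \<omega>)) \<in> \<F> j \<rightarrow>\<^sub>M count_space UNIV"
  proof (rule function_of_past_adaptations_measurable)
    fix \<omega> assume \<omega>: "\<omega> \<in> space M"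
    show "Suc j - enumerate (A \<omega>) (cyc j \<omega>) = (\<lambda>D. Suc j - Max D) (A \<omega> \<inter> {..Suc j})"
      unfolding adaptive_path.cyc_def[OF path[OF \<omega>]] enumerate_cycle_eq_Max[OF adaptation_times(1,2)[OF \<omega>]] ..
  qed
  have m: "(\<lambda>\<omega>. (1 - alpha \<gamma> \<mu> L (current_proj j \<omega>)) ^ (Suc j - enumerate (A \<omega>) (cyc j \<omega>)) * (1 - \<beta>) ^ cyc j \<omega>)
      \<in> borel_measurable (\<F> j)"
    by (intro borel_measurable_times power_adapted cyc_measurable u n) simp
  have "rate k \<omega> = (1 - alpha \<gamma> \<mu> L (current_proj j \<omega>)) ^ (Suc j - enumerate (A \<omega>) (cyc j \<omega>)) * (1 - \<beta>) ^ cyc j \<omega>"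
    if "\<omega> \<in> space M" for \<omega>
    unfolding Suc rate_factor_def current_proj_def current_law_def adaptive_path.cyc_def[OF path[OF that]] ..
  from this m have "rate k \<in> borel_measurable (\<F> j)" by (rule adapted_cong)
  then show ?thesis by (rule measurable_from_subalg[OF subalgebra_filtration])
qed

text \<open>Multiply the bound on the expected quotient by \<open>r\<close>. Where the rate vanishes, finiteness of the
  quotient forces the error to vanish.\<close>

lemma expected_iterate_le:
  assumes r: "AE \<omega> in M. rate k \<omega> \<le> r"
  defines "X \<equiv> \<lambda>\<omega>. (norm (xp k \<omega> - xs))\<^sup>2"
  shows "integrable M X" and "expectation X \<le> r * (norm (z0 - inv_sqrt (avg_proj \<nu>0) *v us))\<^sup>2"
proof -
  define C0 where "C0 = (norm (z0 - inv_sqrt (avg_proj \<nu>0) *v us))\<^sup>2"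
  define q where "q \<omega> = ennreal (X \<omega>) / ennreal (rate k \<omega>)" for \<omega>
  have X: "X \<in> borel_measurable M" "\<And>\<omega>. 0 \<le> X \<omega>"
    unfolding X_def using iterate_measurable[of k] by simp_all
  have q: "q \<in> borel_measurable M" unfolding q_def using X rate_measurable by simp
  have qle: "(\<integral>\<^sup>+\<omega>. q \<omega> \<partial>M) \<le> ennreal C0"
    unfolding q_def X_def C0_def by (rule expected_iterate_quotient_le)
  have r0: "0 \<le> r"
  proof (rule ccontr)
    assume neg: "\<not> 0 \<le> r"
    have "AE \<omega> in M. False" using r AE_space
      proof eventually_elim
      case (elim \<omega>)
      then show ?case using rate_bounds(1)[OF elim(2), of k] neg by linarith
    qed
    then show False by simp
  qed
  have "AE \<omega> in M. q \<omega> \<noteq> \<infinity>"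
    using q qle by (intro nn_integral_PInf_AE) (auto simp: top_unique)
  then have "AE \<omega> in M. ennreal (X \<omega>) \<le> ennreal r * q \<omega>"
    using r AE_space
  proof eventually_elim
    case (elim \<omega>)
    show ?case
    proof (cases "rate k \<omega> = 0")
      case True
      then have "ennreal (X \<omega>) = 0" using elim(1) by (simp add: q_def split: if_splits)
      then show ?thesis by (simp only: zero_le)
    next
      case False
      then have pos: "0 < rate k \<omega>" using rate_bounds(1)[OF elim(3), of k] by simp
      then have "X \<omega> * rate k \<omega> \<le> X \<omega> * r" using elim(2) X(2) by (intro mult_left_mono)
      then have "X \<omega> \<le> r * (X \<omega> / rate k \<omega>)" using pos by (simp add: pos_le_divide_eq mult.commute)
      then show ?thesis
        using pos r0 X(2) by (simp add: q_def divide_ennreal ennreal_mult[symmetric] ennreal_leI)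
    qed
  qed
  then have "(\<integral>\<^sup>+\<omega>. ennreal (X \<omega>) \<partial>M) \<le> (\<integral>\<^sup>+\<omega>. ennreal r * q \<omega> \<partial>M)" by (rule nn_integral_mono_AE)
  also have "\<dots> = ennreal r * (\<integral>\<^sup>+\<omega>. q \<omega> \<partial>M)" by (rule nn_integral_cmult[OF q])
  also have "\<dots> \<le> ennreal r * ennreal C0" using qle by (rule mult_left_mono) simp
  also have "\<dots> = ennreal (r * C0)" using r0 by (simp add: C0_def ennreal_mult)
  finally have le: "(\<integral>\<^sup>+\<omega>. ennreal (X \<omega>) \<partial>M) \<le> ennreal (r * C0)" .
  then show int: "integrable M X"
    using X by (intro integrableI_nonneg) (auto simp: le_less_trans)
  have "ennreal (expectation X) \<le> ennreal (r * C0)"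
    using le by (simp add: nn_integral_eq_integral[OF int] X(2))
  then show "expectation X \<le> r * (norm (z0 - inv_sqrt (avg_proj \<nu>0) *v us))\<^sup>2"
    using r0 by (simp add: C0_def)
qed

end

theorem theorem3:
  fixes f :: "real^'n \<Rightarrow> real" and g :: "real^'n \<Rightarrow> ereal"
    and L \<mu> \<gamma> lam \<beta> :: real and z0 xs :: "real^'n"
    and M :: "'w measure" and C :: "(real^'n) set set"
    and S :: "nat \<Rightarrow> 'w \<Rightarrow> (real^'n) set"
    and \<nu>0 :: "(real^'n) set measure"
    and law :: "nat \<Rightarrow> 'w \<Rightarrow> (real^'n) set measure"
    and A :: "'w \<Rightarrow> nat set" and c :: "nat \<Rightarrow> 'w \<Rightarrow> nat"
    and x :: "nat \<Rightarrow> 'w \<Rightarrow> real^'n" and k :: nat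
  assumes "L_smooth L f" and "\<mu> > 0" and "strongly_convex \<mu> f"
    and "convex_fun g" and "proper_fun g" and "lower_semicont g"
    and "\<forall>y. is_arg_min (\<lambda>x. ereal (f x) + g x) (\<lambda>_. True) y \<longleftrightarrow> y = xs"
    and "0 < \<gamma>" and "\<gamma> \<le> 2 / (\<mu> + L)"
    and "lam > 0" and "\<beta> = \<gamma> * \<mu> * L * lam / (\<mu> + L)"
    and "prob_space M" and "covering C"
    and "arpsd_randomness M C S \<nu>0 law A"
    and "adaptation_strategy \<gamma> \<mu> L lam \<beta> M S law A c"
    and "\<forall>k. \<forall>\<omega>\<in>space M. x (Suc k) \<omega> =
      fst (arpsd f g \<gamma> (\<lambda>l. inv_sqrt (avg_proj (law l \<omega>))) (\<lambda>j. S j \<omega>) (A \<omega>) z0 k)"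
  shows "integrable M (\<lambda>\<omega>. (norm (x (Suc k) \<omega> - xs))\<^sup>2) \<and>
    (\<forall>r. (AE \<omega> in M. \<forall>l. enumerate (A \<omega>) l \<le> k \<and> k < enumerate (A \<omega>) (Suc l) \<longrightarrow>
             rate_factor \<gamma> \<mu> L \<beta> (\<lambda>l. law l \<omega>) (A \<omega>) k l \<le> r) \<longrightarrow>
         prob_space.expectation M (\<lambda>\<omega>. (norm (x (Suc k) \<omega> - xs))\<^sup>2)
           \<le> r * (norm (z0 - inv_sqrt (avg_proj \<nu>0) *v (xs - \<gamma> *\<^sub>R grad f xs)))\<^sup>2) \<and>
    (\<integral>\<^sup>+\<omega>. ennreal ((norm (x (Suc k) \<omega> - xs))\<^sup>2)
            / ennreal (rate_factor \<gamma> \<mu> L \<beta> (\<lambda>l. law l \<omega>) (A \<omega>) k (cycle (A \<omega>) k)) \<partial>M)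
         \<le> ennreal ((norm (z0 - inv_sqrt (avg_proj \<nu>0) *v (xs - \<gamma> *\<^sub>R grad f xs)))\<^sup>2)"
proof -
  interpret composite_problem f g L \<mu> \<gamma> xs
    using assms(1-9) by unfold_locales blast+
  interpret prob_space M by fact
  interpret adaptive_run f g L \<mu> \<gamma> xs M C S \<nu>0 law A c lam \<beta> z0
    by unfold_locales fact+
  have x: "x (Suc k) \<omega> = xp k \<omega>" if "\<omega> \<in> space M" for \<omega>
    using assms(16) that by (simp add: adaptive_path.xpt_def[OF path])
  have int_cong: "integrable M (\<lambda>\<omega>. (norm (x (Suc k) \<omega> - xs))\<^sup>2) \<longleftrightarrow> integrable M (\<lambda>\<omega>. (norm (xp k \<omega> - xs))\<^sup>2)"
    using x by (intro Bochner_Integration.integrable_cong) simp_all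
  have exp_eq: "expectation (\<lambda>\<omega>. (norm (x (Suc k) \<omega> - xs))\<^sup>2) = expectation (\<lambda>\<omega>. (norm (xp k \<omega> - xs))\<^sup>2)"
    using x by (intro Bochner_Integration.integral_cong) simp_all
  have "AE \<omega> in M. rate k \<omega> \<le> 1" using rate_bounds(2) by (intro AE_I2)
  then have "integrable M (\<lambda>\<omega>. (norm (x (Suc k) \<omega> - xs))\<^sup>2)"
    unfolding int_cong by (rule expected_iterate_le(1))
  moreover have "expectation (\<lambda>\<omega>. (norm (x (Suc k) \<omega> - xs))\<^sup>2)
      \<le> r * (norm (z0 - inv_sqrt (avg_proj \<nu>0) *v (xs - \<gamma> *\<^sub>R grad f xs)))\<^sup>2"
    if r: "AE \<omega> in M. \<forall>l. enumerate (A \<omega>) l \<le> k \<and> k < enumerate (A \<omega>) (Suc l) \<longrightarrow>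
             rate_factor \<gamma> \<mu> L \<beta> (\<lambda>l. law l \<omega>) (A \<omega>) k l \<le> r" for r
  proof -
    have "AE \<omega> in M. rate k \<omega> \<le> r"
      using r AE_space
    proof eventually_elim
      case (elim \<omega>)
      then show ?case using cycle_iff[OF adaptation_times(1,2)[OF elim(2)], of "cycle (A \<omega>) k" k] by blast
    qed
    then show ?thesis unfolding exp_eq us_def[symmetric] by (rule expected_iterate_le(2))
  qed
  moreover have "(\<integral>\<^sup>+\<omega>. ennreal ((norm (x (Suc k) \<omega> - xs))\<^sup>2) / ennreal (rate k \<omega>) \<partial>M)
      \<le> ennreal ((norm (z0 - inv_sqrt (avg_proj \<nu>0) *v (xs - \<gamma> *\<^sub>R grad f xs)))\<^sup>2)"
  proof -
    have "(\<integral>\<^sup>+\<omega>. ennreal ((norm (x (Suc k) \<omega> - xs))\<^sup>2) / ennreal (rate k \<omega>) \<partial>M)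
        = (\<integral>\<^sup>+\<omega>. ennreal ((norm (xp k \<omega> - xs))\<^sup>2) / ennreal (rate k \<omega>) \<partial>M)"
      using x by (intro nn_integral_cong) simp
    also note expected_iterate_quotient_le
    finally show ?thesis unfolding us_def .
  qed
  ultimately show ?thesis by blast
qed

end
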